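(* Let $\beta>-2$. For every $n\ge2$, $$L_n\stackrel{d}{=}K_{n-1}.$$ Moreover, there is a coupling in which $K_{n-1}$ equals the discrete height of label $1$ almost surely.
   Context: For $\beta>-2$ put $\phi_\beta(z)=\int_0^1(1-s^z)s^{\beta+1}(1-s)^\beta\,ds$, and let $\xi=(\xi_t)_{t\ge0}$ be the (driftless) subordinator with $\mathsf E e^{-z\xi_t}=e^{-t\phi_\beta(z)}$, $\operatorname{Re}z\ge0$. $B$ denotes the beta function. Let $\Pi=(\Pi(t))_{t\ge0}$ be the homogeneous exchangeable fragmentation of $\mathbb N$ (started from one block, different blocks evolving independently with the same law) without erosion, conservative and binary, with dislocation measure $\nu_\beta(dx)=x^\beta(1-x)^\beta\,dx$ on $[1/2,1)$. Its restriction $\Pi_n$ to $[n]=\{1,\dots,n\}$ is the continuous-time beta-splitting tree on $n$ leaves: different blocks evolve independently, and a block with $m\ge2$ labels splits into ordered daughter blocks of sizes $i$ and $m-i$ at rate $\frac12\binom mi B(i+\beta+1,m-i+\beta+1)$, $1\le i\le m-1$ (total rate $\phi_\beta(m-1)$), with the labels of the first block uniform given its size. If $\Pi_1(t)$ is the block of $\Pi(t)$ containing label $1$, its asymptotic frequency process can be written $|\Pi_1(t)|=e^{-\xi_t}$, where $\xi$ is the driftless subordinator with Laplace exponent $\phi_\beta$, that is, $\mathsf E e^{-z\xi_t}=e^{-t\phi_\beta(z)}$ for $\operatorname{Re}z\ge0$. The discrete height of a leaf in the tree on $[n]$ is the number of splits of blocks of $\Pi_n$ containing it before it becomes a singleton;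 $L_n$ is the discrete height of a uniformly chosen leaf. Occupied gaps: let $E_1,E_2,\dots$ be iid exponential random variables of rate $1$, independent of $\xi$. The gaps are the disjoint open intervals composing the complement in $[0,\infty)$ of the closed range $\overline{\{\xi_t:t\ge0\}}$ (they correspond to the jumps of $\xi$); almost surely every $E_j$ lies in a gap. For $m\ge1$, $K_m$ is the number of gaps containing at least one of $E_1,\dots,E_m$. *)

theory Defs
  imports "HOL-Probability.Probability" "HOL-Combinatorics.Combinatorics"
begin

section \<open>The subordinator and its occupied gaps\<close>

definition phi :: "real \<Rightarrow> complex \<Rightarrow> complex" where
  "phi \<beta> z = (LINT s:{0<..<1}|lborel.
     (1 - of_real s powr z) * of_real (s powr (\<beta> + 1) * (1 - s) powr \<beta>))"

text \<open>
  A (never killed) subordinator: a non-decreasing right-continuous process started at 0 with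
  stationary independent increments; left limits exist by monotonicity. Its law is
  prescribed by the Laplace exponent \<open>\<psi>\<close> on the closed right half-plane; a drift \<open>d\<close> would show
  up as a summand \<open>d * z\<close> of \<open>\<psi> z\<close>.
\<close>

locale subordinator = prob_space M
  for M :: "'a measure" and \<psi> :: "complex \<Rightarrow> complex" and \<xi> :: "real \<Rightarrow> 'a \<Rightarrow> real" +
  assumes random_variable_xi: "0 \<le> t \<Longrightarrow> \<xi> t \<in> borel_measurable M"
    and start: "\<omega> \<in> space M \<Longrightarrow> \<xi> 0 \<omega> = 0"
    and nondecreasing: "\<omega> \<in> space M \<Longrightarrow> mono_on {0..} (\<lambda>t. \<xi> t \<omega>)"
    and right_continuous:
      "\<omega> \<in> space M \<Longrightarrow> 0 \<le> t \<Longrightarrow> continuous (at_right t) (\<lambda>s. \<xi> s \<omega>)"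
    and stationary_increments:
      "0 \<le> s \<Longrightarrow> 0 \<le> t \<Longrightarrow> distr M borel (\<lambda>\<omega>. \<xi> (s + t) \<omega> - \<xi> s \<omega>) = distr M borel (\<xi> t)"
    and independent_increments:
      "0 \<le> \<tau> 0 \<Longrightarrow> mono \<tau> \<Longrightarrow>
       indep_vars (\<lambda>_. borel) (\<lambda>i \<omega>. \<xi> (\<tau> (Suc i)) \<omega> - \<xi> (\<tau> i) \<omega>) {..<k::nat}"
    and laplace_exponent:
      "0 \<le> t \<Longrightarrow> 0 \<le> Re z \<Longrightarrow>
       (LINT \<omega>|M. exp (- (z * of_real (\<xi> t \<omega>)))) = exp (- (of_real t * \<psi> z))"

locale sampled_subordinator = subordinator +
  fixes E :: "nat \<Rightarrow> 'a \<Rightarrow> real"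
  assumes exponential: "1 \<le> j \<Longrightarrow> distributed M lborel (E j) (exponential_density 1)"
    and independent_sample: "indep_vars (\<lambda>_. borel) E {1..}"
    and sample_indep_xi:
      "indep_set
         (sets (vimage_algebra (space M) (\<lambda>\<omega>. \<lambda>t\<in>{0..}. \<xi> t \<omega>) (\<Pi>\<^sub>M t\<in>{0..}. borel)))
         (sets (vimage_algebra (space M) (\<lambda>\<omega>. \<lambda>j\<in>{1..}. E j \<omega>) (\<Pi>\<^sub>M j\<in>{1..}. borel)))"

definition gaps :: "(real \<Rightarrow> real) \<Rightarrow> real set set" where
  "gaps x = components ({0..} - closure (x ` {0..}))"

definition occupied_gaps :: "(real \<Rightarrow> 'a \<Rightarrow> real) \<Rightarrow> (nat \<Rightarrow> 'a \<Rightarrow> real) \<Rightarrow> nat \<Rightarrow> 'a \<Rightarrow> nat" where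
  "occupied_gaps \<xi> E m \<omega> = card {G \<in> gaps (\<lambda>t. \<xi> t \<omega>). \<exists>j\<in>{1..m}. E j \<omega> \<in> G}"


section \<open>Homogeneous fragmentations of the positive integers\<close>

definition restr :: "'i set \<Rightarrow> 'i set set \<Rightarrow> 'i set set" where
  "restr B P = (\<inter>) B ` P - {{}}"

text \<open>
  Kingman's paintbox with two colours of masses \<open>x\<close> and \<open>1 - x\<close>, restricted to \<open>{1..n}\<close>.
\<close>

definition paintbox :: "real \<Rightarrow> nat \<Rightarrow> nat set set pmf" where
  "paintbox x n =
     map_pmf (\<lambda>c. {{j\<in>{1..n}. c j}, {j\<in>{1..n}. \<not> c j}} - {{}})
       (Pi_pmf {1..n} False (\<lambda>_. bernoulli_pmf x))"

text \<open>
  A homogeneous exchangeable fragmentation, binary, conservative and without erosion, with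
  dislocation measure \<open>\<nu>\<close> on \<open>[1/2, 1)\<close>; the atom \<open>x\<close> stands for the mass partition \<open>(x, 1 - x)\<close>.

  \<^item> The semigroup acts as follows: given the past up to time \<open>s\<close>, every block \<open>B\<close> of the partition
    at time \<open>s\<close> is partitioned during \<open>[s, s + t]\<close>, independently of the other blocks, by
    (the trace on \<open>B\<close> of) a copy of the exchangeable partition \<open>P t\<close>. It suffices
    to say so for the restrictions to \<open>{1..n}\<close>, as these determine the law of a partition.
  \<^item> The dislocation measure is read off from the jump rates out of the one-block partition:
    without erosion, \<open>{1..n}\<close> splits into \<open>\<pi>\<close> at rate \<open>\<integral> Pr(paintbox x n = \<pi>) \<nu>(dx)\<close>. The
    integral is finite, since \<open>\<pi>\<close> is nontrivial, whenever \<open>\<integral> (1 - x) \<nu>(dx) < \<infinity>\<close>.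
\<close>

locale homogeneous_fragmentation = prob_space M
  for M :: "'a measure" and \<nu> :: "real measure" and P :: "real \<Rightarrow> 'a \<Rightarrow> nat set set" +
  assumes partition: "\<omega> \<in> space M \<Longrightarrow> 0 \<le> t \<Longrightarrow> partition_on {1..} (P t \<omega>)"
    and random_variable_restr:
      "0 \<le> t \<Longrightarrow> (\<lambda>\<omega>. restr {1..n} (P t \<omega>)) \<in> measurable M (count_space UNIV)"
    and one_block: "\<omega> \<in> space M \<Longrightarrow> P 0 \<omega> = {{1..}}"
    and refining:
      "\<omega> \<in> space M \<Longrightarrow> 0 \<le> s \<Longrightarrow> s \<le> t \<Longrightarrow> refines {1..} (P t \<omega>) (P s \<omega>)"
    and right_continuous:
      "\<omega> \<in> space M \<Longrightarrow> 0 \<le> t \<Longrightarrow>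
       eventually (\<lambda>s. restr {1..n} (P s \<omega>) = restr {1..n} (P t \<omega>)) (at_right t)"
    and exchangeable:
      "0 \<le> t \<Longrightarrow> p permutes {1..n} \<Longrightarrow>
       prob {\<omega> \<in> space M. restr {1..n} (P t \<omega>) = (`) p ` \<pi>} =
       prob {\<omega> \<in> space M. restr {1..n} (P t \<omega>) = \<pi>}"
    and branching:
      "0 \<le> s \<Longrightarrow> 0 \<le> t \<Longrightarrow> partition_on {1..n} \<pi> \<Longrightarrow> partition_on {1..n} \<sigma> \<Longrightarrow>
       H \<in> sigma_sets (space M)
             {{\<omega> \<in> space M. restr {1..m} (P u \<omega>) = \<rho>} |m u \<rho>. 0 \<le> u \<and> u \<le> s} \<Longrightarrow>
       prob {\<omega> \<in> H. restr {1..n} (P s \<omega>) = \<pi> \<and> restr {1..n} (P (s + t) \<omega>) = \<sigma>} =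
       prob {\<omega> \<in> H. restr {1..n} (P s \<omega>) = \<pi>} *
         (if refines {1..n} \<sigma> \<pi>
          then \<Prod>B\<in>\<pi>. prob {\<omega> \<in> space M. restr B (P t \<omega>) = restr B \<sigma>}
          else 0)"
    and dislocation:
      "2 \<le> n \<Longrightarrow> partition_on {1..n} \<pi> \<Longrightarrow> \<pi> \<noteq> {{1..n}} \<Longrightarrow>
       ((\<lambda>t. prob {\<omega> \<in> space M. restr {1..n} (P t \<omega>) = \<pi>} / t) \<longlongrightarrow>
         (LINT x|\<nu>. pmf (paintbox x n) \<pi>)) (at_right 0)"

definition nu :: "real \<Rightarrow> real measure" where
  "nu \<beta> = density lborel
     (\<lambda>x. ennreal (indicator {1/2..<1} x * (x powr \<beta> * (1 - x) powr \<beta>)))"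

definition block_of :: "nat \<Rightarrow> nat set set \<Rightarrow> nat set" where
  "block_of j P = \<Union>{B\<in>P. j \<in> B}"

text \<open>
  The restricted paths are step functions, so \<open>t\<close> is a split time of label \<open>j\<close> iff the block
  of \<open>j\<close> at time \<open>t\<close> differs from that at times just before \<open>t\<close>. Singletons
  do not split, so all split times precede (or are) the time at which \<open>j\<close> becomes a singleton.
\<close>

definition discrete_height ::
  "(real \<Rightarrow> 'a \<Rightarrow> nat set set) \<Rightarrow> nat \<Rightarrow> nat \<Rightarrow> 'a \<Rightarrow> nat" where
  "discrete_height P n j \<omega> =
     card {t. 0 < t \<and>
       \<not> eventually (\<lambda>s. block_of j (restr {1..n} (P s \<omega>)) = block_of j (restr {1..n} (P t \<omega>)))
           (at_left t)}"


section \<open>Equality in distribution\<close>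

definition same_law :: "'a measure \<Rightarrow> ('a \<Rightarrow> nat) \<Rightarrow> 'b measure \<Rightarrow> ('b \<Rightarrow> nat) \<Rightarrow> bool" where
  "same_law M X N Y \<longleftrightarrow>
     X \<in> measurable M (count_space UNIV) \<and> Y \<in> measurable N (count_space UNIV) \<and>
     distr M (count_space UNIV) X = distr N (count_space UNIV) Y"

end

theory Submission
  imports Defs
begin

text \<open>
  Fix a label \<open>j\<close> and call \<open>k\<close> alive at time \<open>t\<close> if \<open>k\<close> still shares the block of \<open>j\<close> at time \<open>t\<close>; on the
  side of the subordinator call \<open>k\<close> alive at time \<open>t\<close> if \<open>\<xi> t < E k\<close>. On both sides the set of living
  labels among \<open>n - 1\<close> labels other than \<open>j\<close> is a decreasing right-continuous step function of \<open>t\<close>,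
  and on both sides the number that is counted is the number of times at which this set jumps. For the
  fragmentation this is the definition of the discrete height. For the subordinator, two points lie
  in the same gap iff \<open>\<xi>\<close> passes them by the same jump, that is, at the same time. So the theorem
  follows once the two set-valued processes are known to have the same law.

  That law is computed from the probabilities that all labels of a set
  \<open>A i\<close> are alive at time \<open>\<tau> i\<close>, for times \<open>0 = \<tau> 0 \<le> \<tau> 1 \<le> \<dots>\<close> and sets \<open>A 1 \<supseteq> A 2 \<supseteq> \<dots>\<close>. These events are stable
  under intersection and generate everything, and on both sides they have, with \<open>split_rate\<close> for \<open>\<phi>\<close>, the probability
  \<open>\<Prod>i. exp (- (\<tau> (i + 1) - \<tau> i) * \<phi> (card (A (i + 1))))\<close>. For the subordinator (\<open>prob_chain\<close>) one
  integrates out the exponential variables first, which leaves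
  \<open>E exp (- (\<Sum>i. card (A (i + 1)) * (\<xi> (\<tau> (i + 1)) - \<xi> (\<tau> i))))\<close>. For the fragmentation (\<open>prob_together_chain\<close>) the
  branching property turns \<open>g m t\<close>, the probability that \<open>m + 1\<close> given labels are together at time \<open>t\<close>,
  into a multiplicative function of \<open>t\<close>; its derivative at 0 is minus the total dislocation rate
  \<open>\<integral> (1 - x ^ (m + 1) - (1 - x) ^ (m + 1)) \<nu>(dx)\<close>, and this is \<open>\<phi> m\<close> because folding the interval at
  \<open>1/2\<close> replaces the size-biased choice between the masses \<open>x\<close> and \<open>1 - x\<close> by the weight \<open>s\<close>.

  The one analytic point is that almost surely no \<open>E k\<close> lies in the closed range of \<open>\<xi>\<close>
  (\<open>AE_sample_not_in_closure\<close>). It holds because \<open>\<xi>\<close> has no drift, in the form \<open>\<phi> n / n \<longlonglongrightarrow> 0\<close>.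

  For the coupling, keep the given \<open>\<xi>\<close> and \<open>E\<close> and sample a fragmentation from its conditional law given
  that the block of label 1 is the set of living labels. As a fragmentation is determined by
  countably many truth values (are \<open>a\<close> and \<open>b\<close> together at the rational time \<open>q\<close>), this conditional
  sampling is done one truth value at a time with independent uniform variables
  (\<open>transfer_bool_array\<close>); the conditional probabilities are Radon-Nikodym densities.
\<close>

section \<open>Splitting rates\<close>

text \<open>
  The exponent \<open>\<phi>\<close> at the nonnegative integers. It is at once the Laplace exponent of \<open>\<xi>\<close> at \<open>n\<close>
  and the rate at which a block of \<open>n + 1\<close> labels splits, which is why the two sides of the
  theorem agree.
\<close>

definition split_rate :: "real \<Rightarrow> nat \<Rightarrow> real" where
  "split_rate \<beta> n = (LBINT s:{0<..<1}. (1 - s ^ n) * (s powr (\<beta> + 1) * (1 - s) powr \<beta>))"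

lemma one_minus_power_le:
  fixes s :: real
  assumes "0 \<le> s" "s \<le> 1"
  shows "1 - s ^ n \<le> n * (1 - s)"
  using Bernoulli_inequality[of "s - 1" n] assms by (simp add: algebra_simps)

text \<open>
  Each of the two singularities is worth one power less than \<open>\<beta>\<close> suggests: \<open>1 - s ^ n\<close>
  contributes a factor \<open>1 - s\<close>, and the weight of \<open>\<phi>\<close> has the size-biasing factor \<open>s\<close>. What
  remains is a beta integral, finite for all \<open>\<beta> > -2\<close>.
\<close>

lemma beta_weight_integrable:
  assumes "\<beta> > -2"
  shows "set_integrable lborel {0<..<1} (\<lambda>s. s powr (\<beta> + 1) * (1 - s) powr (\<beta> + 1) :: real)"
proof -
  have "((\<lambda>t. t powr (\<beta> + 2 - 1) * (1 - t) powr (\<beta> + 2 - 1)) has_integral Beta (\<beta> + 2) (\<beta> + 2)) {0..1::real}"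
    using has_integral_Beta_real[of "\<beta> + 2" "\<beta> + 2"] assms by auto
  then have "(\<lambda>t. t powr (\<beta> + 1) * (1 - t) powr (\<beta> + 1)) absolutely_integrable_on {0..1::real}"
    by (intro nonnegative_absolutely_integrable_1) (auto simp: has_integral_integrable_integral add.commute algebra_simps)
  then have "set_integrable lebesgue {0<..<1} (\<lambda>t. t powr (\<beta> + 1) * (1 - t) powr (\<beta> + 1) :: real)"
    by (rule set_integrable_subset) auto
  then show ?thesis
    unfolding set_integrable_def by (subst (asm) integrable_completion) auto
qed

lemma split_rate_integrable:
  assumes "\<beta> > -2"
  shows "set_integrable lborel {0<..<1} (\<lambda>s. (1 - s ^ n) * (s powr (\<beta> + 1) * (1 - s) powr \<beta>) :: real)"
proof (rule set_integrable_bound)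
  show "set_integrable lborel {0<..<1} (\<lambda>s. real n * (s powr (\<beta> + 1) * (1 - s) powr (\<beta> + 1)))"
    using beta_weight_integrable[OF assms] by (rule set_integrable_mult_right)
  show "set_borel_measurable lborel {0<..<1} (\<lambda>s. (1 - s ^ n) * (s powr (\<beta> + 1) * (1 - s) powr \<beta>) :: real)"
    unfolding set_borel_measurable_def by measurable
  show "AE s in lborel. s \<in> {0<..<1} \<longrightarrow> norm ((1 - s ^ n) * (s powr (\<beta> + 1) * (1 - s) powr \<beta>) :: real)
      \<le> norm (real n * (s powr (\<beta> + 1) * (1 - s) powr (\<beta> + 1)))"
  proof (intro AE_I2 impI)
    fix s :: real assume s: "s \<in> {0<..<1}"
    have "(1 - s ^ n) * (s powr (\<beta> + 1) * (1 - s) powr \<beta>) \<le>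
        (n * (1 - s)) * (s powr (\<beta> + 1) * (1 - s) powr \<beta>)"
      using s by (intro mult_right_mono one_minus_power_le) auto
    also have "\<dots> = real n * (s powr (\<beta> + 1) * (1 - s) powr (\<beta> + 1))"
      using s by (simp add: powr_add)
    finally show "norm ((1 - s ^ n) * (s powr (\<beta> + 1) * (1 - s) powr \<beta>) :: real)
      \<le> norm (real n * (s powr (\<beta> + 1) * (1 - s) powr (\<beta> + 1)))"
      using s by (simp add: power_le_one abs_mult)
  qed
qed

lemma phi_of_nat: "phi \<beta> (of_nat n) = of_real (split_rate \<beta> n)"
proof -
  have "phi \<beta> (of_nat n) = (LBINT s:{0<..<1}. of_real ((1 - s ^ n) * (s powr (\<beta> + 1) * (1 - s) powr \<beta>)) :: complex)"
    unfolding phi_def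
  proof (rule set_lebesgue_integral_cong)
    show "\<forall>s. s \<in> {0<..<1} \<longrightarrow>
         (1 - complex_of_real s powr of_nat n) * complex_of_real (s powr (\<beta> + 1) * (1 - s) powr \<beta>) =
         complex_of_real ((1 - s ^ n) * (s powr (\<beta> + 1) * (1 - s) powr \<beta>))"
      by (auto simp: powr_nat)
  qed auto
  also have "\<dots> = of_real (split_rate \<beta> n)"
    unfolding split_rate_def set_lebesgue_integral_def scaleR_conv_of_real
    by (subst integral_complex_of_real[symmetric]) (simp add: of_real_mult)
  finally show ?thesis .
qed

lemma split_rate_nonneg: "0 \<le> split_rate \<beta> n"
  unfolding split_rate_def set_lebesgue_integral_def
  by (intro integral_nonneg_AE AE_I2) (auto simp: indicator_def power_le_one)

lemma split_rate_1_pos: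
  assumes "\<beta> > -2"
  shows "0 < split_rate \<beta> 1"
proof -
  have "((\<lambda>t. t powr (\<beta> + 2 - 1) * (1 - t) powr (\<beta> + 2 - 1)) has_integral Beta (\<beta> + 2) (\<beta> + 2)) {0..1::real}"
    using has_integral_Beta_real[of "\<beta> + 2" "\<beta> + 2"] assms by auto
  then have "integral {0..1} (\<lambda>t::real. t powr (\<beta> + 1) * (1 - t) powr (\<beta> + 1)) = Beta (\<beta> + 2) (\<beta> + 2)"
    by (intro integral_unique) (simp add: add.commute algebra_simps)
  also have "\<dots> > 0"
    using assms by (simp add: Beta_def Gamma_real_pos)
  finally have pos: "0 < integral {0..1} (\<lambda>t::real. t powr (\<beta> + 1) * (1 - t) powr (\<beta> + 1))" .
  have "split_rate \<beta> 1 = (LBINT s:{0<..<1}. s powr (\<beta> + 1) * (1 - s) powr (\<beta> + 1))"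
    unfolding split_rate_def
    by (intro set_lebesgue_integral_cong) (auto simp: powr_add)
  also have "\<dots> = integral {0<..<1} (\<lambda>t::real. t powr (\<beta> + 1) * (1 - t) powr (\<beta> + 1))"
    by (intro set_borel_integral_eq_integral beta_weight_integrable assms)
  also have "\<dots> = integral {0..1} (\<lambda>t::real. t powr (\<beta> + 1) * (1 - t) powr (\<beta> + 1))"
    using integral_open_interval[of 0 "1::real" "\<lambda>t::real. t powr (\<beta> + 1) * (1 - t) powr (\<beta> + 1)"]
    by (simp add: box_real)
  finally show ?thesis using pos by simp
qed

text \<open>
  This is the absence of drift: a drift \<open>d\<close> would add \<open>d\<close> to the limit. By Bernoulli the
  integrand divided by \<open>n\<close> is dominated by the beta weight.
\<close>

lemma split_rate_sublinear:
  assumes "\<beta> > -2"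
  shows "(\<lambda>n. split_rate \<beta> n / n) \<longlonglongrightarrow> 0"
proof -
  let ?f = "\<lambda>n s. indicator {0<..<1} s *\<^sub>R ((1 - s ^ n) / n * (s powr (\<beta> + 1) * (1 - s) powr \<beta>)) :: real"
  let ?g = "\<lambda>s. indicator {0<..<1} s *\<^sub>R (s powr (\<beta> + 1) * (1 - s) powr (\<beta> + 1)) :: real"
  have "(\<lambda>n. \<integral>s. ?f n s \<partial>lborel) \<longlonglongrightarrow> (\<integral>s. 0 \<partial>(lborel :: real measure))"
  proof (rule integral_dominated_convergence[where w = ?g])
    show "integrable lborel ?g"
      using beta_weight_integrable[OF assms] unfolding set_integrable_def by simp
    show "AE s in lborel. (\<lambda>n. ?f n s) \<longlonglongrightarrow> 0"
    proof (intro AE_I2)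
      fix s :: real
      show "(\<lambda>n. ?f n s) \<longlonglongrightarrow> 0"
      proof (cases "s \<in> {0<..<1}")
        case True
        then have "(\<lambda>n. (1 - s ^ n) * (1 / real n) * (s powr (\<beta> + 1) * (1 - s) powr \<beta>))
            \<longlonglongrightarrow> (1 - 0) * 0 * (s powr (\<beta> + 1) * (1 - s) powr \<beta>)"
          by (intro tendsto_intros LIMSEQ_realpow_zero lim_1_over_n) auto
        then show ?thesis using True by simp
      qed simp
    qed
    show "AE s in lborel. norm (?f n s) \<le> ?g s" for n
    proof (intro AE_I2)
      fix s :: real
      show "norm (?f n s) \<le> ?g s"
      proof (cases "s \<in> {0<..<1}")
        case True
        have "(1 - s ^ n) / n \<le> 1 - s"
          using one_minus_power_le[of s n] True by (cases "n = 0") (auto simp: field_simps)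
        then have "(1 - s ^ n) / n * (s powr (\<beta> + 1) * (1 - s) powr \<beta>) \<le> (1 - s) * (s powr (\<beta> + 1) * (1 - s) powr \<beta>)"
          by (intro mult_right_mono) auto
        also have "\<dots> = s powr (\<beta> + 1) * (1 - s) powr (\<beta> + 1)"
          using True by (simp add: powr_add)
        finally show ?thesis
          using True by (simp add: power_le_one abs_mult)
      qed simp
    qed
  qed auto
  moreover have "(\<integral>s. ?f n s \<partial>lborel) = split_rate \<beta> n / n" for n
    unfolding split_rate_def set_lebesgue_integral_def
    by (subst Bochner_Integration.integral_divide_zero[symmetric]) (simp add: ac_simps)
  ultimately show ?thesis by (simp only: Bochner_Integration.integral_zero)
qed


lemma nu_integral:
  assumes "f \<in> borel_measurable borel"
  shows "(LINT x|nu \<beta>. f x) = (LBINT x:{1/2..<1}. (x powr \<beta> * (1 - x) powr \<beta>) * f x :: real)"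
    and "integrable (nu \<beta>) f \<longleftrightarrow> set_integrable lborel {1/2..<1} (\<lambda>x. (x powr \<beta> * (1 - x) powr \<beta>) * f x :: real)"
  unfolding nu_def set_lebesgue_integral_def set_integrable_def using assms
  by (subst integral_density integrable_density; simp add: ac_simps)+

text \<open>
  Write \<open>1 - x ^ (n + 1) - (1 - x) ^ (n + 1)\<close> as \<open>h x + h (1 - x)\<close> with \<open>h s = s * (1 - s ^ n)\<close>.
  As the density of \<open>\<nu>\<close> is symmetric under \<open>x \<mapsto> 1 - x\<close>, the second summand is the integral of
  \<open>h\<close> over the other half of the unit interval, and the factor \<open>s\<close> of \<open>h\<close> is the one that turns
  \<open>s powr \<beta>\<close> into \<open>s powr (\<beta> + 1)\<close>.
\<close>

lemma nu_integral_split: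
  assumes \<beta>: "\<beta> > -2"
  shows "(LINT x|nu \<beta>. 1 - x ^ Suc n - (1 - x) ^ Suc n) = split_rate \<beta> n"
    and "integrable (nu \<beta>) (\<lambda>x. 1 - x ^ Suc n - (1 - x) ^ Suc n)"
proof -
  let ?w = "\<lambda>x::real. x powr \<beta> * (1 - x) powr \<beta>"
  let ?h = "\<lambda>s::real. (s - s ^ Suc n) * ?w s"
  have h: "set_integrable lborel {0<..<1} ?h"
  proof -
    have "set_integrable lborel {0<..<1} (\<lambda>s. (1 - s ^ n) * (s powr (\<beta> + 1) * (1 - s) powr \<beta>) :: real)"
      by (rule split_rate_integrable[OF \<beta>])
    then show ?thesis
      by (rule set_integrable_cong[THEN iffD1, rotated -1]) (auto simp: powr_add algebra_simps)
  qed
  have h1: "set_integrable lborel {1/2..<1} ?h"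
    by (rule set_integrable_subset[OF h]) auto
  have h2: "set_integrable lborel {1/2..<1} (\<lambda>s. ?h (1 - s))"
  proof -
    have "set_integrable lborel {0<..<1} (\<lambda>s. ?h (1 - s))"
      using h unfolding set_integrable_def
      by (subst (asm) lborel_integrable_real_affine_iff[symmetric, where c = "-1" and t = 1])
         (auto elim!: integrable_cong[THEN iffD1, rotated -1] simp: indicator_def conj_commute)
    then show ?thesis
      by (rule set_integrable_subset) auto
  qed
  have "split_rate \<beta> n = (LBINT s:{0<..<1}. ?h s)"
    unfolding split_rate_def
    by (intro set_lebesgue_integral_cong) (auto simp: powr_add algebra_simps)
  also have "{0<..<1} = {0<..<1/2} \<union> {1/2..<1::real}" by auto
  also have "(LBINT s:{0<..<1/2} \<union> {1/2..<1}. ?h s) = (LBINT s:{0<..<1/2}. ?h s) + (LBINT s:{1/2..<1}. ?h s)"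
    by (intro set_integral_Un set_integrable_subset[OF h]) auto
  also have "(LBINT s:{0<..<1/2}. ?h s) = (LBINT s:{1/2<..<1}. ?h (1 - s))"
    unfolding set_lebesgue_integral_def
    by (subst lborel_integral_real_affine[where c = "-1" and t = 1])
       (auto intro!: Bochner_Integration.integral_cong simp: indicator_def)
  also have "\<dots> = (LBINT s:{1/2..<1}. ?h (1 - s))"
    unfolding set_lebesgue_integral_def
    by (intro integral_cong_AE) (auto intro!: AE_I[where N = "{1/2}"] simp: indicator_def)
  also have "\<dots> + (LBINT s:{1/2..<1}. ?h s) = (LBINT s:{1/2..<1}. ?h (1 - s) + ?h s)"
    by (rule set_integral_add(2)[symmetric, OF h2 h1])
  also have "\<dots> = (LBINT s:{1/2..<1}. ?w s * (1 - s ^ Suc n - (1 - s) ^ Suc n))"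
    by (intro set_lebesgue_integral_cong) (auto simp: algebra_simps)
  also have "\<dots> = (LINT x|nu \<beta>. 1 - x ^ Suc n - (1 - x) ^ Suc n)"
    by (rule nu_integral[symmetric]) auto
  finally show "(LINT x|nu \<beta>. 1 - x ^ Suc n - (1 - x) ^ Suc n) = split_rate \<beta> n" by simp
  have "set_integrable lborel {1/2..<1} (\<lambda>s. ?h (1 - s) + ?h s)"
    by (rule set_integral_add(1)[OF h2 h1])
  also have "?this \<longleftrightarrow> set_integrable lborel {1/2..<1} (\<lambda>s. ?w s * (1 - s ^ Suc n - (1 - s) ^ Suc n))"
    by (intro set_integrable_cong) (auto simp: algebra_simps)
  finally show "integrable (nu \<beta>) (\<lambda>x. 1 - x ^ Suc n - (1 - x) ^ Suc n)"
    by (subst nu_integral(2)) auto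
qed

section \<open>Decreasing step paths\<close>

definition jump_times :: "(real \<Rightarrow> 'c) \<Rightarrow> real set" where
  "jump_times f = {t. 0 < t \<and> \<not> eventually (\<lambda>s. f s = f t) (at_left t)}"

locale decreasing_step_path =
  fixes f :: "real \<Rightarrow> 'c set"
  assumes antimono: "\<And>s t. 0 \<le> s \<Longrightarrow> s \<le> t \<Longrightarrow> f t \<subseteq> f s"
    and right_cont: "\<And>t. 0 \<le> t \<Longrightarrow> eventually (\<lambda>s. f s = f t) (at_right t)"
begin

lemma right_constancy:
  assumes "0 \<le> t"
  obtains b where "b > t" "\<And>r. t \<le> r \<Longrightarrow> r < b \<Longrightarrow> f r = f t"
proof -
  from right_cont[OF assms] obtain b where "b > t" "\<forall>r>t. r < b \<longrightarrow> f r = f t"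
    by (auto simp: eventually_at_right_field)
  then show ?thesis
    by (intro that[of b]) (auto simp: order_le_less)
qed

lemma constant_between:
  assumes "0 \<le> s" "f s = f t" "s \<le> r" "r \<le> t"
  shows "f r = f t"
proof (rule subset_antisym)
  show "f r \<subseteq> f t" using antimono[of s r] assms by simp
  show "f t \<subseteq> f r" using antimono[of r t] assms by simp
qed

lemma value_before_jump:
  assumes "0 \<le> s" "s < t" "t \<in> jump_times f"
  shows "f s \<noteq> f t"
proof
  assume eq: "f s = f t"
  have "f r = f t" if "s < r" "r < t" for r
    by (rule constant_between[OF assms(1) eq]) (use that in auto)
  with assms(2) have "eventually (\<lambda>r. f r = f t) (at_left t)"
    unfolding eventually_at_left_field by blast
  with assms(3) show False by (simp add: jump_times_def)
qed

text \<open>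
  A value other than the first one is attained for the first time at a jump, by
  right-continuity, and it is never attained again after the next jump, by monotonicity.
\<close>

lemma bij_betw_jump_times: "bij_betw f (jump_times f) (f ` {0..} - {f 0})"
proof (rule bij_betw_imageI)
  show "inj_on f (jump_times f)"
  proof (rule inj_onI)
    fix s t assume st: "s \<in> jump_times f" "t \<in> jump_times f" "f s = f t"
    then have "0 \<le> s" "0 \<le> t" by (auto simp: jump_times_def)
    then show "s = t"
      using value_before_jump[of s t] value_before_jump[of t s] st
      by (metis linorder_neqE)
  qed
  show "f ` jump_times f = f ` {0..} - {f 0}"
  proof (intro equalityI subsetI)
    fix v assume "v \<in> f ` jump_times f"
    then show "v \<in> f ` {0..} - {f 0}"
      using value_before_jump[OF order_refl] by (force simp: jump_times_def)
  next
    fix v assume v: "v \<in> f ` {0..} - {f 0}"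
    define S where "S = {r. 0 \<le> r \<and> f r = v}"
    define t where "t = Inf S"
    have S: "S \<noteq> {}" "bdd_below S" using v by (auto simp: S_def intro: bdd_belowI[of _ 0])
    have t0: "0 \<le> t" unfolding t_def using S by (intro cInf_greatest) (auto simp: S_def)
    obtain b where b: "b > t" "\<And>r. t \<le> r \<Longrightarrow> r < b \<Longrightarrow> f r = f t"
      using right_constancy[OF t0] by blast
    obtain r where r: "r \<in> S" "r < b" using b(1) S unfolding t_def by (metis cInf_lessD)
    have "t \<le> r" unfolding t_def using r S by (intro cInf_lower)
    with b(2)[of r] r have ft: "f t = v" by (simp add: S_def)
    then have tpos: "0 < t" using v t0 by (cases "t = 0") auto
    have "\<not> eventually (\<lambda>s. f s = f t) (at_left t)"
    proof
      assume "eventually (\<lambda>s. f s = f t) (at_left t)"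
      then obtain a where a: "a < t" "\<forall>y>a. y < t \<longrightarrow> f y = f t"
        by (auto simp: eventually_at_left_field)
      \<comment> \<open>An earlier time at which the value \<open>v\<close> would be attained.\<close>
      define y where "y = (max a 0 + t) / 2"
      have "a < y" "y < t" "0 < y" using a(1) tpos by (auto simp: y_def)
      then have "y \<in> S" using a(2) ft by (auto simp: S_def)
      with \<open>y < t\<close> show False
        using S cInf_lower[of y S] by (simp add: t_def)
    qed
    with tpos ft show "v \<in> f ` jump_times f" by (auto simp: jump_times_def)
  qed
qed

lemma card_jump_times: "card (jump_times f) = card (f ` {0..}) - 1"
proof -
  have "card (jump_times f) = card (f ` {0..} - {f 0})"
    by (rule bij_betw_same_card[OF bij_betw_jump_times])
  also have "\<dots> = card (f ` {0..}) - 1"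
    by (rule card_Diff_singleton) auto
  finally show ?thesis .
qed

text \<open>
  Hence the number of jumps is determined by countably many times. The map \<open>q \<mapsto> \<bar>of_rat q\<bar>\<close> is
  used to index the nonnegative rational times by a countable type.
\<close>

lemma values_at_rationals: "f ` {0..} = range (\<lambda>q::rat. f \<bar>of_rat q\<bar>)"
proof (intro equalityI subsetI)
  fix v assume "v \<in> f ` {0..}"
  then obtain t where t: "0 \<le> t" "v = f t" by auto
  obtain b where b: "b > t" "\<And>r. t \<le> r \<Longrightarrow> r < b \<Longrightarrow> f r = f t"
    using right_constancy[OF t(1)] by blast
  obtain q :: rat where "t < of_rat q" "of_rat q < b" using of_rat_dense[OF b(1)] by auto
  moreover from this have "\<bar>of_rat q\<bar> = (of_rat q :: real)"
    using t(1) by linarith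
  ultimately have "f (of_rat q) = v" "\<bar>of_rat q\<bar> = (of_rat q :: real)"
    using b(2)[of "of_rat q"] t by auto
  then have "v = f \<bar>of_rat q\<bar>" by metis
  then show "v \<in> range (\<lambda>q::rat. f \<bar>of_rat q\<bar>)" by blast
qed auto

end

abbreviation bool_arrays :: "('i \<Rightarrow> bool) measure" where
  "bool_arrays \<equiv> \<Pi>\<^sub>M i\<in>UNIV. count_space UNIV"

lemma space_bool_arrays [simp]: "space (bool_arrays :: ('i \<Rightarrow> bool) measure) = UNIV"
  by (simp add: space_PiM)

lemma measurable_bool_arrays:
  "(\<And>i. (\<lambda>\<omega>. f \<omega> i) \<in> measurable M (count_space UNIV)) \<Longrightarrow> f \<in> measurable M (bool_arrays :: ('i \<Rightarrow> bool) measure)"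
  by (rule measurable_PiM_single') auto

lemma measurable_bool_arrays_coord [measurable]:
  "(\<lambda>x. x i) \<in> measurable (bool_arrays :: ('i \<Rightarrow> bool) measure) (count_space UNIV)"
  by (rule measurable_component_singleton) simp

text \<open>
  The number of jumps of the set of living labels, read off from the array \<open>b (k, q)\<close> that tells
  whether \<open>k\<close> is alive at time \<open>\<bar>of_rat q\<bar>\<close>: all values but the initial one count.
\<close>

definition num_values :: "nat \<Rightarrow> (nat \<times> rat \<Rightarrow> bool) \<Rightarrow> nat" where
  "num_values m b = card (range (\<lambda>q. {k. k < m \<and> b (k, q)})) - 1"

lemma measurable_range:
  fixes F :: "'i::countable \<Rightarrow> 'a \<Rightarrow> 'c"
  assumes A: "finite A" and F: "\<And>q. F q \<in> measurable M (count_space A)"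
  shows "(\<lambda>\<omega>. range (\<lambda>q. F q \<omega>)) \<in> measurable M (count_space (Pow A))"
proof -
  have FA: "F q \<omega> \<in> A" if "\<omega> \<in> space M" for q \<omega>
    using measurable_space[OF F[of q] that] by simp
  show ?thesis
    unfolding measurable_count_space_eq2[OF finite_Pow_iff[THEN iffD2, OF A]]
  proof (intro conjI ballI)
    show "(\<lambda>\<omega>. range (\<lambda>q. F q \<omega>)) \<in> space M \<rightarrow> Pow A"
      using FA by auto
    fix R assume "R \<in> Pow A"
    then have R: "R \<subseteq> A" "finite R" using A finite_subset by auto
    have *: "{\<omega> \<in> space M. F q \<omega> = S} \<in> sets M" if "S \<in> R" for q S
    proof -
      have "F q -` {S} \<inter> space M \<in> sets M"
        using R that by (intro measurable_sets[OF F]) auto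
      then show ?thesis by (simp add: vimage_def Int_def conj_commute)
    qed
    have "range f = R \<longleftrightarrow> (\<forall>S\<in>R. \<exists>q. f q = S) \<and> (\<forall>q. \<exists>S\<in>R. f q = S)" for f :: "'i \<Rightarrow> 'c"
    proof
      assume "range f = R"
      then show "(\<forall>S\<in>R. \<exists>q. f q = S) \<and> (\<forall>q. \<exists>S\<in>R. f q = S)" by (auto 0 2)
    next
      assume *: "(\<forall>S\<in>R. \<exists>q. f q = S) \<and> (\<forall>q. \<exists>S\<in>R. f q = S)"
      have "f q \<in> R" for q using *[THEN conjunct2, rule_format, of q] by auto
      moreover have "S \<in> range f" if "S \<in> R" for S
        using *[THEN conjunct1, rule_format, OF that] by auto
      ultimately show "range f = R" by (intro subset_antisym) auto
    qed
    then have "(\<lambda>\<omega>. range (\<lambda>q. F q \<omega>)) -` {R} \<inter> space M =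
        {\<omega> \<in> space M. (\<forall>S\<in>R. \<exists>q. F q \<omega> = S) \<and> (\<forall>q. \<exists>S\<in>R. F q \<omega> = S)}"
      by (simp add: vimage_def Int_def conj_commute)
    also have "\<dots> \<in> sets M"
      using R(2) * by (intro sets.sets_Collect_conj sets.sets_Collect_finite_All sets.sets_Collect_finite_Ex
          sets.sets_Collect_countable_Ex sets.sets_Collect_countable_All)
    finally show "(\<lambda>\<omega>. range (\<lambda>q. F q \<omega>)) -` {R} \<inter> space M \<in> sets M" .
  qed
qed

lemma measurable_num_values [measurable]:
  "num_values m \<in> measurable bool_arrays (count_space UNIV)"
proof -
  have "(\<lambda>b :: nat \<times> rat \<Rightarrow> bool. {k. k < m \<and> b (k, q)}) \<in> measurable bool_arrays (count_space (Pow {..<m}))" for q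
    unfolding measurable_count_space_eq2[OF finite_Pow_iff[THEN iffD2, OF finite_lessThan]]
  proof (intro conjI ballI)
    fix S assume "S \<in> Pow {..<m}"
    then have "(\<lambda>b :: nat \<times> rat \<Rightarrow> bool. {k. k < m \<and> b (k, q)}) -` {S} \<inter> space bool_arrays =
        {b \<in> space bool_arrays. \<forall>k\<in>{..<m}. b (k, q) \<longleftrightarrow> k \<in> S}"
      by auto
    also have "\<dots> \<in> sets bool_arrays"
      by measurable
    finally show "(\<lambda>b :: nat \<times> rat \<Rightarrow> bool. {k. k < m \<and> b (k, q)}) -` {S} \<inter> space bool_arrays \<in> sets bool_arrays" .
  qed auto
  then have "(\<lambda>b :: nat \<times> rat \<Rightarrow> bool. range (\<lambda>q. {k. k < m \<and> b (k, q)}))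
      \<in> measurable bool_arrays (count_space (Pow (Pow {..<m})))"
    by (rule measurable_range[rotated]) auto
  then have "(\<lambda>R. card R - 1) \<circ> (\<lambda>b :: nat \<times> rat \<Rightarrow> bool. range (\<lambda>q. {k. k < m \<and> b (k, q)}))
      \<in> measurable bool_arrays (count_space UNIV)"
    by (rule measurable_comp) simp
  then show ?thesis by (simp add: comp_def num_values_def[abs_def])
qed

section \<open>Coupling through a common function\<close>

lemma sets_bool_arrays_cylinder:
  assumes "finite F"
  shows "{x :: 'i \<Rightarrow> bool. \<forall>i\<in>F. x i} \<in> sets bool_arrays"
proof -
  have "{x \<in> space (bool_arrays :: ('i \<Rightarrow> bool) measure). \<forall>i\<in>F. x i} \<in> sets bool_arrays"
    using assms measurable_bool_arrays_coord
    by (intro sets.sets_Collect_finite_All) (simp only: pred_def[symmetric])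
  then show ?thesis by simp
qed

text \<open>
  The events that finitely many given entries are all true form a generator that is stable under
  intersection.
\<close>

lemma pair_bool_arrays_eqI:
  fixes P Q :: "('s \<times> ('i \<Rightarrow> bool)) measure"
  assumes P: "finite_measure P" "sets P = sets (S \<Otimes>\<^sub>M bool_arrays)" 
    and Q: "sets Q = sets (S \<Otimes>\<^sub>M bool_arrays)"
    and eq: "\<And>B F. B \<in> sets S \<Longrightarrow> finite F \<Longrightarrow> emeasure P (B \<times> {x. \<forall>i\<in>F. x i}) = emeasure Q (B \<times> {x. \<forall>i\<in>F. x i})"
  shows "P = Q"
proof -
  let ?G = "{B \<times> {x :: 'i \<Rightarrow> bool. \<forall>i\<in>F. x i} |B F. B \<in> sets S \<and> finite F}"
  let ?O = "space S \<times> (UNIV :: ('i \<Rightarrow> bool) set)"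
  have G: "?G \<subseteq> Pow ?O" using sets.sets_into_space by fastforce
  have [measurable]: "{x :: 'i \<Rightarrow> bool. \<forall>i\<in>F. x i} \<in> sets bool_arrays" if "finite F" for F
    using that by (rule sets_bool_arrays_cylinder)
  have "sets (S \<Otimes>\<^sub>M bool_arrays) = sigma_sets ?O ?G"
  proof (intro equalityI)
    have "(\<lambda>x. x) \<in> measurable (sigma ?O ?G) (S \<Otimes>\<^sub>M bool_arrays)"
    proof (rule measurable_pair)
      show "fst \<circ> (\<lambda>x. x) \<in> measurable (sigma ?O ?G) S"
      proof (rule measurableI)
        fix B assume B: "B \<in> sets S"
        have "(fst \<circ> (\<lambda>x. x)) -` B \<inter> space (sigma ?O ?G) = B \<times> {x. \<forall>i\<in>{}. x i}"
          using G sets.sets_into_space[OF B] by (auto simp: space_measure_of_conv)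
        then show "(fst \<circ> (\<lambda>x. x)) -` B \<inter> space (sigma ?O ?G) \<in> sets (sigma ?O ?G)"
          using B by (auto simp: sets_measure_of[OF G])
      qed (use G in \<open>auto simp: space_measure_of_conv\<close>)
      show "snd \<circ> (\<lambda>x. x) \<in> measurable (sigma ?O ?G) bool_arrays"
      proof (rule measurable_bool_arrays)
        fix i
        have "{\<omega> \<in> space (sigma ?O ?G). snd \<omega> i} = space S \<times> {x. \<forall>i\<in>{i}. x i}"
          using G by (auto simp: space_measure_of_conv)
        also have "\<dots> \<in> sets (sigma ?O ?G)"
          unfolding sets_measure_of[OF G] by (rule sigma_sets.Basic) (auto intro!: exI[of _ "{i}"])
        finally show "(\<lambda>\<omega>. (snd \<circ> (\<lambda>x. x)) \<omega> i) \<in> measurable (sigma ?O ?G) (count_space UNIV)"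
          by (simp add: pred_def)
      qed
    qed
    then have "D \<in> sets (sigma ?O ?G)" if D: "D \<in> sets (S \<Otimes>\<^sub>M bool_arrays)" for D
    proof -
      have "(\<lambda>x. x) -` D \<inter> space (sigma ?O ?G) = D"
        using sets.sets_into_space[OF D] by (auto simp: space_pair_measure space_measure_of_conv)
      with measurable_sets[OF \<open>(\<lambda>x. x) \<in> _\<close> D] show ?thesis by simp
    qed
    then have "sets (S \<Otimes>\<^sub>M bool_arrays) \<subseteq> sets (sigma ?O ?G)" by (rule subsetI)
    then show "sets (S \<Otimes>\<^sub>M bool_arrays) \<subseteq> sigma_sets ?O ?G"
      using G by simp
    show "sigma_sets ?O ?G \<subseteq> sets (S \<Otimes>\<^sub>M bool_arrays)"
    proof -
      have "?G \<subseteq> sets (S \<Otimes>\<^sub>M bool_arrays)"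
        using sets_bool_arrays_cylinder by blast
      from sets.sigma_sets_subset[OF this] show ?thesis by (simp add: space_pair_measure)
    qed
  qed
  moreover have "Int_stable ?G"
  proof (rule Int_stableI)
    fix a b assume "a \<in> ?G" "b \<in> ?G"
    then obtain B F C H where *: "a = B \<times> {x. \<forall>i\<in>F. x i}" "b = C \<times> {x. \<forall>i\<in>H. x i}"
      "B \<in> sets S" "C \<in> sets S" "finite F" "finite H" by auto
    have "a \<inter> b = (B \<inter> C) \<times> {x. \<forall>i\<in>F \<union> H. x i}" unfolding * by auto
    moreover have "B \<inter> C \<in> sets S" "finite (F \<union> H)" using * by auto
    ultimately show "a \<inter> b \<in> ?G" by blast
  qed
  ultimately show ?thesis
  proof (intro measure_eqI_generator_eq[where A = "\<lambda>_. ?O" and \<Omega> = ?O and E = ?G])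
    have "?O = space S \<times> {x. \<forall>i\<in>{}. x i}" by simp
    then show "range (\<lambda>_. ?O) \<subseteq> ?G" by blast
    show "emeasure P ?O \<noteq> \<infinity>" using P(1) by (simp add: finite_measure.emeasure_finite)
  qed (use assms G in auto)
qed

lemma bool_arrays_eqI:
  fixes P Q :: "('i \<Rightarrow> bool) measure"
  assumes P: "finite_measure P" "sets P = sets bool_arrays" and Q: "sets Q = sets bool_arrays"
    and eq: "\<And>F. finite F \<Longrightarrow> emeasure P {x. \<forall>i\<in>F. x i} = emeasure Q {x. \<forall>i\<in>F. x i}"
  shows "P = Q"
proof -
  let ?S = "count_space {()}" and ?l = "\<lambda>x :: 'i \<Rightarrow> bool. ((), x)"
  have m: "?l \<in> measurable P (?S \<Otimes>\<^sub>M bool_arrays)" "?l \<in> measurable Q (?S \<Otimes>\<^sub>M bool_arrays)"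
    using P Q by (auto intro!: measurable_Pair simp: measurable_ident_sets)
  have sp: "space P = UNIV" "space Q = UNIV"
    using sets_eq_imp_space_eq[OF P(2)] sets_eq_imp_space_eq[OF Q] by simp_all
  have [measurable]: "{x :: 'i \<Rightarrow> bool. \<forall>i\<in>F. x i} \<in> sets bool_arrays" if "finite F" for F
    using that by (rule sets_bool_arrays_cylinder)
  have "distr P (?S \<Otimes>\<^sub>M bool_arrays) ?l = distr Q (?S \<Otimes>\<^sub>M bool_arrays) ?l"
  proof (rule pair_bool_arrays_eqI)
    show "finite_measure (distr P (?S \<Otimes>\<^sub>M bool_arrays) ?l)"
      using P(1) m(1) by (intro finite_measure.finite_measure_distr)
    fix B and F :: "'i set" assume B: "B \<in> sets ?S" "finite F"
    show "emeasure (distr P (?S \<Otimes>\<^sub>M bool_arrays) ?l) (B \<times> {x. \<forall>i\<in>F. x i}) =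
        emeasure (distr Q (?S \<Otimes>\<^sub>M bool_arrays) ?l) (B \<times> {x. \<forall>i\<in>F. x i})"
    proof -
      have "B \<times> {x. \<forall>i\<in>F. x i} \<in> sets (?S \<Otimes>\<^sub>M bool_arrays)"
        using B sets_bool_arrays_cylinder by blast
      moreover have "?l -` (B \<times> {x. \<forall>i\<in>F. x i}) = (if () \<in> B then {x. \<forall>i\<in>F. x i} else {})"
        by auto
      ultimately show ?thesis
        using eq[OF B(2)] by (simp add: emeasure_distr[OF m(1)] emeasure_distr[OF m(2)] sp)
    qed
  qed auto
  then have "distr (distr P (?S \<Otimes>\<^sub>M bool_arrays) ?l) bool_arrays snd = distr (distr Q (?S \<Otimes>\<^sub>M bool_arrays) ?l) bool_arrays snd"
    by simp
  then show ?thesis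
    using m P Q by (simp add: distr_distr comp_def distr_id2)
qed

abbreviation uniforms :: "(nat \<Rightarrow> real) measure" where
  "uniforms \<equiv> \<Pi>\<^sub>M k\<in>UNIV. uniform_measure lborel {0..1}"

lemma prob_space_unit_uniform: "prob_space (uniform_measure lborel {0..1::real})"
  by (rule prob_space_uniform_measure) auto

lemma prob_space_uniforms: "prob_space uniforms"
  by (intro prob_space_PiM prob_space_unit_uniform)

lemma emeasure_unit_uniform_less:
  assumes "p \<le> 1"
  shows "emeasure (uniform_measure lborel {0..1::real}) {v. ennreal v < p} = p"
proof -
  obtain r where r: "p = ennreal r" "0 \<le> r" using assms by (cases p) (auto simp: top_unique)
  have "r \<le> 1" using assms r by simp
  have "{0..1} \<inter> {v. ennreal v < p} = {0..<r}"
    using r \<open>r \<le> 1\<close> by (auto simp: ennreal_less_iff)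
  then show ?thesis
    using r by (simp add: emeasure_uniform_measure divide_ennreal_def)
qed

text \<open>
  A coordinate of the product measure may be redrawn before integrating. If the integrand looks
  at \<open>u k\<close> in one place only, this integrates out \<open>u k\<close> there and leaves everything else as it
  was.
\<close>

lemma nn_integral_resample:
  assumes M: "prob_space M" and f: "f \<in> borel_measurable (M \<Otimes>\<^sub>M uniforms)"
  shows "(\<integral>\<^sup>+ z. f z \<partial>(M \<Otimes>\<^sub>M uniforms)) =
    (\<integral>\<^sup>+ z. (\<integral>\<^sup>+ v. f (fst z, (snd z)(k := v)) \<partial>uniform_measure lborel {0..1}) \<partial>(M \<Otimes>\<^sub>M uniforms))"
proof -
  let ?V = "uniform_measure lborel {0..1::real}" 
  interpret M: prob_space M by fact
  interpret V: prob_space ?V by (rule prob_space_unit_uniform)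
  interpret U: prob_space uniforms by (rule prob_space_uniforms)
  interpret VU: pair_sigma_finite ?V uniforms ..
  have upd: "(\<lambda>(v, u). u(k := v)) \<in> measurable (?V \<Otimes>\<^sub>M uniforms) uniforms"
    using measurable_add_dim[of k UNIV "\<lambda>_. ?V"]
    by (subst measurable_pair_swap_iff) (simp add: split_beta' insert_absorb)
  have dist: "distr (?V \<Otimes>\<^sub>M uniforms) uniforms (\<lambda>(v, u). u(k := v)) = uniforms"
    using distr_pair_PiM_eq_PiM[of UNIV "\<lambda>_. ?V" k] by (simp add: prob_space_unit_uniform)
  have upd': "(\<lambda>z. (fst (fst z), (snd (fst z))(k := snd z))) \<in> measurable ((M \<Otimes>\<^sub>M uniforms) \<Otimes>\<^sub>M ?V) (M \<Otimes>\<^sub>M uniforms)"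
    using measurable_compose[OF _ upd, of "\<lambda>z. (snd z, snd (fst z))" "(M \<Otimes>\<^sub>M uniforms) \<Otimes>\<^sub>M ?V"]
    by (intro measurable_Pair) (auto simp: split_beta')
  have "(\<integral>\<^sup>+ z. f z \<partial>(M \<Otimes>\<^sub>M uniforms)) = (\<integral>\<^sup>+ \<omega>. \<integral>\<^sup>+ u. f (\<omega>, u) \<partial>uniforms \<partial>M)"
    by (rule U.nn_integral_fst[symmetric, OF f])
  also have "\<dots> = (\<integral>\<^sup>+ \<omega>. \<integral>\<^sup>+ u. \<integral>\<^sup>+ v. f (\<omega>, u(k := v)) \<partial>?V \<partial>uniforms \<partial>M)"
  proof (rule nn_integral_cong)
    fix \<omega> assume \<omega>: "\<omega> \<in> space M"
    have f\<omega>: "(\<lambda>u. f (\<omega>, u)) \<in> borel_measurable uniforms"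
      using f \<omega> by measurable
    have "(\<integral>\<^sup>+ u. f (\<omega>, u) \<partial>uniforms) = (\<integral>\<^sup>+ u. f (\<omega>, u) \<partial>distr (?V \<Otimes>\<^sub>M uniforms) uniforms (\<lambda>(v, u). u(k := v)))"
      by (simp only: dist)
    also have "\<dots> = (\<integral>\<^sup>+ z. f (\<omega>, (snd z)(k := fst z)) \<partial>(?V \<Otimes>\<^sub>M uniforms))"
      using f\<omega> upd by (subst nn_integral_distr) (auto simp: split_beta')
    also have "\<dots> = (\<integral>\<^sup>+ u. \<integral>\<^sup>+ v. f (\<omega>, u(k := v)) \<partial>?V \<partial>uniforms)"
    proof -
      have "(\<lambda>z. f (\<omega>, (snd z)(k := fst z))) \<in> borel_measurable (?V \<Otimes>\<^sub>M uniforms)"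
        using measurable_compose[OF upd f\<omega>] by (simp add: split_beta')
      from VU.nn_integral_snd[OF this] show ?thesis by simp
    qed
    finally show "(\<integral>\<^sup>+ u. f (\<omega>, u) \<partial>uniforms) = (\<integral>\<^sup>+ u. \<integral>\<^sup>+ v. f (\<omega>, u(k := v)) \<partial>?V \<partial>uniforms)" .
  qed
  also have "\<dots> = (\<integral>\<^sup>+ z. (\<integral>\<^sup>+ v. f (fst z, (snd z)(k := v)) \<partial>?V) \<partial>(M \<Otimes>\<^sub>M uniforms))"
  proof -
    have "(\<lambda>z. \<integral>\<^sup>+ v. f (fst z, (snd z)(k := v)) \<partial>?V) \<in> borel_measurable (M \<Otimes>\<^sub>M uniforms)"
      using measurable_compose[OF upd' f] by (intro V.borel_measurable_nn_integral) (simp add: split_beta')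
    from U.nn_integral_fst[OF this] show ?thesis by simp
  qed
  finally show ?thesis .
qed

text \<open>
  The first \<open>k\<close> entries of a random array, the others being \<open>False\<close>. Entry \<open>k\<close> is true with the
  probability that \<open>p k\<close> prescribes given \<open>y\<close> and the earlier entries; the uniform variable
  \<open>u k\<close> decides.
\<close>

primrec threshold_array :: "(nat \<Rightarrow> 's \<times> (nat \<Rightarrow> bool) \<Rightarrow> ennreal) \<Rightarrow> 's \<Rightarrow> (nat \<Rightarrow> real) \<Rightarrow> nat \<Rightarrow> nat \<Rightarrow> bool" where
  "threshold_array p y u 0 = (\<lambda>_. False)"
| "threshold_array p y u (Suc k) = (threshold_array p y u k)
     (k := ennreal (u k) < p k (y, threshold_array p y u k))"

lemma threshold_array_stable: "i < k \<Longrightarrow> k \<le> l \<Longrightarrow> threshold_array p y u l i = threshold_array p y u k i"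
  by (induction l) (auto simp: le_Suc_eq)

lemma threshold_array_upd: "k \<le> l \<Longrightarrow> threshold_array p y (u(l := v)) k = threshold_array p y u k"
  by (induction k) auto

lemma measurable_threshold_array:
  fixes S :: "'s measure"
  assumes p: "\<And>k. p k \<in> borel_measurable (S \<Otimes>\<^sub>M bool_arrays)"
  shows "(\<lambda>z. threshold_array p (fst z) (snd z) k) \<in> measurable (S \<Otimes>\<^sub>M uniforms) bool_arrays"
proof (induction k)
  case 0
  then show ?case by (intro measurable_bool_arrays) auto
next
  case (Suc k)
  have c: "(\<lambda>u. u k) \<in> borel_measurable uniforms" for k
  proof -
    have "measurable uniforms (uniform_measure lborel {0..1::real}) = borel_measurable uniforms"
      by (rule measurable_cong_sets) auto
    then show ?thesis
      using measurable_component_singleton[of k UNIV "\<lambda>_. uniform_measure lborel {0..1::real}"] by simp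
  qed
  show ?case
  proof (rule measurable_bool_arrays)
    fix i
    have "Measurable.pred (S \<Otimes>\<^sub>M uniforms) (\<lambda>z. ennreal (snd z k) < p k (fst z, threshold_array p (fst z) (snd z) k))"
      using measurable_compose[OF measurable_Pair[OF measurable_fst Suc.IH] p[of k]]
        measurable_compose[OF measurable_snd c[of k]] by measurable
    then show "(\<lambda>z. threshold_array p (fst z) (snd z) (Suc k) i) \<in> measurable (S \<Otimes>\<^sub>M uniforms) (count_space UNIV)"
      using measurable_compose[OF Suc.IH measurable_bool_arrays_coord[of i]]
      by (cases "i = k") auto
  qed
qed


text \<open>
  Used for \<open>\<nu> A = Pr (W \<in> A \<and> X)\<close> and \<open>\<mu> A = Pr (W \<in> A)\<close>, where the density is the conditional
  probability of \<open>X\<close> given \<open>W\<close>.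
\<close>

lemma RN_deriv_le_1:
  assumes \<mu>: "finite_measure \<mu>" and sets: "sets \<nu> = sets \<mu>" and le: "\<And>A. A \<in> sets \<mu> \<Longrightarrow> emeasure \<nu> A \<le> emeasure \<mu> A"
  shows "density \<mu> (RN_deriv \<mu> \<nu>) = \<nu>" and "AE x in \<mu>. RN_deriv \<mu> \<nu> x \<le> 1"
proof -
  interpret finite_measure \<mu> by fact
  show dens: "density \<mu> (RN_deriv \<mu> \<nu>) = \<nu>"
  proof (rule density_RN_deriv[OF _ sets])
    show "absolutely_continuous \<mu> \<nu>"
      unfolding absolutely_continuous_def
      using le sets by (auto simp: null_sets_def) (metis le_zero_eq)
  qed
  let ?p = "RN_deriv \<mu> \<nu>"
  let ?D = "{x \<in> space \<mu>. 1 < ?p x}"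
  have D: "?D \<in> sets \<mu>" by measurable
  show "AE x in \<mu>. ?p x \<le> 1"
  proof (rule ccontr)
    assume neg: "\<not> (AE x in \<mu>. ?p x \<le> 1)"
    have "(\<integral>\<^sup>+x. indicator ?D x \<partial>\<mu>) < (\<integral>\<^sup>+x. ?p x * indicator ?D x \<partial>\<mu>)"
    proof (rule nn_integral_less)
      show "\<not> (AE x in \<mu>. ?p x * indicator ?D x \<le> indicator ?D x)"
      proof
        assume "AE x in \<mu>. ?p x * indicator ?D x \<le> indicator ?D x"
        with AE_space have "AE x in \<mu>. ?p x \<le> 1"
        proof eventually_elim
          case (elim x)
          then show ?case by (cases "1 < ?p x") (auto simp: not_less)
        qed
        with neg show False ..
      qed
      show "(\<integral>\<^sup>+x. indicator ?D x \<partial>\<mu>) \<noteq> \<infinity>" using D emeasure_finite[of ?D] by simp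
      show "AE x in \<mu>. indicator ?D x \<le> ?p x * indicator ?D x"
        by (intro AE_I2) (auto simp: indicator_def)
    qed measurable
    also have "(\<integral>\<^sup>+x. ?p x * indicator ?D x \<partial>\<mu>) = emeasure \<nu> ?D"
      using D by (subst dens[symmetric]) (simp add: emeasure_density)
    also have "\<dots> \<le> emeasure \<mu> ?D" by (rule le[OF D])
    finally show False using D by simp
  qed
qed

text \<open>
  If \<open>Y\<close> and \<open>B\<close> have the same law, then \<open>Y\<close> can be completed, with extra independent
  randomness, to a pair that has the joint law of \<open>B\<close> and the random array \<open>X\<close>. The entries are
  produced one after the other: \<open>p k\<close> is the conditional probability, as a Radon-Nikodym
  density, that the next entry of \<open>X\<close> is true, given \<open>B\<close> and the entries before it.
\<close>

lemma transfer_bool_array: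
  fixes Y :: "'a \<Rightarrow> 's" and B :: "'b \<Rightarrow> 's" and X :: "'b \<Rightarrow> nat \<Rightarrow> bool"
  assumes M: "prob_space M" and N: "prob_space N"
    and Y: "Y \<in> measurable M S" and B: "B \<in> measurable N S"
    and YB: "distr M S Y = distr N S B"
    and X: "X \<in> measurable N bool_arrays"
  obtains Z :: "'a \<times> (nat \<Rightarrow> real) \<Rightarrow> nat \<Rightarrow> bool" where
    "Z \<in> measurable (M \<Otimes>\<^sub>M uniforms) bool_arrays"
    "distr (M \<Otimes>\<^sub>M uniforms) (S \<Otimes>\<^sub>M bool_arrays) (\<lambda>z. (Y (fst z), Z z)) =
     distr N (S \<Otimes>\<^sub>M bool_arrays) (\<lambda>\<omega>. (B \<omega>, X \<omega>))"
proof -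
  interpret M: prob_space M by fact
  interpret N: prob_space N by fact
  interpret U: prob_space uniforms by (rule prob_space_uniforms)
  interpret MU: pair_prob_space M uniforms ..
  let ?A = "bool_arrays :: (nat \<Rightarrow> bool) measure"
  let ?V = "uniform_measure lborel {0..1::real}"
  let ?C = "\<lambda>C (F :: nat set). C \<times> {x. \<forall>i\<in>F. x i}"
  note [measurable] = Y B X measurable_compose[OF X measurable_bool_arrays_coord]
  \<comment> \<open>The information available before entry \<open>k\<close> is generated.\<close>
  define W where "W k \<omega> = (B \<omega>, \<lambda>i. i < k \<and> X \<omega> i)" for k :: nat and \<omega>
  have W: "W k \<in> measurable N (S \<Otimes>\<^sub>M ?A)" for k
    unfolding W_def[abs_def] by (intro measurable_Pair measurable_bool_arrays) measurable
  define \<mu> where "\<mu> k = distr N (S \<Otimes>\<^sub>M ?A) (W k)" for k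
  define \<nu> where "\<nu> k = distr (density N (indicator {\<omega> \<in> space N. X \<omega> k})) (S \<Otimes>\<^sub>M ?A) (W k)" for k
  define p where "p k = RN_deriv (\<mu> k) (\<nu> k)" for k
  have Xk: "{\<omega> \<in> space N. X \<omega> k} \<in> sets N" for k
    by measurable
  have \<nu>: "emeasure (\<nu> k) G = emeasure N {\<omega> \<in> space N. W k \<omega> \<in> G \<and> X \<omega> k}" if G: "G \<in> sets (S \<Otimes>\<^sub>M ?A)" for k G
  proof -
    have "W k -` G \<inter> space N \<in> sets N" using W G by (rule measurable_sets)
    then have "emeasure (\<nu> k) G = (\<integral>\<^sup>+\<omega>. indicator {\<omega> \<in> space N. X \<omega> k} \<omega> * indicator (W k -` G \<inter> space N) \<omega> \<partial>N)"
      using W[of k] G unfolding \<nu>_def by (subst emeasure_distr) (auto simp: emeasure_density)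
    also have "\<dots> = (\<integral>\<^sup>+\<omega>. indicator ({\<omega> \<in> space N. X \<omega> k} \<inter> (W k -` G \<inter> space N)) \<omega> \<partial>N)"
      by (simp add: indicator_inter_arith)
    also have "\<dots> = emeasure N ({\<omega> \<in> space N. X \<omega> k} \<inter> (W k -` G \<inter> space N))"
      by (rule nn_integral_indicator[OF sets.Int[OF Xk \<open>W k -` G \<inter> space N \<in> sets N\<close>]])
    finally show ?thesis by (auto simp: vimage_def Int_def conj_ac intro: arg_cong[where f = "emeasure N"])
  qed
  have \<mu>: "emeasure (\<mu> k) G = emeasure N {\<omega> \<in> space N. W k \<omega> \<in> G}" if G: "G \<in> sets (S \<Otimes>\<^sub>M ?A)" for k G
    using W[of k] G unfolding \<mu>_def by (simp add: emeasure_distr vimage_def Int_def conj_commute)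
  have fin: "finite_measure (\<mu> k)" for k
    unfolding \<mu>_def using W[of k] by (intro N.finite_measure_distr)
  have le: "emeasure (\<nu> k) G \<le> emeasure (\<mu> k) G" if "G \<in> sets (\<mu> k)" for k G
  proof -
    have G: "G \<in> sets (S \<Otimes>\<^sub>M ?A)" using that by (simp add: \<mu>_def)
    have "{\<omega> \<in> space N. W k \<omega> \<in> G} \<in> sets N"
      using measurable_sets[OF W G] by (simp add: vimage_def Int_def conj_commute)
    then show ?thesis
      unfolding \<nu>[OF G] \<mu>[OF G] by (intro emeasure_mono) auto
  qed
  have dens: "density (\<mu> k) (p k) = \<nu> k" and p1: "AE w in \<mu> k. p k w \<le> 1" for k
    unfolding p_def using RN_deriv_le_1[OF fin[of k], of "\<nu> k"] le[of _ k] by (simp_all add: \<mu>_def \<nu>_def)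
  have pm [measurable]: "p k \<in> borel_measurable (S \<Otimes>\<^sub>M ?A)" for k
    using borel_measurable_RN_deriv[of "\<mu> k" "\<nu> k"] by (simp add: p_def \<mu>_def)

  define h where "h k z = threshold_array p (Y (fst z)) (snd z) k" for k and z :: "'a \<times> (nat \<Rightarrow> real)"
  define Z where "Z z = (\<lambda>k. h (Suc k) z k)" for z
  have h: "h k \<in> measurable (M \<Otimes>\<^sub>M uniforms) ?A" for k
    using measurable_compose[OF _ measurable_threshold_array[OF pm], of "\<lambda>z. (Y (fst z), snd z)"]
    unfolding h_def[abs_def] by simp
  have Z: "Z \<in> measurable (M \<Otimes>\<^sub>M uniforms) ?A"
    unfolding Z_def by (intro measurable_bool_arrays measurable_compose[OF h measurable_bool_arrays_coord])
  have Zh: "Z z i = h k z i" if "i < k" for i k z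
    using threshold_array_stable[of i "Suc i" k p "Y (fst z)" "snd z"] that
    by (simp add: Z_def h_def Suc_leI del: threshold_array.simps)
  let ?W = "\<lambda>k z. (Y (fst z), h k z)"
  have Wm: "?W k \<in> measurable (M \<Otimes>\<^sub>M uniforms) (S \<Otimes>\<^sub>M ?A)" for k
    using h by (intro measurable_Pair) auto
  have CF: "?C C F \<in> sets (S \<Otimes>\<^sub>M ?A)" if "C \<in> sets S" "finite F" for C F
    using that sets_bool_arrays_cylinder by blast
  have law: "distr (M \<Otimes>\<^sub>M uniforms) (S \<Otimes>\<^sub>M ?A) (?W k) = \<mu> k" for k
  proof (induction k)
    case 0
    show ?case
    proof (rule pair_bool_arrays_eqI)
      fix C and F :: "nat set" assume CF0: "C \<in> sets S" "finite F"
      have "emeasure (distr (M \<Otimes>\<^sub>M uniforms) (S \<Otimes>\<^sub>M ?A) (?W 0)) (?C C F) =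
          emeasure (M \<Otimes>\<^sub>M uniforms) (if F = {} then (Y -` C \<inter> space M) \<times> space uniforms else {})"
      proof -
        have "?W 0 -` ?C C F \<inter> space (M \<Otimes>\<^sub>M uniforms) =
            (if F = {} then (Y -` C \<inter> space M) \<times> space uniforms else {})"
          by (auto simp: h_def space_pair_measure)
        then show ?thesis by (simp only: emeasure_distr[OF Wm CF[OF CF0]])
      qed
      also have "\<dots> = (if F = {} then emeasure (distr M S Y) C else 0)"
        using CF0 measurable_sets[OF Y CF0(1)] by (simp add: U.emeasure_pair_measure_Times U.emeasure_space_1 emeasure_distr)
      also have "\<dots> = emeasure (\<mu> 0) (?C C F)"
        unfolding YB \<mu>[OF CF[OF CF0]] using CF0
        by (auto simp: W_def emeasure_distr vimage_def Int_def conj_commute)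
      finally show "emeasure (distr (M \<Otimes>\<^sub>M uniforms) (S \<Otimes>\<^sub>M ?A) (?W 0)) (?C C F) = emeasure (\<mu> 0) (?C C F)" .
    qed (use Wm[of 0] in \<open>auto simp: \<mu>_def intro: MU.finite_measure_distr\<close>)
  next
    case (Suc k)
    have IH: "emeasure (M \<Otimes>\<^sub>M uniforms) {z \<in> space (M \<Otimes>\<^sub>M uniforms). ?W k z \<in> G} = emeasure (\<mu> k) G"
      if "G \<in> sets (S \<Otimes>\<^sub>M ?A)" for G
      using that Wm[of k] unfolding Suc[symmetric] by (simp add: emeasure_distr vimage_def Int_def conj_commute)
    show ?case
    proof (rule pair_bool_arrays_eqI)
      fix C and F :: "nat set" assume CF0: "C \<in> sets S" "finite F"
      define G where "G = ?C C (F - {k})"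
      have G: "G \<in> sets (S \<Otimes>\<^sub>M ?A)" unfolding G_def using CF0 by (intro CF) auto
      have *: "emeasure (distr (M \<Otimes>\<^sub>M uniforms) (S \<Otimes>\<^sub>M ?A) (?W (Suc k))) (?C C F) =
          emeasure (M \<Otimes>\<^sub>M uniforms) {z \<in> space (M \<Otimes>\<^sub>M uniforms). ?W (Suc k) z \<in> ?C C F}"
        using CF[OF CF0] Wm[of "Suc k"] by (simp add: emeasure_distr vimage_def Int_def conj_commute)
      have hS: "h (Suc k) z = (h k z)(k := ennreal (snd z k) < p k (?W k z))" for z
        by (simp add: h_def)
      show "emeasure (distr (M \<Otimes>\<^sub>M uniforms) (S \<Otimes>\<^sub>M ?A) (?W (Suc k))) (?C C F) = emeasure (\<mu> (Suc k)) (?C C F)"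
      proof (cases "k \<in> F")
        case False
        then have "{z \<in> space (M \<Otimes>\<^sub>M uniforms). ?W (Suc k) z \<in> ?C C F} = {z \<in> space (M \<Otimes>\<^sub>M uniforms). ?W k z \<in> G}"
          by (auto simp: hS G_def)
        moreover have "{\<omega> \<in> space N. W (Suc k) \<omega> \<in> ?C C F} = {\<omega> \<in> space N. W k \<omega> \<in> G}"
          using False by (auto simp: W_def G_def less_Suc_eq)
        ultimately show ?thesis
          unfolding * by (simp add: IH[OF G] \<mu>[OF G] \<mu>[OF CF[OF CF0]])
      next
        case True
        let ?f = "\<lambda>z. indicator {z \<in> space (M \<Otimes>\<^sub>M uniforms). ?W (Suc k) z \<in> ?C C F} z :: ennreal"
        have ev: "{z \<in> space (M \<Otimes>\<^sub>M uniforms). ?W (Suc k) z \<in> ?C C F} \<in> sets (M \<Otimes>\<^sub>M uniforms)"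
          using measurable_sets[OF Wm CF[OF CF0], of "Suc k"] by (simp add: vimage_def Int_def conj_commute)
        have "emeasure (M \<Otimes>\<^sub>M uniforms) {z \<in> space (M \<Otimes>\<^sub>M uniforms). ?W (Suc k) z \<in> ?C C F} = (\<integral>\<^sup>+z. ?f z \<partial>(M \<Otimes>\<^sub>M uniforms))"
          using ev by simp
        also have "\<dots> = (\<integral>\<^sup>+z. \<integral>\<^sup>+v. ?f (fst z, (snd z)(k := v)) \<partial>?V \<partial>(M \<Otimes>\<^sub>M uniforms))"
          using ev by (intro nn_integral_resample[OF M]) auto
        also have "\<dots> = (\<integral>\<^sup>+z. indicator G (?W k z) * emeasure ?V {v. ennreal v < p k (?W k z)} \<partial>(M \<Otimes>\<^sub>M uniforms))"
        proof (rule nn_integral_cong)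
          fix z assume z: "z \<in> space (M \<Otimes>\<^sub>M uniforms)"
          have sp: "(fst z, (snd z)(k := v)) \<in> space (M \<Otimes>\<^sub>M uniforms)" for v
            using z by (auto simp: space_pair_measure space_PiM)
          have "?f (fst z, (snd z)(k := v)) = indicator G (?W k z) * indicator {v. ennreal v < p k (?W k z)} v" for v
            using sp[of v] True
            by (auto simp: indicator_def hS G_def h_def threshold_array_upd)
          then have "(\<integral>\<^sup>+v. ?f (fst z, (snd z)(k := v)) \<partial>?V) = (\<integral>\<^sup>+v. indicator G (?W k z) * indicator {v. ennreal v < p k (?W k z)} v \<partial>?V)"
            by (intro nn_integral_cong)
          also have "\<dots> = indicator G (?W k z) * emeasure ?V {v. ennreal v < p k (?W k z)}"
            by (subst nn_integral_cmult_indicator) auto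
          finally show "(\<integral>\<^sup>+v. ?f (fst z, (snd z)(k := v)) \<partial>?V) = indicator G (?W k z) * emeasure ?V {v. ennreal v < p k (?W k z)}" .
        qed
        also have "\<dots> = (\<integral>\<^sup>+z. (\<lambda>w. indicator G w * p k w) (?W k z) \<partial>(M \<Otimes>\<^sub>M uniforms))"
        proof (rule nn_integral_cong_AE)
          have "AE z in M \<Otimes>\<^sub>M uniforms. p k (?W k z) \<le> 1"
            using p1[of k] unfolding Suc[symmetric] by (subst (asm) AE_distr_iff[OF Wm]) auto
          then show "AE z in M \<Otimes>\<^sub>M uniforms. indicator G (?W k z) * emeasure ?V {v. ennreal v < p k (?W k z)} =
              (\<lambda>w. indicator G w * p k w) (?W k z)"
            by eventually_elim (simp only: emeasure_unit_uniform_less)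
        qed
        also have "\<dots> = (\<integral>\<^sup>+w. indicator G w * p k w \<partial>\<mu> k)"
          unfolding Suc[symmetric] using G Wm[of k] by (subst nn_integral_distr) auto
        also have "\<dots> = emeasure (density (\<mu> k) (p k)) G"
          using G by (subst emeasure_density) (auto simp: \<mu>_def mult.commute)
        also have "\<dots> = emeasure (\<mu> (Suc k)) (?C C F)"
          unfolding dens \<nu>[OF G] \<mu>[OF CF[OF CF0]] using True
          by (auto intro!: arg_cong[where f = "emeasure N"] simp: W_def G_def less_Suc_eq)
        finally show ?thesis unfolding * .
      qed
    qed (use Wm[of "Suc k"] in \<open>auto simp: \<mu>_def intro: MU.finite_measure_distr\<close>)
  qed
  have YZ: "(\<lambda>z. (Y (fst z), Z z)) \<in> measurable (M \<Otimes>\<^sub>M uniforms) (S \<Otimes>\<^sub>M ?A)"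
    using Z by (intro measurable_Pair) auto
  have BX: "(\<lambda>\<omega>. (B \<omega>, X \<omega>)) \<in> measurable N (S \<Otimes>\<^sub>M ?A)"
    by measurable
  have "distr (M \<Otimes>\<^sub>M uniforms) (S \<Otimes>\<^sub>M ?A) (\<lambda>z. (Y (fst z), Z z)) = distr N (S \<Otimes>\<^sub>M ?A) (\<lambda>\<omega>. (B \<omega>, X \<omega>))"
  proof (rule pair_bool_arrays_eqI)
    fix C and F :: "nat set" assume CF0: "C \<in> sets S" "finite F"
    obtain k where k: "F \<subseteq> {..<k}" using finite_nat_iff_bounded CF0(2) by auto
    have "emeasure (distr (M \<Otimes>\<^sub>M uniforms) (S \<Otimes>\<^sub>M ?A) (\<lambda>z. (Y (fst z), Z z))) (?C C F) =
        emeasure (distr (M \<Otimes>\<^sub>M uniforms) (S \<Otimes>\<^sub>M ?A) (?W k)) (?C C F)"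
      unfolding emeasure_distr[OF YZ CF[OF CF0]] emeasure_distr[OF Wm CF[OF CF0]]
    proof -
      have "Z z i = h k z i" if "i \<in> F" for z i using Zh k that by blast
      then show "emeasure (M \<Otimes>\<^sub>M uniforms) ((\<lambda>z. (Y (fst z), Z z)) -` ?C C F \<inter> space (M \<Otimes>\<^sub>M uniforms)) =
          emeasure (M \<Otimes>\<^sub>M uniforms) (?W k -` ?C C F \<inter> space (M \<Otimes>\<^sub>M uniforms))"
        by (intro arg_cong[where f = "emeasure _"]) auto
    qed
    also have "\<dots> = emeasure (distr N (S \<Otimes>\<^sub>M ?A) (\<lambda>\<omega>. (B \<omega>, X \<omega>))) (?C C F)"
      unfolding law \<mu>_def emeasure_distr[OF W CF[OF CF0]] emeasure_distr[OF BX CF[OF CF0]]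
      using k by (intro arg_cong[where f = "emeasure _"]) (auto simp: W_def)
    finally show "emeasure (distr (M \<Otimes>\<^sub>M uniforms) (S \<Otimes>\<^sub>M ?A) (\<lambda>z. (Y (fst z), Z z))) (?C C F) =
        emeasure (distr N (S \<Otimes>\<^sub>M ?A) (\<lambda>\<omega>. (B \<omega>, X \<omega>))) (?C C F)" .
  qed (use YZ in \<open>auto intro: MU.finite_measure_distr\<close>)
  with Z show ?thesis by (rule that)
qed

section \<open>Gaps of an increasing path\<close>

lemma card_image_same_kernel:
  assumes "\<And>i j. i \<in> A \<Longrightarrow> j \<in> A \<Longrightarrow> f i = f j \<longleftrightarrow> g i = g j"
  shows "card (f ` A) = card (g ` A)"
proof -
  have "bij_betw (\<lambda>v. g (SOME i. i \<in> A \<and> f i = v)) (f ` A) (g ` A)"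
  proof (rule bij_betw_imageI)
    have *: "(SOME i. i \<in> A \<and> f i = v) \<in> A \<and> f (SOME i. i \<in> A \<and> f i = v) = v" if "v \<in> f ` A" for v
      using that by (intro someI_ex[of "\<lambda>i. i \<in> A \<and> f i = v"]) auto
    show "inj_on (\<lambda>v. g (SOME i. i \<in> A \<and> f i = v)) (f ` A)"
    proof (rule inj_onI)
      fix v w assume vw: "v \<in> f ` A" "w \<in> f ` A"
        "g (SOME i. i \<in> A \<and> f i = v) = g (SOME i. i \<in> A \<and> f i = w)"
      with *[of v] *[of w] assms show "v = w" by metis
    qed
    show "(\<lambda>v. g (SOME i. i \<in> A \<and> f i = v)) ` f ` A = g ` A"
    proof (intro equalityI subsetI)
      fix y assume "y \<in> g ` A"
      then obtain j where j: "j \<in> A" "y = g j" by auto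
      with *[of "f j"] assms have "g (SOME i. i \<in> A \<and> f i = f j) = y" by auto
      with j show "y \<in> (\<lambda>v. g (SOME i. i \<in> A \<and> f i = v)) ` f ` A"
        by (intro image_eqI[of y _ "f j"]) auto
    qed (use * in auto)
  qed
  then show ?thesis by (rule bij_betw_same_card)
qed

locale increasing_path =
  fixes x :: "real \<Rightarrow> real"
  assumes path_start: "x 0 = 0"
    and path_mono: "mono_on {0..} x"
    and path_right_cont: "\<And>t. 0 \<le> t \<Longrightarrow> continuous (at_right t) x"
begin

lemma path_le: "0 \<le> s \<Longrightarrow> s \<le> t \<Longrightarrow> x s \<le> x t"
  using path_mono by (auto simp: mono_on_def)

lemma path_below_persists:
  assumes "0 \<le> t" "x t < e"
  obtains b where "t < b" "\<And>s. t \<le> s \<Longrightarrow> s < b \<Longrightarrow> x s < e"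
proof -
  have "(x \<longlongrightarrow> x t) (at_right t)"
    using path_right_cont[OF assms(1)] by (simp add: continuous_within)
  then have "eventually (\<lambda>s. x s < e) (at_right t)"
    using assms(2) by (rule order_tendstoD)
  then obtain b where "b > t" "\<forall>s>t. s < b \<longrightarrow> x s < e"
    by (auto simp: eventually_at_right_field)
  then show ?thesis using assms(2)
    by (intro that[of b]) (auto simp: order_le_less)
qed

text \<open>
  The first time at which the path reaches level \<open>e\<close>; by right-continuity the infimum is
  attained.
\<close>

definition passage :: "real \<Rightarrow> real" where
  "passage e = Inf {t. 0 \<le> t \<and> e \<le> x t}"

lemma passage_le_iff:
  assumes "\<exists>t\<ge>0. e \<le> x t" "0 \<le> t"
  shows "passage e \<le> t \<longleftrightarrow> e \<le> x t"
proof
  let ?S = "{t. 0 \<le> t \<and> e \<le> x t}"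
  have S: "?S \<noteq> {}" "bdd_below ?S" using assms by (auto intro: bdd_belowI[of _ 0])
  show "passage e \<le> t" if "e \<le> x t"
    unfolding passage_def using that assms S by (intro cInf_lower) auto
  assume le: "passage e \<le> t"
  show "e \<le> x t"
  proof (rule ccontr)
    assume "\<not> e \<le> x t"
    then obtain b where b: "t < b" "\<And>s. t \<le> s \<Longrightarrow> s < b \<Longrightarrow> x s < e"
      using path_below_persists[of t e] assms by auto
    have "Inf ?S < b" using le b(1) by (simp add: passage_def)
    then obtain s where s: "s \<in> ?S" "s < b" using cInf_lessD[OF S(1)] by blast
    then show False using b(2)[of s] path_le[of s t] assms(2) \<open>\<not> e \<le> x t\<close>
      by (cases "t \<le> s") auto
  qed
qed

lemma passage_nonneg: "\<exists>t\<ge>0. e \<le> x t \<Longrightarrow> 0 \<le> passage e"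
  unfolding passage_def by (intro cInf_greatest) auto

lemma decreasing_step_path_remaining:
  "decreasing_step_path (\<lambda>t. {k. k < m \<and> x t < e k})" for m :: nat
proof
  fix s t :: real assume "0 \<le> s" "s \<le> t"
  then show "{k. k < m \<and> x t < e k} \<subseteq> {k. k < m \<and> x s < e k}"
    using path_le[of s t] by auto
next
  fix t :: real assume t: "0 \<le> t"
  have "eventually (\<lambda>s. \<forall>k\<in>{..<m}. x s < e k \<longleftrightarrow> x t < e k) (at_right t)"
  proof (rule eventually_ball_finite)
    show "\<forall>k\<in>{..<m}. eventually (\<lambda>s. x s < e k \<longleftrightarrow> x t < e k) (at_right t)"
    proof
      fix k
      show "eventually (\<lambda>s. x s < e k \<longleftrightarrow> x t < e k) (at_right t)"
      proof (cases "x t < e k")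
        case True
        then obtain b where b: "t < b" "\<And>s. t \<le> s \<Longrightarrow> s < b \<Longrightarrow> x s < e k"
          using path_below_persists[OF t] by metis
        then show ?thesis using True
          unfolding eventually_at_right_field by (intro exI[of _ b]) auto
      next
        case False
        then show ?thesis
          unfolding eventually_at_right_field using path_le[OF t]
          by (intro exI[of _ "t + 1"]) (auto simp: not_less intro: order_trans)
      qed
    qed
  qed simp
  then show "eventually (\<lambda>s. {k. k < m \<and> x s < e k} = {k. k < m \<and> x t < e k}) (at_right t)"
    by eventually_elim auto
qed

text \<open>
  The set of points above the path changes exactly when the path passes one of the points.
\<close>

lemma jump_times_remaining:
  assumes e: "\<And>k. k < m \<Longrightarrow> 0 < e k" "\<And>k. k < m \<Longrightarrow> \<exists>t\<ge>0. e k \<le> x t"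
  shows "jump_times (\<lambda>t. {k. k < m \<and> x t < e k}) = (\<lambda>k. passage (e k)) ` {..<m :: nat}"
    (is "jump_times ?f = ?T")
proof (intro equalityI subsetI)
  have below: "x t < e k \<longleftrightarrow> t < passage (e k)" if "k < m" "0 \<le> t" for k t
    using passage_le_iff[OF e(2)[OF that(1)] that(2)] by linarith
  have pos: "0 < passage (e k)" if "k < m" for k
    using below[OF that order_refl] e(1)[OF that] by (simp add: path_start)
  {
    fix t assume "t \<in> ?T"
    then obtain k where k: "k < m" "t = passage (e k)" by auto
    have "\<not> eventually (\<lambda>s. ?f s = ?f t) (at_left t)"
    proof
      assume "eventually (\<lambda>s. ?f s = ?f t) (at_left t)"
      moreover have "eventually (\<lambda>s. s \<in> {0<..<t}) (at_left t)"
        using pos[OF k(1)] k(2) by (intro eventually_at_left_real) auto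
      ultimately have "eventually (\<lambda>s. False) (at_left t)"
      proof eventually_elim
        case (elim s)
        then have "k \<in> ?f s" "k \<notin> ?f t" using below[of k s] below[of k t] k pos[OF k(1)] by auto
        with elim(1) show ?case by simp
      qed
      then show False by simp
    qed
    then show "t \<in> jump_times ?f" using pos[OF k(1)] k(2) by (simp add: jump_times_def)
  next
    fix t assume t: "t \<in> jump_times ?f"
    show "t \<in> ?T"
    proof (rule ccontr)
      assume "t \<notin> ?T"
      have t0: "0 < t" using t by (simp add: jump_times_def)
      have "eventually (\<lambda>s. \<forall>k\<in>{..<m}. x s < e k \<longleftrightarrow> x t < e k) (at_left t)"
      proof (rule eventually_ball_finite)
        show "\<forall>k\<in>{..<m}. eventually (\<lambda>s. x s < e k \<longleftrightarrow> x t < e k) (at_left t)"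
        proof
          fix k assume k: "k \<in> {..<m}"
          with \<open>t \<notin> ?T\<close> have "t \<noteq> passage (e k)" by auto
          have "eventually (\<lambda>s. s \<in> {(if t < passage (e k) then 0 else passage (e k))<..<t}) (at_left t)"
            using t0 \<open>t \<noteq> passage (e k)\<close> by (intro eventually_at_left_real) auto
          then show "eventually (\<lambda>s. x s < e k \<longleftrightarrow> x t < e k) (at_left t)"
          proof eventually_elim
            case (elim s)
            then have "0 \<le> s" using pos[of k] k by (auto split: if_splits)
            then show ?case
              using below[of k s] below[of k t] k t0 elim \<open>t \<noteq> passage (e k)\<close> by (auto split: if_splits)
          qed
        qed
      qed simp
      then have "eventually (\<lambda>s. ?f s = ?f t) (at_left t)"
        by eventually_elim auto
      with t show False by (simp add: jump_times_def)
    qed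
  }
qed

abbreviation vacant :: "real set" where
  "vacant \<equiv> {0..} - closure (x ` {0..})"

lemma connected_component_real_iff:
  fixes a b :: real
  assumes "a \<le> b"
  shows "connected_component S a b \<longleftrightarrow> {a..b} \<subseteq> S"
proof
  assume "connected_component S a b"
  then obtain T where "connected T" "T \<subseteq> S" "a \<in> T" "b \<in> T"
    by (auto simp: connected_component_def)
  then show "{a..b} \<subseteq> S" using connected_contains_Icc[of T a b] by auto
next
  assume "{a..b} \<subseteq> S"
  then show "connected_component S a b"
    unfolding connected_component_def using assms by (intro exI[of _ "{a..b}"]) auto
qed

text \<open>
  For end points off the closed range it makes no difference whether the range or its closure is
  avoided, as an open interval that meets the closure meets the range.
\<close>

lemma Icc_subset_vacant_iff:
  assumes "a \<in> vacant" "b \<in> vacant" "a \<le> b"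
  shows "{a..b} \<subseteq> vacant \<longleftrightarrow> (\<forall>t\<ge>0. \<not> (a < x t \<and> x t < b))"
proof
  assume sub: "{a..b} \<subseteq> vacant"
  show "\<forall>t\<ge>0. \<not> (a < x t \<and> x t < b)"
  proof (intro allI impI notI)
    fix t :: real assume t: "0 \<le> t" "a < x t \<and> x t < b"
    then have "x t \<in> closure (x ` {0..})" by (intro subsetD[OF closure_subset]) auto
    moreover have "x t \<in> {a..b}" using t by simp
    with sub have "x t \<in> vacant" by (rule subsetD)
    ultimately show False by simp
  qed
next
  assume none: "\<forall>t\<ge>0. \<not> (a < x t \<and> x t < b)"
  show "{a..b} \<subseteq> vacant"
  proof
    fix z assume z: "z \<in> {a..b}"
    have "z \<notin> closure (x ` {0..})"
    proof
      assume cl: "z \<in> closure (x ` {0..})"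
      with assms z have "z \<in> {a<..<b}" by (auto simp: order_le_less)
      with cl have "{a<..<b} \<inter> x ` {0..} \<noteq> {}"
        using open_Int_closure_eq_empty[of "{a<..<b}" "x ` {0..}"] by auto
      with none show False by auto
    qed
    with z assms show "z \<in> vacant" by auto
  qed
qed

text \<open>
  Components of subsets of the line are intervals, so two vacant points are in the same gap iff
  the path does not visit the interval between them, that is, iff the path passes them
  simultaneously.
\<close>

lemma connected_component_vacant_iff:
  assumes "a \<in> vacant" "b \<in> vacant"
  shows "connected_component_set vacant a = connected_component_set vacant b \<longleftrightarrow>
    (\<forall>t\<ge>0. x t < a \<longleftrightarrow> x t < b)"
proof -
  have *: "connected_component_set vacant a = connected_component_set vacant b \<longleftrightarrow> (\<forall>t\<ge>0. x t < a \<longleftrightarrow> x t < b)"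
    if ab: "a \<in> vacant" "b \<in> vacant" "a \<le> b" for a b
  proof -
    have ne: "x t \<noteq> a" "x t \<noteq> b" if "0 \<le> t" for t
    proof -
      have "x t \<in> closure (x ` {0..})" using that by (intro subsetD[OF closure_subset]) auto
      with ab show "x t \<noteq> a" "x t \<noteq> b" by auto
    qed
    have "connected_component_set vacant a = connected_component_set vacant b \<longleftrightarrow> connected_component vacant a b"
      using ab by (subst connected_component_eq_eq) auto
    also have "\<dots> \<longleftrightarrow> (\<forall>t\<ge>0. \<not> (a < x t \<and> x t < b))"
      using ab by (simp only: connected_component_real_iff Icc_subset_vacant_iff)
    also have "\<dots> \<longleftrightarrow> (\<forall>t\<ge>0. x t < a \<longleftrightarrow> x t < b)"
      using ne ab(3) by (meson linorder_neqE_linordered_idom order_less_le_trans order_less_asym)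
    finally show ?thesis .
  qed
  show ?thesis
    using *[OF assms] *[OF assms(2,1)] by (cases "a \<le> b") auto
qed

lemma occupied_gaps_eq:
  "{G \<in> gaps x. \<exists>k<m. e k \<in> G} = (\<lambda>k. connected_component_set vacant (e k)) ` {k. k < m \<and> e k \<in> vacant}"
  for m :: nat
proof (intro equalityI subsetI)
  fix G assume "G \<in> {G \<in> gaps x. \<exists>k<m. e k \<in> G}"
  then obtain k where k: "G \<in> components vacant" "k < m" "e k \<in> G" by (auto simp: gaps_def)
  then have "e k \<in> vacant" using in_components_subset by blast
  moreover have "G = connected_component_set vacant (e k)"
    using k by (metis components_iff connected_component_eq)
  ultimately show "G \<in> (\<lambda>k. connected_component_set vacant (e k)) ` {k. k < m \<and> e k \<in> vacant}"
    using k(2) by blast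
next
  fix G assume "G \<in> (\<lambda>k. connected_component_set vacant (e k)) ` {k. k < m \<and> e k \<in> vacant}"
  then obtain k where k: "k < m" "e k \<in> vacant" "G = connected_component_set vacant (e k)" by auto
  then have "G \<in> components vacant" "e k \<in> G" by (auto simp: components_def)
  with k(1) show "G \<in> {G \<in> gaps x. \<exists>k<m. e k \<in> G}" by (auto simp: gaps_def)
qed

text \<open>
  Occupied gaps correspond to the distinct passage times of the points, and these are the jump
  times of the set of points above the path.
\<close>

lemma card_occupied_gaps:
  assumes e: "\<And>k. k < m \<Longrightarrow> 0 < e k" "\<And>k. k < m \<Longrightarrow> \<exists>t\<ge>0. e k \<le> x t"
    "\<And>k. k < m \<Longrightarrow> e k \<notin> closure (x ` {0..})"
  shows "card {G \<in> gaps x. \<exists>k<m. e k \<in> G} = num_values m (\<lambda>(k, q). x \<bar>of_rat q\<bar> < e k)"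
proof -
  let ?f = "\<lambda>t. {k. k < m \<and> x t < e k}"
  interpret f: decreasing_step_path ?f by (rule decreasing_step_path_remaining)
  have vac: "e k \<in> vacant" if "k < m" for k using e that by force
  have "card {G \<in> gaps x. \<exists>k<m. e k \<in> G} = card ((\<lambda>k. connected_component_set vacant (e k)) ` {..<m})"
    unfolding occupied_gaps_eq using vac by (intro arg_cong[where f = card] image_cong) auto
  also have "\<dots> = card ((\<lambda>k. passage (e k)) ` {..<m})"
  proof (rule card_image_same_kernel)
    fix i j assume "i \<in> {..<m}" "j \<in> {..<m}"
    then have ij: "i < m" "j < m" by auto
    have below: "x t < e k \<longleftrightarrow> t < passage (e k)" if "k < m" "0 \<le> t" for k t
      using passage_le_iff[OF e(2)[OF that(1)] that(2)] by linarith
    have "(\<forall>t\<ge>0. x t < e i \<longleftrightarrow> x t < e j) \<longleftrightarrow> (\<forall>t\<ge>0. t < passage (e i) \<longleftrightarrow> t < passage (e j))"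
      using below[OF ij(1)] below[OF ij(2)] by auto
    also have "\<dots> \<longleftrightarrow> passage (e i) = passage (e j)"
      using passage_nonneg[OF e(2)[OF ij(1)]] passage_nonneg[OF e(2)[OF ij(2)]]
      by (metis linorder_neqE_linordered_idom order_less_irrefl)
    finally show "connected_component_set vacant (e i) = connected_component_set vacant (e j) \<longleftrightarrow>
        passage (e i) = passage (e j)"
      using connected_component_vacant_iff[OF vac[OF ij(1)] vac[OF ij(2)]] by simp
  qed
  also have "\<dots> = card (jump_times ?f)"
    using jump_times_remaining[of m e] e by simp
  also have "\<dots> = num_values m (\<lambda>(k, q). x \<bar>of_rat q\<bar> < e k)"
    unfolding f.card_jump_times f.values_at_rationals num_values_def by simp
  finally show ?thesis .
qed

text \<open>
  By right-continuity the values at rational times are dense in the range from above.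
\<close>

lemma rational_time:
  assumes "0 \<le> t" "x t < c"
  obtains q :: rat where "x t \<le> x \<bar>of_rat q\<bar>" "x \<bar>of_rat q\<bar> < c"
proof -
  obtain b where b: "t < b" "\<And>s. t \<le> s \<Longrightarrow> s < b \<Longrightarrow> x s < c"
    using path_below_persists[OF assms] by metis
  obtain q :: rat where q: "t < of_rat q" "of_rat q < b" using of_rat_dense[OF b(1)] by auto
  have "\<bar>of_rat q\<bar> = (of_rat q :: real)" using q assms(1) by linarith
  with q b(2)[of "of_rat q"] path_le[OF assms(1), of "of_rat q"] show ?thesis
    by (intro that[of q]) auto
qed

lemma not_in_closure_iff:
  "e \<notin> closure (x ` {0..}) \<longleftrightarrow> (\<exists>n. \<forall>q::rat. 1 / real (Suc n) \<le> \<bar>x \<bar>of_rat q\<bar> - e\<bar>)"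
proof
  assume "e \<notin> closure (x ` {0..})"
  then obtain d where d: "0 < d" "\<And>t. 0 \<le> t \<Longrightarrow> d \<le> \<bar>x t - e\<bar>"
    by (auto simp: closure_approachable dist_real_def not_less)
  obtain n where "1 / real (Suc n) < d" using nat_approx_posE[OF d(1)] by blast
  then show "\<exists>n. \<forall>q::rat. 1 / real (Suc n) \<le> \<bar>x \<bar>of_rat q\<bar> - e\<bar>"
    using d(2) by (intro exI[of _ n]) (metis abs_ge_zero less_le_trans order_less_imp_le)
next
  assume "\<exists>n. \<forall>q::rat. 1 / real (Suc n) \<le> \<bar>x \<bar>of_rat q\<bar> - e\<bar>"
  then obtain n where n: "\<And>q::rat. 1 / real (Suc n) \<le> \<bar>x \<bar>of_rat q\<bar> - e\<bar>" by auto
  show "e \<notin> closure (x ` {0..})"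
  proof
    assume "e \<in> closure (x ` {0..})"
    then obtain t where t: "0 \<le> t" "\<bar>x t - e\<bar> < 1 / real (Suc n)"
      unfolding closure_approachable dist_real_def by (metis atLeast_iff imageE of_nat_0_less_iff zero_less_Suc zero_less_divide_1_iff)
    have "x t < e + 1 / real (Suc n)" using t(2) by linarith
    from rational_time[OF t(1) this]
    obtain q :: rat where "x t \<le> x \<bar>of_rat q\<bar>" "x \<bar>of_rat q\<bar> < e + 1 / real (Suc n)"
      by blast
    with t(2) have "\<bar>x \<bar>of_rat q\<bar> - e\<bar> < 1 / real (Suc n)" by linarith
    with n[of q] show False by simp
  qed
qed

lemma same_side_iff:
  "(\<forall>t\<ge>0. x t < a \<longleftrightarrow> x t < b) \<longleftrightarrow> (\<forall>q::rat. x \<bar>of_rat q\<bar> < a \<longleftrightarrow> x \<bar>of_rat q\<bar> < b)"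
proof
  assume *: "\<forall>q::rat. x \<bar>of_rat q\<bar> < a \<longleftrightarrow> x \<bar>of_rat q\<bar> < b"
  show "\<forall>t\<ge>0. x t < a \<longleftrightarrow> x t < b"
  proof (intro allI impI iffI)
    fix t :: real assume t: "0 \<le> t"
    show "x t < b" if "x t < a" using rational_time[OF t that] * by (metis order_le_less_trans)
    show "x t < a" if "x t < b" using rational_time[OF t that] * by (metis order_le_less_trans)
  qed
qed simp

text \<open>
  Counting each gap by its first occupant gives a formula in terms of countably many values,
  which is valid for every path and all points, also those in the closed range. It serves to
  prove measurability on the whole probability space rather than up to a null set.
\<close>

lemma card_occupied_gaps_first:
  "card {G \<in> gaps x. \<exists>k<m. e k \<in> G} =
    card {k \<in> {..<m}. e k \<in> vacant \<and> (\<forall>i<k. e i \<in> vacant \<longrightarrow> \<not> (\<forall>q::rat. x \<bar>of_rat q\<bar> < e i \<longleftrightarrow> x \<bar>of_rat q\<bar> < e k))}"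
  (is "_ = card ?K") for m :: nat
proof -
  let ?g = "\<lambda>k. connected_component_set vacant (e k)"
  have same: "?g i = ?g k \<longleftrightarrow> (\<forall>q::rat. x \<bar>of_rat q\<bar> < e i \<longleftrightarrow> x \<bar>of_rat q\<bar> < e k)"
    if "e i \<in> vacant" "e k \<in> vacant" for i k
    using connected_component_vacant_iff[OF that] by (simp add: same_side_iff)
  have K: "?K = {k. k < m \<and> e k \<in> vacant \<and> (\<forall>i<k. e i \<in> vacant \<longrightarrow> ?g i \<noteq> ?g k)}"
    using same by auto
  have "?g ` {k. k < m \<and> e k \<in> vacant} = ?g ` ?K"
  proof (intro equalityI subsetI)
    fix G assume "G \<in> ?g ` {k. k < m \<and> e k \<in> vacant}"
    then obtain k where k: "k < m \<and> e k \<in> vacant \<and> ?g k = G" by auto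
    define l where "l = (LEAST k. k < m \<and> e k \<in> vacant \<and> ?g k = G)"
    have l: "l < m \<and> e l \<in> vacant \<and> ?g l = G" unfolding l_def using k by (rule LeastI)
    have "\<forall>i<l. e i \<in> vacant \<longrightarrow> ?g i \<noteq> ?g l"
      using not_less_Least[of _ "\<lambda>k. k < m \<and> e k \<in> vacant \<and> ?g k = G"] l unfolding l_def[symmetric]
      by (metis order_less_trans)
    with l show "G \<in> ?g ` ?K" unfolding K by blast
  qed (auto simp: K)
  moreover have "inj_on ?g ?K"
    unfolding K by (rule inj_onI) (metis (mono_tags, lifting) mem_Collect_eq linorder_neqE_nat)
  ultimately show ?thesis
    unfolding occupied_gaps_eq by (simp add: card_image)
qed

end

section \<open>Gaps of the subordinator\<close>

lemma min_1_le_exp: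
  assumes "0 \<le> (x::real)"
  shows "min 1 x \<le> 2 * (1 - exp (- x))"
proof -
  have "1 + x \<le> exp x" by (rule exp_ge_add_one_self)
  then have "exp (- x) \<le> 1 / (1 + x)"
    using assms by (simp add: exp_minus inverse_eq_divide frac_le)
  moreover have "1 / (1 + x) \<le> 1 - min 1 x / 2"
    using assms by (cases "x \<le> 1") (auto simp: field_simps min_def power2_eq_square mult_left_le)
  ultimately have "exp (- x) \<le> 1 - min 1 x / 2" by (rule order_trans)
  then show ?thesis by (simp add: algebra_simps)
qed

text \<open>
  In the form of a product law independence visibly depends on the joint law only.
\<close>

lemma (in prob_space) indep_set_vimage_iff:
  assumes X: "X \<in> measurable M S" and Y: "Y \<in> measurable M T"
  shows "indep_set (sets (vimage_algebra (space M) X S)) (sets (vimage_algebra (space M) Y T)) \<longleftrightarrow>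
    distr M S X \<Otimes>\<^sub>M distr M T Y = distr M (S \<Otimes>\<^sub>M T) (\<lambda>\<omega>. (X \<omega>, Y \<omega>))"
    (is "?indep \<longleftrightarrow> ?P \<Otimes>\<^sub>M ?Q = ?J")
proof
  interpret P: prob_space ?P by (rule prob_space_distr[OF X])
  interpret Q: prob_space ?Q by (rule prob_space_distr[OF Y])
  have XY: "(\<lambda>\<omega>. (X \<omega>, Y \<omega>)) \<in> measurable M (S \<Otimes>\<^sub>M T)"
    by (intro measurable_Pair X Y)
  have sX: "sets (vimage_algebra (space M) X S) = {X -` A \<inter> space M |A. A \<in> sets S}"
    using measurable_space[OF X] by (intro sets_vimage_algebra2) auto
  have sY: "sets (vimage_algebra (space M) Y T) = {Y -` A \<inter> space M |A. A \<in> sets T}"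
    using measurable_space[OF Y] by (intro sets_vimage_algebra2) auto
  have J: "emeasure ?J (A \<times> B) = emeasure M ((X -` A \<inter> space M) \<inter> (Y -` B \<inter> space M))"
    if "A \<in> sets S" "B \<in> sets T" for A B
    using that XY by (subst emeasure_distr) (auto intro!: arg_cong[where f = "emeasure M"])
  {
    assume ind: ?indep
    show "?P \<Otimes>\<^sub>M ?Q = ?J"
    proof (rule pair_measure_eqI)
      fix A B assume "A \<in> sets ?P" "B \<in> sets ?Q"
      then have AB: "A \<in> sets S" "B \<in> sets T" by auto
      have "prob ((X -` A \<inter> space M) \<inter> (Y -` B \<inter> space M)) = prob (X -` A \<inter> space M) * prob (Y -` B \<inter> space M)"
        using AB by (intro indep_setD[OF ind]) (auto simp: sX sY)
      then show "emeasure ?P A * emeasure ?Q B = emeasure ?J (A \<times> B)"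
        unfolding J[OF AB] using AB X Y
        by (simp add: emeasure_distr emeasure_eq_measure ennreal_mult)
    qed (auto intro: P.sigma_finite_measure_axioms Q.sigma_finite_measure_axioms)
  next
    assume eq: "?P \<Otimes>\<^sub>M ?Q = ?J"
    show ?indep
    proof (rule indep_setI)
      show "sets (vimage_algebra (space M) X S) \<subseteq> events" "sets (vimage_algebra (space M) Y T) \<subseteq> events"
        using X Y by (auto simp: sX sY)
      fix a b assume "a \<in> sets (vimage_algebra (space M) X S)" "b \<in> sets (vimage_algebra (space M) Y T)"
      then obtain A B where AB: "A \<in> sets S" "B \<in> sets T" "a = X -` A \<inter> space M" "b = Y -` B \<inter> space M"
        by (auto simp: sX sY)
      have "emeasure M (a \<inter> b) = emeasure (?P \<Otimes>\<^sub>M ?Q) (A \<times> B)"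
        unfolding eq using J[OF AB(1,2)] AB(3,4) by simp
      also have "\<dots> = emeasure M a * emeasure M b"
        using AB X Y by (subst Q.emeasure_pair_measure_Times) (simp_all add: emeasure_distr)
      finally show "prob (a \<inter> b) = prob a * prob b"
        by (simp add: emeasure_eq_measure ennreal_mult[symmetric])
    qed
  }
qed

abbreviation path_space :: "(real \<Rightarrow> real) measure" where
  "path_space \<equiv> \<Pi>\<^sub>M t\<in>{0..}. borel"

abbreviation sample_space :: "(nat \<Rightarrow> real) measure" where
  "sample_space \<equiv> \<Pi>\<^sub>M j\<in>{1..}. borel"

locale beta_sample = sampled_subordinator M "phi \<beta>" \<xi> E
  for M :: "'a measure" and \<beta> :: real and \<xi> :: "real \<Rightarrow> 'a \<Rightarrow> real" and E :: "nat \<Rightarrow> 'a \<Rightarrow> real" +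
  assumes beta: "\<beta> > -2"
begin

lemma increasing_path: "\<omega> \<in> space M \<Longrightarrow> increasing_path (\<lambda>t. \<xi> t \<omega>)"
  by standard (auto simp: start nondecreasing right_continuous)

lemma xi_mono: "\<omega> \<in> space M \<Longrightarrow> 0 \<le> s \<Longrightarrow> s \<le> t \<Longrightarrow> \<xi> s \<omega> \<le> \<xi> t \<omega>"
  using increasing_path.path_le[OF increasing_path] .

lemma xi_nonneg: "\<omega> \<in> space M \<Longrightarrow> 0 \<le> t \<Longrightarrow> 0 \<le> \<xi> t \<omega>"
  using xi_mono[of \<omega> 0 t] start by simp

lemma laplace_nat:
  assumes t: "0 \<le> t"
  shows "expectation (\<lambda>\<omega>. exp (- (real n * \<xi> t \<omega>))) = exp (- (t * split_rate \<beta> n))"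
proof -
  have "of_real (expectation (\<lambda>\<omega>. exp (- (real n * \<xi> t \<omega>)))) =
      (LINT \<omega>|M. complex_of_real (exp (- (real n * \<xi> t \<omega>))))"
    by simp
  also have "\<dots> = (LINT \<omega>|M. exp (- (of_nat n * of_real (\<xi> t \<omega>))))"
    by (simp add: exp_of_real[symmetric])
  also have "\<dots> = exp (- (of_real t * of_real (split_rate \<beta> n)))"
    using laplace_exponent[OF t, of "of_nat n"] by (simp add: phi_of_nat)
  also have "\<dots> = of_real (exp (- (t * split_rate \<beta> n)))"
    by (simp add: exp_of_real[symmetric])
  finally show ?thesis unfolding of_real_eq_iff .
qed

lemma expectation_increment:
  assumes "0 \<le> s" "s \<le> t" and f: "f \<in> borel_measurable borel"
  shows "expectation (\<lambda>\<omega>. f (\<xi> t \<omega> - \<xi> s \<omega>)) = (expectation (\<lambda>\<omega>. f (\<xi> (t - s) \<omega>)) :: real)"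
proof -
  have m: "(\<lambda>\<omega>. \<xi> (s + (t - s)) \<omega> - \<xi> s \<omega>) \<in> borel_measurable M" "\<xi> (t - s) \<in> borel_measurable M"
    using assms by (auto intro!: borel_measurable_diff random_variable_xi)
  have "expectation (\<lambda>\<omega>. f (\<xi> (s + (t - s)) \<omega> - \<xi> s \<omega>)) =
      (LINT y|distr M borel (\<lambda>\<omega>. \<xi> (s + (t - s)) \<omega> - \<xi> s \<omega>). f y)"
    by (rule integral_distr[symmetric, OF m(1) f])
  also have "\<dots> = (LINT y|distr M borel (\<xi> (t - s)). f y)"
    using stationary_increments[of s "t - s"] assms by simp
  also have "\<dots> = expectation (\<lambda>\<omega>. f (\<xi> (t - s) \<omega>))"
    by (rule integral_distr[OF m(2) f])
  finally show ?thesis by simp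
qed

text \<open>
  Independence and stationarity of the increments over \<open>\<tau> 0, \<tau> 1, \<dots>\<close>.
\<close>

lemma expectation_chain:
  fixes \<tau> :: "nat \<Rightarrow> real" and c :: "nat \<Rightarrow> nat"
  assumes \<tau>: "\<tau> 0 = 0" "mono \<tau>"
  shows "expectation (\<lambda>\<omega>. \<Prod>i<k. exp (- (real (c i) * (\<xi> (\<tau> (Suc i)) \<omega> - \<xi> (\<tau> i) \<omega>)))) =
    (\<Prod>i<k. exp (- ((\<tau> (Suc i) - \<tau> i) * split_rate \<beta> (c i))))"
proof -
  have \<tau>i: "0 \<le> \<tau> i" "\<tau> i \<le> \<tau> (Suc i)" for i
    using monoD[OF \<tau>(2), of 0 i] monoD[OF \<tau>(2), of i "Suc i"] \<tau>(1) by auto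
  have [measurable]: "\<xi> (\<tau> i) \<in> borel_measurable M" for i by (intro random_variable_xi \<tau>i)
  have "indep_vars (\<lambda>_. borel) (\<lambda>i \<omega>. exp (- (real (c i) * (\<xi> (\<tau> (Suc i)) \<omega> - \<xi> (\<tau> i) \<omega>)))) {..<k}"
    by (rule indep_vars_compose2[OF independent_increments, where Y = "\<lambda>i y. exp (- (real (c i) * y))"]) (auto simp: \<tau>)
  moreover have "integrable M (\<lambda>\<omega>. exp (- (real (c i) * (\<xi> (\<tau> (Suc i)) \<omega> - \<xi> (\<tau> i) \<omega>))))" for i
  proof (rule integrable_const_bound[of _ 1])
    show "AE \<omega> in M. norm (exp (- (real (c i) * (\<xi> (\<tau> (Suc i)) \<omega> - \<xi> (\<tau> i) \<omega>)))) \<le> 1"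
      using xi_mono[OF _ \<tau>i(1) \<tau>i(2)] by (intro AE_I2) simp
  qed measurable
  ultimately have "expectation (\<lambda>\<omega>. \<Prod>i<k. exp (- (real (c i) * (\<xi> (\<tau> (Suc i)) \<omega> - \<xi> (\<tau> i) \<omega>)))) =
      (\<Prod>i<k. expectation (\<lambda>\<omega>. exp (- (real (c i) * (\<xi> (\<tau> (Suc i)) \<omega> - \<xi> (\<tau> i) \<omega>)))))"
    by (intro indep_vars_lebesgue_integral) auto
  also have "\<dots> = (\<Prod>i<k. exp (- ((\<tau> (Suc i) - \<tau> i) * split_rate \<beta> (c i))))"
  proof (intro prod.cong refl)
    fix i
    have "expectation (\<lambda>\<omega>. exp (- (real (c i) * (\<xi> (\<tau> (Suc i)) \<omega> - \<xi> (\<tau> i) \<omega>)))) =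
        expectation (\<lambda>\<omega>. exp (- (real (c i) * \<xi> (\<tau> (Suc i) - \<tau> i) \<omega>)))"
      using expectation_increment[OF \<tau>i, where f = "\<lambda>y. exp (- (real (c i) * y))"] by simp
    then show "expectation (\<lambda>\<omega>. exp (- (real (c i) * (\<xi> (\<tau> (Suc i)) \<omega> - \<xi> (\<tau> i) \<omega>)))) =
        exp (- ((\<tau> (Suc i) - \<tau> i) * split_rate \<beta> (c i)))"
      using laplace_nat[of "\<tau> (Suc i) - \<tau> i" "c i"] \<tau>i[of i] by simp
  qed
  finally show ?thesis .
qed

definition path where "path \<omega> = (\<lambda>t\<in>{0..}. \<xi> t \<omega>)"
definition sample where "sample \<omega> = (\<lambda>j\<in>{1..}. E j \<omega>)"


lemma E_measurable: "1 \<le> j \<Longrightarrow> E j \<in> borel_measurable M"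
  using exponential[of j] by (simp add: distributed_def)

lemma path_measurable: "path \<in> measurable M path_space"
  unfolding path_def[abs_def] by (rule measurable_restrict) (auto intro: random_variable_xi)

lemma sample_measurable: "sample \<in> measurable M sample_space"
  unfolding sample_def[abs_def] by (rule measurable_restrict) (auto intro: E_measurable)

lemma path_sample_joint_law:
  "distr M path_space path \<Otimes>\<^sub>M distr M sample_space sample =
    distr M (path_space \<Otimes>\<^sub>M sample_space) (\<lambda>\<omega>. (path \<omega>, sample \<omega>))"
proof -
  have "indep_set (sets (vimage_algebra (space M) path path_space)) (sets (vimage_algebra (space M) sample sample_space))"
    using sample_indep_xi by (simp add: path_def[abs_def] sample_def[abs_def])
  then show ?thesis
    by (rule indep_set_vimage_iff[OF path_measurable sample_measurable, THEN iffD1])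
qed

text \<open>
  Fubini: by independence the path may be frozen while the exponential sample is redrawn.
\<close>

lemma emeasure_path_sample:
  assumes G: "G \<in> sets (path_space \<Otimes>\<^sub>M sample_space)"
  shows "emeasure M {\<omega> \<in> space M. (path \<omega>, sample \<omega>) \<in> G} =
    (\<integral>\<^sup>+\<omega>. emeasure M {\<omega>' \<in> space M. (path \<omega>, sample \<omega>') \<in> G} \<partial>M)"
proof -
  let ?P = "distr M path_space path" and ?S = "distr M sample_space sample"
  interpret P: prob_space ?P by (rule prob_space_distr[OF path_measurable])
  interpret S: prob_space ?S by (rule prob_space_distr[OF sample_measurable])
  have ps: "(\<lambda>\<omega>. (path \<omega>, sample \<omega>)) \<in> measurable M (path_space \<Otimes>\<^sub>M sample_space)"
    by (intro measurable_Pair path_measurable sample_measurable)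
  note eq = path_sample_joint_law
  have G': "G \<in> sets (?P \<Otimes>\<^sub>M ?S)" using G by (simp cong: sets_pair_measure_cong)
  have "emeasure M {\<omega> \<in> space M. (path \<omega>, sample \<omega>) \<in> G} = emeasure (?P \<Otimes>\<^sub>M ?S) G"
    unfolding eq using ps G by (simp add: emeasure_distr vimage_def Int_def conj_commute)
  also have "\<dots> = (\<integral>\<^sup>+x. emeasure ?S (Pair x -` G) \<partial>?P)"
    by (rule S.emeasure_pair_measure_alt[OF G'])
  also have "\<dots> = (\<integral>\<^sup>+\<omega>. emeasure ?S (Pair (path \<omega>) -` G) \<partial>M)"
  proof (rule nn_integral_distr[OF path_measurable])
    show "(\<lambda>x. emeasure ?S (Pair x -` G)) \<in> borel_measurable ?P"
      by (rule S.measurable_emeasure_Pair[OF G'])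
  qed
  also have "\<dots> = (\<integral>\<^sup>+\<omega>. emeasure M {\<omega>' \<in> space M. (path \<omega>, sample \<omega>') \<in> G} \<partial>M)"
  proof (rule nn_integral_cong)
    fix \<omega>
    have "Pair (path \<omega>) -` G \<in> sets sample_space" using sets_Pair1[OF G] .
    then show "emeasure ?S (Pair (path \<omega>) -` G) = emeasure M {\<omega>' \<in> space M. (path \<omega>, sample \<omega>') \<in> G}"
      using sample_measurable by (simp add: emeasure_distr vimage_def Int_def conj_commute)
  qed
  finally show ?thesis .
qed

lemma prob_E_gt:
  assumes "1 \<le> j" "0 \<le> c"
  shows "prob {\<omega> \<in> space M. c < E j \<omega>} = exp (- c)"
  using exponential_distributedD_gt[OF exponential[OF assms(1)] assms(2)] by simp

lemma prob_all_E_gt: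
  assumes J: "finite J" "J \<subseteq> {1..}" and c: "\<And>j. j \<in> J \<Longrightarrow> 0 \<le> c j"
  shows "prob {\<omega> \<in> space M. \<forall>j\<in>J. c j < E j \<omega>} = exp (- (\<Sum>j\<in>J. c j))"
proof (cases "J = {}")
  case True then show ?thesis by (simp add: prob_space)
next
  case False
  have "prob (\<Inter>j\<in>J. E j -` {c j<..} \<inter> space M) = (\<Prod>j\<in>J. prob (E j -` {c j<..} \<inter> space M))"
    by (rule indep_varsD[OF independent_sample False J]) auto
  also have "(\<Inter>j\<in>J. E j -` {c j<..} \<inter> space M) = {\<omega> \<in> space M. \<forall>j\<in>J. c j < E j \<omega>}"
    using False by auto
  also have "(\<Prod>j\<in>J. prob (E j -` {c j<..} \<inter> space M)) = (\<Prod>j\<in>J. exp (- c j))"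
  proof (rule prod.cong[OF refl])
    fix j assume j: "j \<in> J"
    then have "E j -` {c j<..} \<inter> space M = {\<omega> \<in> space M. c j < E j \<omega>}" by auto
    then show "prob (E j -` {c j<..} \<inter> space M) = exp (- c j)"
      using prob_E_gt[of j "c j"] j J c by auto
  qed
  also have "\<dots> = exp (- (\<Sum>j\<in>J. c j))"
    using J(1) by (simp add: exp_sum sum_negf[symmetric])
  finally show ?thesis .
qed

lemma xi_coord: "0 \<le> t \<Longrightarrow> \<xi> t \<omega> = path \<omega> t"
  by (simp add: path_def)

lemma E_coord: "1 \<le> j \<Longrightarrow> E j \<omega> = sample \<omega> j"
  by (simp add: sample_def)

lemma prob_all_E_gt_xi:
  assumes J: "finite J" "J \<subseteq> {1..}" and t: "\<And>j. j \<in> J \<Longrightarrow> 0 \<le> t j"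
  shows "prob {\<omega> \<in> space M. \<forall>j\<in>J. \<xi> (t j) \<omega> < E j \<omega>} = expectation (\<lambda>\<omega>. exp (- (\<Sum>j\<in>J. \<xi> (t j) \<omega>)))"
proof -
  let ?G = "{z \<in> space (path_space \<Otimes>\<^sub>M sample_space). \<forall>j\<in>J. fst z (t j) < snd z j}"
  have G: "?G \<in> sets (path_space \<Otimes>\<^sub>M sample_space)"
  proof (intro sets.sets_Collect_finite_All J)
    fix j assume j: "j \<in> J"
    have [measurable]: "(\<lambda>z. fst z (t j)) \<in> borel_measurable (path_space \<Otimes>\<^sub>M sample_space)"
      "(\<lambda>z. snd z j) \<in> borel_measurable (path_space \<Otimes>\<^sub>M sample_space)"
      using j J t by (auto intro!: measurable_compose[OF measurable_fst] measurable_compose[OF measurable_snd] measurable_component_singleton)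
    show "{z \<in> space (path_space \<Otimes>\<^sub>M sample_space). fst z (t j) < snd z j} \<in> sets (path_space \<Otimes>\<^sub>M sample_space)"
      by measurable
  qed
  have mem: "(path \<omega>, sample \<omega>') \<in> ?G \<longleftrightarrow> (\<forall>j\<in>J. \<xi> (t j) \<omega> < E j \<omega>')" if "\<omega> \<in> space M" "\<omega>' \<in> space M" for \<omega> \<omega>'
    using measurable_space[OF path_measurable that(1)] measurable_space[OF sample_measurable that(2)] J t
    by (auto simp: space_pair_measure xi_coord E_coord subset_iff)
  have [measurable]: "\<xi> (t j) \<in> borel_measurable M" if "j \<in> J" for j using that t by (intro random_variable_xi)
  have "emeasure M {\<omega> \<in> space M. \<forall>j\<in>J. \<xi> (t j) \<omega> < E j \<omega>} = emeasure M {\<omega> \<in> space M. (path \<omega>, sample \<omega>) \<in> ?G}"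
    using mem by (intro arg_cong[where f = "emeasure M"]) blast
  also have "\<dots> = (\<integral>\<^sup>+\<omega>. emeasure M {\<omega>' \<in> space M. (path \<omega>, sample \<omega>') \<in> ?G} \<partial>M)"
    by (rule emeasure_path_sample[OF G])
  also have "\<dots> = (\<integral>\<^sup>+\<omega>. ennreal (exp (- (\<Sum>j\<in>J. \<xi> (t j) \<omega>))) \<partial>M)"
  proof (rule nn_integral_cong)
    fix \<omega> assume \<omega>: "\<omega> \<in> space M"
    have "{\<omega>' \<in> space M. (path \<omega>, sample \<omega>') \<in> ?G} = {\<omega>' \<in> space M. \<forall>j\<in>J. \<xi> (t j) \<omega> < E j \<omega>'}"
      using mem[OF \<omega>] by blast
    then show "emeasure M {\<omega>' \<in> space M. (path \<omega>, sample \<omega>') \<in> ?G} = ennreal (exp (- (\<Sum>j\<in>J. \<xi> (t j) \<omega>)))"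
      using prob_all_E_gt[OF J, of "\<lambda>j. \<xi> (t j) \<omega>"] xi_nonneg[OF \<omega>] t by (simp add: emeasure_eq_measure)
  qed
  also have "\<dots> = ennreal (expectation (\<lambda>\<omega>. exp (- (\<Sum>j\<in>J. \<xi> (t j) \<omega>))))"
  proof (rule nn_integral_eq_integral)
    show "integrable M (\<lambda>\<omega>. exp (- (\<Sum>j\<in>J. \<xi> (t j) \<omega>)))"
    proof (rule integrable_const_bound[of _ 1])
      show "AE \<omega> in M. norm (exp (- (\<Sum>j\<in>J. \<xi> (t j) \<omega>))) \<le> 1"
        using xi_nonneg t by (intro AE_I2) (simp add: sum_nonneg)
    qed measurable
  qed simp
  finally show ?thesis
    by (simp add: emeasure_eq_measure integral_nonneg_AE)
qed

text \<open>
  Label \<open>j\<close> is required to survive up to the last time \<open>\<tau> (l j)\<close> at which it is listed. Given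
  the path this has probability \<open>exp (- \<xi> (\<tau> (l j)))\<close>; summing by parts over the increments, the
  interval from \<open>\<tau> i\<close> to \<open>\<tau> (i + 1)\<close> is counted once for each label in \<open>A (i + 1)\<close>.
\<close>

lemma prob_chain:
  fixes A :: "nat \<Rightarrow> nat set"
  assumes \<tau>: "\<tau> 0 = 0" "mono \<tau>"
    and A: "\<And>i. finite (A i)" "\<And>i. A i \<subseteq> {1..}" "\<And>i. A (Suc i) \<subseteq> A i"
  shows "prob {\<omega> \<in> space M. \<forall>i\<in>{1..k}. \<forall>j\<in>A i. \<xi> (\<tau> i) \<omega> < E j \<omega>} =
    (\<Prod>i<k. exp (- ((\<tau> (Suc i) - \<tau> i) * split_rate \<beta> (card (A (Suc i))))))"
proof (cases "k = 0")
  case True then show ?thesis by (simp add: prob_space)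
next
  case False
  have A_anti: "A j \<subseteq> A i" if "i \<le> j" for i j
    using that by (induction rule: dec_induct) (use A(3) in auto)
  have \<tau>0: "0 \<le> \<tau> i" for i using monoD[OF \<tau>(2), of 0 i] \<tau>(1) by simp
  \<comment> \<open>The last time at which survival of \<open>j\<close> is required.\<close>
  define l where "l j = Max {i \<in> {1..k}. j \<in> A i}" for j
  have l: "l j \<in> {1..k} \<and> j \<in> A (l j)" and le_l: "\<And>i. i \<in> {1..k} \<Longrightarrow> j \<in> A i \<longleftrightarrow> i \<le> l j" if "j \<in> A 1" for j
  proof -
    have "{i \<in> {1..k}. j \<in> A i} \<noteq> {}" using that False by (auto intro: exI[of _ 1])
    from Max_in[OF _ this] show *: "l j \<in> {1..k} \<and> j \<in> A (l j)" by (simp add: l_def)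
    show "j \<in> A i \<longleftrightarrow> i \<le> l j" if "i \<in> {1..k}" for i
      using that * A_anti[of i "l j"] by (auto simp: l_def)
  qed
  have A1: "j \<in> A 1" if "i \<in> {1..k}" "j \<in> A i" for i j using that A_anti[of 1 i] by auto
  have "{\<omega> \<in> space M. \<forall>i\<in>{1..k}. \<forall>j\<in>A i. \<xi> (\<tau> i) \<omega> < E j \<omega>} = {\<omega> \<in> space M. \<forall>j\<in>A 1. \<xi> (\<tau> (l j)) \<omega> < E j \<omega>}"
  proof (intro Collect_cong conj_cong refl iffI ballI)
    fix \<omega> i j assume \<omega>: "\<omega> \<in> space M" and all: "\<forall>j\<in>A 1. \<xi> (\<tau> (l j)) \<omega> < E j \<omega>" and ij: "i \<in> {1..k}" "j \<in> A i"
    have j: "j \<in> A 1" using A1[OF ij] .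
    have "\<xi> (\<tau> i) \<omega> \<le> \<xi> (\<tau> (l j)) \<omega>"
      using le_l[OF j ij(1)] ij(2) by (intro xi_mono \<omega> \<tau>0 monoD[OF \<tau>(2)]) auto
    with all j show "\<xi> (\<tau> i) \<omega> < E j \<omega>" by force
  next
    fix \<omega> j assume "\<forall>i\<in>{1..k}. \<forall>j\<in>A i. \<xi> (\<tau> i) \<omega> < E j \<omega>" "j \<in> A 1"
    with l[of j] show "\<xi> (\<tau> (l j)) \<omega> < E j \<omega>" by blast
  qed
  then have "prob {\<omega> \<in> space M. \<forall>i\<in>{1..k}. \<forall>j\<in>A i. \<xi> (\<tau> i) \<omega> < E j \<omega>} = expectation (\<lambda>\<omega>. exp (- (\<Sum>j\<in>A 1. \<xi> (\<tau> (l j)) \<omega>)))"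
    using prob_all_E_gt_xi[OF A(1,2)[of 1], of "\<lambda>j. \<tau> (l j)"] \<tau>0 by simp
  also have "\<dots> = expectation (\<lambda>\<omega>. \<Prod>i<k. exp (- (real (card (A (Suc i))) * (\<xi> (\<tau> (Suc i)) \<omega> - \<xi> (\<tau> i) \<omega>))))"
  proof (rule Bochner_Integration.integral_cong[OF refl])
    fix \<omega> assume \<omega>: "\<omega> \<in> space M"
    let ?d = "\<lambda>i. \<xi> (\<tau> (Suc i)) \<omega> - \<xi> (\<tau> i) \<omega>"
    have "(\<Sum>j\<in>A 1. \<xi> (\<tau> (l j)) \<omega>) = (\<Sum>j\<in>A 1. \<Sum>i<k. (if j \<in> A (Suc i) then ?d i else 0))"
    proof (rule sum.cong[OF refl])
      fix j assume j: "j \<in> A 1"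
      have "\<xi> (\<tau> (l j)) \<omega> = (\<Sum>i<l j. ?d i)"
        using start[OF \<omega>] \<tau>(1) by (subst sum_lessThan_telescope) simp
      also have "\<dots> = (\<Sum>i\<in>{i \<in> {..<k}. j \<in> A (Suc i)}. ?d i)"
        using l[OF j] le_l[OF j] by (intro sum.cong refl) auto
      also have "\<dots> = (\<Sum>i<k. (if j \<in> A (Suc i) then ?d i else 0))"
        by (rule sum.inter_filter) simp
      finally show "\<xi> (\<tau> (l j)) \<omega> = (\<Sum>i<k. (if j \<in> A (Suc i) then ?d i else 0))" .
    qed
    also have "\<dots> = (\<Sum>i<k. \<Sum>j\<in>A 1. (if j \<in> A (Suc i) then ?d i else 0))"
      by (rule sum.swap)
    also have "\<dots> = (\<Sum>i<k. real (card (A (Suc i))) * ?d i)"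
    proof (rule sum.cong[OF refl])
      fix i
      have "{j \<in> A 1. j \<in> A (Suc i)} = A (Suc i)" using A_anti[of 1 "Suc i"] by auto
      then show "(\<Sum>j\<in>A 1. (if j \<in> A (Suc i) then ?d i else 0)) = real (card (A (Suc i))) * ?d i"
        using A(1) by (subst sum.inter_filter[symmetric]) auto
    qed
    finally show "exp (- (\<Sum>j\<in>A 1. \<xi> (\<tau> (l j)) \<omega>)) = (\<Prod>i<k. exp (- (real (card (A (Suc i))) * ?d i)))"
      by (simp add: exp_sum sum_negf[symmetric])
  qed
  also have "\<dots> = (\<Prod>i<k. exp (- ((\<tau> (Suc i) - \<tau> i) * split_rate \<beta> (card (A (Suc i))))))"
    by (rule expectation_chain[OF \<tau>])
  finally show ?thesis .
qed

lemma prob_E_in_Ioc_le: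
  assumes j: "1 \<le> j" and a: "0 \<le> a" "a \<le> u" and d: "0 \<le> d" "v - u \<le> d"
  shows "prob {\<omega> \<in> space M. u < E j \<omega> \<and> E j \<omega> \<le> v} \<le> exp (- a) * d"
proof (cases "u \<le> v")
  case False
  then have "{\<omega> \<in> space M. u < E j \<omega> \<and> E j \<omega> \<le> v} = {}" by auto
  with d show ?thesis by (simp only: measure_empty) simp
next
  case True
  have [measurable]: "E j \<in> borel_measurable M" by (rule E_measurable[OF j])
  have "{\<omega> \<in> space M. u < E j \<omega> \<and> E j \<omega> \<le> v} = {\<omega> \<in> space M. u < E j \<omega>} - {\<omega> \<in> space M. v < E j \<omega>}"
    using True by auto
  moreover have "prob ({\<omega> \<in> space M. u < E j \<omega>} - {\<omega> \<in> space M. v < E j \<omega>}) =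
      prob {\<omega> \<in> space M. u < E j \<omega>} - prob {\<omega> \<in> space M. v < E j \<omega>}"
    using True by (intro finite_measure_Diff) auto
  ultimately have "prob {\<omega> \<in> space M. u < E j \<omega> \<and> E j \<omega> \<le> v} = exp (- u) - exp (- v)"
    using True a prob_E_gt[OF j, of u] prob_E_gt[OF j, of v] by simp
  also have "exp (- u) - exp (- v) = exp (- u) * (1 - exp (- (v - u)))"
    by (simp add: algebra_simps flip: exp_add)
  also have "\<dots> \<le> exp (- a) * d"
  proof (rule mult_mono)
    show "1 - exp (- (v - u)) \<le> d" using exp_ge_add_one_self[of "- (v - u)"] d by linarith
  qed (use a True in auto)
  finally show ?thesis .
qed

text \<open>
  The interval consists of those points within \<open>\<eta>\<close> of \<open>\<xi> t\<close> that are at distance more than \<open>\<eta>\<close>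
  above \<open>\<xi> s\<close> (enlarged a little on the left, so that it is half-open). It lies above \<open>\<xi> s\<close>,
  where the exponential density is at most \<open>exp (- \<xi> s)\<close>, and its length is at most \<open>3 * \<eta>\<close> and
  at most the increment \<open>\<xi> t - \<xi> s\<close>.
\<close>

lemma prob_E_in_random_Ioc_le:
  assumes j: "1 \<le> j" and t: "0 \<le> s" "s \<le> t" and \<eta>: "0 < \<eta>"
  shows "prob {\<omega> \<in> space M. max (\<xi> t \<omega> - 2 * \<eta>) (\<xi> s \<omega> + \<eta>) < E j \<omega> \<and> E j \<omega> \<le> \<xi> t \<omega> + \<eta>} \<le>
    exp (- (s * split_rate \<beta> 1)) * expectation (\<lambda>\<omega>. min (3 * \<eta>) (\<xi> (t - s) \<omega>))"
proof -
  let ?G = "{z \<in> space (path_space \<Otimes>\<^sub>M sample_space).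
    max (fst z t - 2 * \<eta>) (fst z s + \<eta>) < snd z j \<and> snd z j \<le> fst z t + \<eta>}"
  let ?B = "{\<omega> \<in> space M. max (\<xi> t \<omega> - 2 * \<eta>) (\<xi> s \<omega> + \<eta>) < E j \<omega> \<and> E j \<omega> \<le> \<xi> t \<omega> + \<eta>}"
  have st: "0 \<le> s" "0 \<le> t" "0 \<le> t - s" using t by auto
  have [measurable]: "(\<lambda>z. fst z s) \<in> borel_measurable (path_space \<Otimes>\<^sub>M sample_space)"
    "(\<lambda>z. fst z t) \<in> borel_measurable (path_space \<Otimes>\<^sub>M sample_space)"
    "(\<lambda>z. snd z j) \<in> borel_measurable (path_space \<Otimes>\<^sub>M sample_space)"
    using j st by (auto intro!: measurable_compose[OF measurable_fst] measurable_compose[OF measurable_snd] measurable_component_singleton)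
  have G: "?G \<in> sets (path_space \<Otimes>\<^sub>M sample_space)" by measurable
  have [measurable]: "\<xi> s \<in> borel_measurable M" "\<xi> t \<in> borel_measurable M" "\<xi> (t - s) \<in> borel_measurable M"
    using st by (auto intro: random_variable_xi)
  have mem: "(path \<omega>, sample \<omega>') \<in> ?G \<longleftrightarrow>
      max (\<xi> t \<omega> - 2 * \<eta>) (\<xi> s \<omega> + \<eta>) < E j \<omega>' \<and> E j \<omega>' \<le> \<xi> t \<omega> + \<eta>"
    if "\<omega> \<in> space M" "\<omega>' \<in> space M" for \<omega> \<omega>'
    using measurable_space[OF path_measurable that(1)] measurable_space[OF sample_measurable that(2)] st j
    by (simp add: space_pair_measure xi_coord E_coord)
  have "emeasure M ?B = emeasure M {\<omega> \<in> space M. (path \<omega>, sample \<omega>) \<in> ?G}"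
    using mem by (intro arg_cong[where f = "emeasure M"]) blast
  also have "\<dots> = (\<integral>\<^sup>+\<omega>. emeasure M {\<omega>' \<in> space M. (path \<omega>, sample \<omega>') \<in> ?G} \<partial>M)"
    by (rule emeasure_path_sample[OF G])
  also have "\<dots> \<le> (\<integral>\<^sup>+\<omega>. ennreal (exp (- \<xi> s \<omega>) * min (3 * \<eta>) (\<xi> t \<omega> - \<xi> s \<omega>)) \<partial>M)"
  proof (rule nn_integral_mono)
    fix \<omega> assume \<omega>: "\<omega> \<in> space M"
    have "{\<omega>' \<in> space M. (path \<omega>, sample \<omega>') \<in> ?G} =
        {\<omega>' \<in> space M. max (\<xi> t \<omega> - 2 * \<eta>) (\<xi> s \<omega> + \<eta>) < E j \<omega>' \<and> E j \<omega>' \<le> \<xi> t \<omega> + \<eta>}"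
      using mem[OF \<omega>] by blast
    moreover have "prob \<dots> \<le> exp (- \<xi> s \<omega>) * min (3 * \<eta>) (\<xi> t \<omega> - \<xi> s \<omega>)"
    proof (rule prob_E_in_Ioc_le[OF j])
      have le: "0 \<le> \<xi> s \<omega>" "\<xi> s \<omega> \<le> \<xi> t \<omega>"
        using xi_nonneg[OF \<omega> st(1)] xi_mono[OF \<omega> t] by auto
      show "0 \<le> \<xi> s \<omega>" by (rule le(1))
      show "\<xi> s \<omega> \<le> max (\<xi> t \<omega> - 2 * \<eta>) (\<xi> s \<omega> + \<eta>)" using \<eta> by linarith
      show "0 \<le> min (3 * \<eta>) (\<xi> t \<omega> - \<xi> s \<omega>)" using \<eta> le by simp
      show "\<xi> t \<omega> + \<eta> - max (\<xi> t \<omega> - 2 * \<eta>) (\<xi> s \<omega> + \<eta>) \<le> min (3 * \<eta>) (\<xi> t \<omega> - \<xi> s \<omega>)"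
        by (simp add: min_def max_def)
    qed
    ultimately show "emeasure M {\<omega>' \<in> space M. (path \<omega>, sample \<omega>') \<in> ?G} \<le>
        ennreal (exp (- \<xi> s \<omega>) * min (3 * \<eta>) (\<xi> t \<omega> - \<xi> s \<omega>))"
      by (simp add: emeasure_eq_measure ennreal_leI)
  qed
  also have "\<dots> = ennreal (expectation (\<lambda>\<omega>. exp (- \<xi> s \<omega>) * min (3 * \<eta>) (\<xi> t \<omega> - \<xi> s \<omega>)))"
  proof (rule nn_integral_eq_integral)
    show "integrable M (\<lambda>\<omega>. exp (- \<xi> s \<omega>) * min (3 * \<eta>) (\<xi> t \<omega> - \<xi> s \<omega>))"
    proof (rule integrable_const_bound[of _ "3 * \<eta>"])
      show "AE \<omega> in M. norm (exp (- \<xi> s \<omega>) * min (3 * \<eta>) (\<xi> t \<omega> - \<xi> s \<omega>)) \<le> 3 * \<eta>"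
      proof (intro AE_I2)
        fix \<omega> assume \<omega>: "\<omega> \<in> space M"
        have "exp (- \<xi> s \<omega>) * min (3 * \<eta>) (\<xi> t \<omega> - \<xi> s \<omega>) \<le> 1 * (3 * \<eta>)"
          using xi_nonneg[OF \<omega> st(1)] xi_mono[OF \<omega> t] \<eta> by (intro mult_mono) auto
        then show "norm (exp (- \<xi> s \<omega>) * min (3 * \<eta>) (\<xi> t \<omega> - \<xi> s \<omega>)) \<le> 3 * \<eta>"
          using xi_mono[OF \<omega> t] \<eta> by (simp add: abs_mult)
      qed
    qed measurable
    show "AE \<omega> in M. 0 \<le> exp (- \<xi> s \<omega>) * min (3 * \<eta>) (\<xi> t \<omega> - \<xi> s \<omega>)"
      using xi_mono[OF _ t] \<eta> by (intro AE_I2) auto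
  qed
  finally have "ennreal (prob ?B) \<le> ennreal (expectation (\<lambda>\<omega>. exp (- \<xi> s \<omega>) * min (3 * \<eta>) (\<xi> t \<omega> - \<xi> s \<omega>)))"
    by (simp only: emeasure_eq_measure)
  moreover have "0 \<le> expectation (\<lambda>\<omega>. exp (- \<xi> s \<omega>) * min (3 * \<eta>) (\<xi> t \<omega> - \<xi> s \<omega>))"
    using xi_mono[OF _ t] \<eta> by (intro integral_nonneg_AE AE_I2) auto
  ultimately have le: "prob ?B \<le> expectation (\<lambda>\<omega>. exp (- \<xi> s \<omega>) * min (3 * \<eta>) (\<xi> t \<omega> - \<xi> s \<omega>))"
    by simp
  define \<tau> where "\<tau> i = (if i = 0 then 0 else if i = 1 then s else t)" for i :: nat
  have \<tau>: "mono \<tau>" "0 \<le> \<tau> 0" using t by (auto simp: \<tau>_def mono_def)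
  \<comment> \<open>The two factors belong to the increments over the intervals from 0 to \<open>s\<close> and from \<open>s\<close> to \<open>t\<close>.\<close>
  define Y where "Y i y = (if i = 0 then exp (- y) else min (3 * \<eta>) y)" for i :: nat and y :: real
  have Ym: "Y i \<in> borel_measurable borel" for i unfolding Y_def[abs_def] by (cases "i = 0") auto
  have "indep_vars (\<lambda>_. borel) (\<lambda>i \<omega>. Y i (\<xi> (\<tau> (Suc i)) \<omega> - \<xi> (\<tau> i) \<omega>)) {..<2}"
    by (rule indep_vars_compose2[OF independent_increments]) (use \<tau> Ym in auto)
  moreover have "integrable M (\<lambda>\<omega>. Y i (\<xi> (\<tau> (Suc i)) \<omega> - \<xi> (\<tau> i) \<omega>))" for i
  proof (rule integrable_const_bound[of _ "max 1 (3 * \<eta>)"])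
    have \<tau>i: "0 \<le> \<tau> i" "\<tau> i \<le> \<tau> (Suc i)" for i using t by (auto simp: \<tau>_def)
    show "AE \<omega> in M. norm (Y i (\<xi> (\<tau> (Suc i)) \<omega> - \<xi> (\<tau> i) \<omega>)) \<le> max 1 (3 * \<eta>)"
    proof (intro AE_I2)
      have "norm (Y i y) \<le> max 1 (3 * \<eta>)" if "0 \<le> y" for y
        using that \<eta> by (auto simp: Y_def le_max_iff_disj min_def)
      moreover fix \<omega> assume "\<omega> \<in> space M"
      ultimately show "norm (Y i (\<xi> (\<tau> (Suc i)) \<omega> - \<xi> (\<tau> i) \<omega>)) \<le> max 1 (3 * \<eta>)"
        using xi_mono[OF _ \<tau>i[of i]] by simp
    qed
    show "(\<lambda>\<omega>. Y i (\<xi> (\<tau> (Suc i)) \<omega> - \<xi> (\<tau> i) \<omega>)) \<in> borel_measurable M"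
      using \<tau>i[of i] by (intro measurable_compose[OF _ Ym] borel_measurable_diff random_variable_xi) auto
  qed
  ultimately have "expectation (\<lambda>\<omega>. \<Prod>i<2. Y i (\<xi> (\<tau> (Suc i)) \<omega> - \<xi> (\<tau> i) \<omega>)) =
      (\<Prod>i<2. expectation (\<lambda>\<omega>. Y i (\<xi> (\<tau> (Suc i)) \<omega> - \<xi> (\<tau> i) \<omega>)))"
    by (intro indep_vars_lebesgue_integral) auto
  then have "expectation (\<lambda>\<omega>. exp (- (\<xi> s \<omega> - \<xi> 0 \<omega>)) * min (3 * \<eta>) (\<xi> t \<omega> - \<xi> s \<omega>)) =
      expectation (\<lambda>\<omega>. exp (- (\<xi> s \<omega> - \<xi> 0 \<omega>))) * expectation (\<lambda>\<omega>. min (3 * \<eta>) (\<xi> t \<omega> - \<xi> s \<omega>))"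
    by (simp add: numeral_2_eq_2 \<tau>_def Y_def)
  also have "expectation (\<lambda>\<omega>. exp (- (\<xi> s \<omega> - \<xi> 0 \<omega>)) * min (3 * \<eta>) (\<xi> t \<omega> - \<xi> s \<omega>)) =
      expectation (\<lambda>\<omega>. exp (- \<xi> s \<omega>) * min (3 * \<eta>) (\<xi> t \<omega> - \<xi> s \<omega>))"
    by (rule Bochner_Integration.integral_cong[OF refl]) (simp add: start)
  also have "expectation (\<lambda>\<omega>. exp (- (\<xi> s \<omega> - \<xi> 0 \<omega>))) = exp (- (s * split_rate \<beta> 1))"
  proof -
    have "expectation (\<lambda>\<omega>. exp (- (\<xi> s \<omega> - \<xi> 0 \<omega>))) = expectation (\<lambda>\<omega>. exp (- (real 1 * \<xi> s \<omega>)))"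
      by (rule Bochner_Integration.integral_cong[OF refl]) (simp add: start)
    then show ?thesis using laplace_nat[OF st(1), of 1] by simp
  qed
  also have "expectation (\<lambda>\<omega>. min (3 * \<eta>) (\<xi> t \<omega> - \<xi> s \<omega>)) = expectation (\<lambda>\<omega>. min (3 * \<eta>) (\<xi> (t - s) \<omega>))"
    by (rule expectation_increment[OF t, where f = "\<lambda>y. min (3 * \<eta>) y"]) simp
  finally show ?thesis using le by simp
qed

text \<open>
  The truncation at level \<open>1 / n\<close> is comparable to \<open>(1 - exp (- n * x)) / n\<close>, whose expectation
  is known.
\<close>

lemma expectation_min_increment_le:
  assumes h: "0 \<le> h" and n: "1 \<le> n"
  shows "expectation (\<lambda>\<omega>. min (1 / real n) (\<xi> h \<omega>)) \<le> 2 / n * (h * split_rate \<beta> n)"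
proof -
  have [measurable]: "\<xi> h \<in> borel_measurable M" by (rule random_variable_xi[OF h])
  have int: "integrable M (\<lambda>\<omega>. exp (- (real n * \<xi> h \<omega>)))"
    by (rule integrable_const_bound[of _ 1]) (use xi_nonneg[OF _ h] in auto)
  have "expectation (\<lambda>\<omega>. min (1 / real n) (\<xi> h \<omega>)) \<le> expectation (\<lambda>\<omega>. 2 / n * (1 - exp (- (real n * \<xi> h \<omega>))))"
  proof (rule integral_mono)
    show "integrable M (\<lambda>\<omega>. min (1 / real n) (\<xi> h \<omega>))"
      by (rule integrable_const_bound[of _ "1 / n"]) (use xi_nonneg[OF _ h] in auto)
    show "integrable M (\<lambda>\<omega>. 2 / n * (1 - exp (- (real n * \<xi> h \<omega>))))"
      using int by simp
    fix \<omega> assume \<omega>: "\<omega> \<in> space M"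
    have "min (1 / real n) (\<xi> h \<omega>) = 1 / n * min 1 (real n * \<xi> h \<omega>)"
      using n by (auto simp: min_def field_simps)
    also have "\<dots> \<le> 1 / n * (2 * (1 - exp (- (real n * \<xi> h \<omega>))))"
      using xi_nonneg[OF \<omega> h] by (intro mult_left_mono min_1_le_exp) auto
    finally show "min (1 / real n) (\<xi> h \<omega>) \<le> 2 / n * (1 - exp (- (real n * \<xi> h \<omega>)))" by simp
  qed
  also have "\<dots> = 2 / n * (1 - exp (- (h * split_rate \<beta> n)))"
    using int laplace_nat[OF h, of n] by (simp add: prob_space)
  also have "\<dots> \<le> 2 / n * (h * split_rate \<beta> n)"
    using exp_ge_add_one_self[of "- (h * split_rate \<beta> n)"] by (intro mult_left_mono) auto
  finally show ?thesis .
qed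

text \<open>
  The probability that an exponential point is within \<open>1 / (3 n)\<close> of the path observed on the
  grid \<open>0, h, 2 h, \<dots>\<close>. Look at the first grid value that is this close: apart from the start of
  the path, the point lies in the interval of the lemma on random intervals for two consecutive
  grid times. The resulting geometric series has the sum \<open>1 / (1 - exp (- h * \<phi> 1))\<close>, which is
  of order \<open>1 / h\<close>, while the increments contribute \<open>h * \<phi> n / n\<close>. Hence the bound does not
  depend on the mesh, and it tends to 0 with \<open>n\<close> since there is no drift.
\<close>

lemma prob_near_grid_le:
  fixes h :: real
  assumes j: "1 \<le> j" and h: "0 < h" "h * split_rate \<beta> 1 \<le> 1" and n: "1 \<le> n"
  shows "prob {\<omega> \<in> space M. \<exists>k::nat. \<bar>\<xi> (k * h) \<omega> - E j \<omega>\<bar> \<le> 1 / (3 * n)} \<le>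
    1 / (3 * n) + 4 * (split_rate \<beta> n / n) / split_rate \<beta> 1"
proof -
  let ?r = "split_rate \<beta> 1" and ?\<eta> = "1 / (3 * real n)"
  have r: "0 < ?r" by (rule split_rate_1_pos[OF beta])
  have \<eta>: "0 < ?\<eta>" using n by simp
  define B where "B k = {\<omega> \<in> space M. max (\<xi> (Suc k * h) \<omega> - 2 * ?\<eta>) (\<xi> (k * h) \<omega> + ?\<eta>) < E j \<omega> \<and> E j \<omega> \<le> \<xi> (Suc k * h) \<omega> + ?\<eta>}" for k :: nat
  have [measurable]: "E j \<in> borel_measurable M" by (rule E_measurable[OF j])
  have [measurable]: "\<xi> (real k * h) \<in> borel_measurable M" for k using h by (intro random_variable_xi) auto
  have [measurable]: "B k \<in> sets M" for k unfolding B_def by measurable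
  let ?q = "exp (- (h * ?r))"
  have q: "0 < ?q" "?q < 1" using h(1) r by auto
  let ?m = "2 / n * (h * split_rate \<beta> n)"
  have m: "0 \<le> ?m" using h(1) split_rate_nonneg[of \<beta> n] by simp
  have B: "prob (B k) \<le> ?q ^ k * ?m" for k
  proof -
    have "prob (B k) \<le> exp (- ((k * h) * ?r)) * expectation (\<lambda>\<omega>. min (3 * ?\<eta>) (\<xi> (Suc k * h - k * h) \<omega>))"
      unfolding B_def using h(1) \<eta> by (intro prob_E_in_random_Ioc_le j) auto
    also have "exp (- ((k * h) * ?r)) = ?q ^ k"
      by (simp add: exp_of_nat_mult[symmetric] algebra_simps)
    also have "Suc k * h - k * h = h" by (simp add: algebra_simps)
    also have "3 * ?\<eta> = 1 / n" by simp
    also have "?q ^ k * expectation (\<lambda>\<omega>. min (1 / n) (\<xi> h \<omega>)) \<le> ?q ^ k * ?m"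
      using expectation_min_increment_le[OF _ n, of h] h(1) by (intro mult_left_mono) auto
    finally show ?thesis .
  qed
  have geo: "summable (\<lambda>k. ?q ^ k * ?m)" "(\<Sum>k. ?q ^ k * ?m) = 1 / (1 - ?q) * ?m"
  proof -
    have s: "summable (\<lambda>k. ?q ^ k)" using q by (intro summable_geometric) simp
    from s show "summable (\<lambda>k. ?q ^ k * ?m)" by (rule summable_mult2)
    have "(\<Sum>k. ?q ^ k * ?m) = (\<Sum>k. ?q ^ k) * ?m" by (rule suminf_mult2[OF s, symmetric])
    also have "(\<Sum>k. ?q ^ k) = 1 / (1 - ?q)" using q by (intro suminf_geometric) simp
    finally show "(\<Sum>k. ?q ^ k * ?m) = 1 / (1 - ?q) * ?m" .
  qed
  have sumB: "summable (\<lambda>k. prob (B k))"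
    by (rule summable_comparison_test'[OF geo(1), of 0]) (use B in auto)
  have "{\<omega> \<in> space M. \<exists>k::nat. \<bar>\<xi> (k * h) \<omega> - E j \<omega>\<bar> \<le> ?\<eta>} \<subseteq> {\<omega> \<in> space M. E j \<omega> \<le> ?\<eta>} \<union> (\<Union>k. B k)"
  proof
    fix \<omega> assume "\<omega> \<in> {\<omega> \<in> space M. \<exists>k::nat. \<bar>\<xi> (k * h) \<omega> - E j \<omega>\<bar> \<le> ?\<eta>}"
    then obtain k0 :: nat where \<omega>: "\<omega> \<in> space M" and k0: "\<bar>\<xi> (k0 * h) \<omega> - E j \<omega>\<bar> \<le> ?\<eta>" by auto
    \<comment> \<open>The first grid value within \<open>\<eta>\<close> of the point; earlier ones are more than \<open>\<eta>\<close> below it.\<close>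
    define k where "k = (LEAST k::nat. \<bar>\<xi> (k * h) \<omega> - E j \<omega>\<bar> \<le> ?\<eta>)"
    have k: "\<bar>\<xi> (k * h) \<omega> - E j \<omega>\<bar> \<le> ?\<eta>" unfolding k_def by (rule LeastI[of _ k0]) (rule k0)
    show "\<omega> \<in> {\<omega> \<in> space M. E j \<omega> \<le> ?\<eta>} \<union> (\<Union>k. B k)"
    proof (cases k)
      case 0
      then have "E j \<omega> \<le> ?\<eta>" using k start[OF \<omega>] by simp
      with \<omega> show ?thesis by simp
    next
      case (Suc l)
      then have "\<not> \<bar>\<xi> (l * h) \<omega> - E j \<omega>\<bar> \<le> ?\<eta>"
        using not_less_Least[of l "\<lambda>k::nat. \<bar>\<xi> (k * h) \<omega> - E j \<omega>\<bar> \<le> ?\<eta>"] by (simp add: k_def)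
      moreover have "\<xi> (l * h) \<omega> \<le> \<xi> (Suc l * h) \<omega>"
        using h(1) by (intro xi_mono[OF \<omega>]) (auto simp: algebra_simps)
      ultimately have "\<omega> \<in> B l"
        using k \<omega> \<eta> unfolding Suc B_def
        by (simp only: mem_Collect_eq max_less_iff_conj not_le) (intro conjI TrueI; linarith)
      then show ?thesis by blast
    qed
  qed
  then have "prob {\<omega> \<in> space M. \<exists>k::nat. \<bar>\<xi> (k * h) \<omega> - E j \<omega>\<bar> \<le> ?\<eta>} \<le> prob ({\<omega> \<in> space M. E j \<omega> \<le> ?\<eta>} \<union> (\<Union>k. B k))"
    by (intro finite_measure_mono) auto
  also have "\<dots> \<le> prob {\<omega> \<in> space M. E j \<omega> \<le> ?\<eta>} + prob (\<Union>k. B k)"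
    by (intro measure_Un_le) auto
  also have "prob {\<omega> \<in> space M. E j \<omega> \<le> ?\<eta>} \<le> ?\<eta>"
  proof -
    have "prob {\<omega> \<in> space M. E j \<omega> \<le> ?\<eta>} = 1 - prob {\<omega> \<in> space M. ?\<eta> < E j \<omega>}"
      by (subst prob_compl[symmetric]) (auto intro!: arg_cong[where f = prob])
    also have "\<dots> = 1 - exp (- ?\<eta>)" using prob_E_gt[OF j, of ?\<eta>] by simp
    also have "\<dots> \<le> ?\<eta>" using exp_ge_add_one_self[of "- ?\<eta>"] by linarith
    finally show ?thesis .
  qed
  also have "prob (\<Union>k. B k) \<le> (\<Sum>k. prob (B k))"
    by (intro finite_measure_subadditive_countably sumB) auto
  also have "\<dots> \<le> (\<Sum>k. ?q ^ k * ?m)"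
    by (intro suminf_le B sumB geo)
  also have "\<dots> = 1 / (1 - ?q) * ?m" by (rule geo(2))
  also have "\<dots> \<le> 2 / (h * ?r) * ?m"
  proof (rule mult_right_mono[OF _ m])
    have "h * ?r / 2 \<le> 1 - ?q" using min_1_le_exp[of "h * ?r"] h r by simp
    then have "1 / (1 - ?q) \<le> 1 / (h * ?r / 2)" using h(1) r by (intro divide_left_mono) auto
    then show "1 / (1 - ?q) \<le> 2 / (h * ?r)" by simp
  qed
  also have "2 / (h * ?r) * ?m = 4 * (split_rate \<beta> n / n) / ?r" using h(1) by simp
  finally show ?thesis by simp
qed

text \<open>
  Refine the grid by halving its mesh. By right-continuity a point of the closed range is within
  \<open>1 / (3 n)\<close> of a dyadic grid value, for every \<open>n\<close>; by the uniform bound this has probability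
  0.
\<close>

lemma AE_sample_not_in_closure:
  assumes j: "1 \<le> j"
  shows "AE \<omega> in M. E j \<omega> \<notin> closure ((\<lambda>t. \<xi> t \<omega>) ` {0..})"
proof -
  let ?r = "split_rate \<beta> 1"
  have r: "0 < ?r" by (rule split_rate_1_pos[OF beta])
  define h where "h l = 1 / ?r / 2 ^ l" for l :: nat
  have h: "0 < h l" "h l * ?r \<le> 1" for l
    using r by (auto simp: h_def field_simps)
  define D where "D n l = {\<omega> \<in> space M. \<exists>k::nat. \<bar>\<xi> (k * h l) \<omega> - E j \<omega>\<bar> \<le> 1 / (3 * real (Suc n))}" for n l :: nat
  \<comment> \<open>The bound for the grid, which is the same for all mesh sizes \<open>h l\<close>.\<close>
  define \<delta> where "\<delta> n = 1 / (3 * real (Suc n)) + 4 * (split_rate \<beta> (Suc n) / real (Suc n)) / ?r" for n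
  have [measurable]: "E j \<in> borel_measurable M" by (rule E_measurable[OF j])
  have [measurable]: "\<xi> (real k * h l) \<in> borel_measurable M" for k l using h(1)[of l] by (intro random_variable_xi) auto
  have [measurable]: "D n l \<in> sets M" for n l unfolding D_def by measurable
  have inc: "incseq (D n)" for n
  proof (rule incseq_SucI)
    fix l
    \<comment> \<open>Halving the mesh keeps all grid points.\<close>
    have eq: "real k * h l = real (2 * k) * h (Suc l)" for k by (simp add: h_def)
    show "D n l \<subseteq> D n (Suc l)"
    proof
      fix \<omega> assume "\<omega> \<in> D n l"
      then obtain k :: nat where "\<omega> \<in> space M" "\<bar>\<xi> (k * h l) \<omega> - E j \<omega>\<bar> \<le> 1 / (3 * real (Suc n))"
        unfolding D_def by blast
      then show "\<omega> \<in> D n (Suc l)" unfolding D_def eq by blast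
    qed
  qed
  have D: "prob (\<Union>l. D n l) \<le> \<delta> n" for n
  proof (rule LIMSEQ_le_const2)
    show "(\<lambda>l. prob (D n l)) \<longlonglongrightarrow> prob (\<Union>l. D n l)"
      by (rule finite_Lim_measure_incseq[OF _ inc]) auto
    show "\<exists>N. \<forall>l\<ge>N. prob (D n l) \<le> \<delta> n"
      unfolding D_def \<delta>_def using prob_near_grid_le[OF j h, of "Suc n"] by simp
  qed
  let ?N = "\<Inter>n. \<Union>l. D n l"
  have "prob ?N \<le> 0"
  proof (rule LIMSEQ_le_const)
    have "(\<lambda>n. 1 / 3 * (1 / real (Suc n)) + 4 * (split_rate \<beta> (Suc n) / real (Suc n)) / ?r) \<longlonglongrightarrow> 1 / 3 * 0 + 4 * 0 / ?r"
      using r LIMSEQ_Suc[OF split_rate_sublinear[OF beta]] LIMSEQ_Suc[OF lim_1_over_n]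
      by (intro tendsto_intros) auto
    then show "\<delta> \<longlonglongrightarrow> 0" by (simp add: \<delta>_def[abs_def])
    have "prob ?N \<le> \<delta> n" for n
    proof -
      have "prob ?N \<le> prob (\<Union>l. D n l)" by (intro finite_measure_mono) auto
      with D[of n] show ?thesis by linarith
    qed
    then show "\<exists>N. \<forall>n\<ge>N. prob ?N \<le> \<delta> n" by blast
  qed
  then have "?N \<in> null_sets M"
    by (intro null_setsI) (auto simp: emeasure_eq_measure measure_le_0_iff)
  moreover have "{\<omega> \<in> space M. \<not> E j \<omega> \<notin> closure ((\<lambda>t. \<xi> t \<omega>) ` {0..})} \<subseteq> ?N"
  proof (intro subsetI INT_I)
    fix \<omega> n assume "\<omega> \<in> {\<omega> \<in> space M. \<not> E j \<omega> \<notin> closure ((\<lambda>t. \<xi> t \<omega>) ` {0..})}"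
    then have \<omega>: "\<omega> \<in> space M" and cl: "E j \<omega> \<in> closure ((\<lambda>t. \<xi> t \<omega>) ` {0..})" by auto
    let ?\<eta> = "1 / (3 * real (Suc n))"
    have "0 < ?\<eta>" by simp
    with cl obtain t where t: "0 \<le> t" "\<bar>\<xi> t \<omega> - E j \<omega>\<bar> < ?\<eta>"
      unfolding closure_approachable dist_real_def by blast
    have "\<xi> t \<omega> < E j \<omega> + ?\<eta>" using t(2) by linarith
    then obtain b where b: "t < b" "\<And>s. t \<le> s \<Longrightarrow> s < b \<Longrightarrow> \<xi> s \<omega> < E j \<omega> + ?\<eta>"
      using increasing_path.path_below_persists[OF increasing_path[OF \<omega>] t(1)] by metis
    obtain l where l: "h l < b - t"
    proof -
      obtain l where "1 / ?r / (b - t) < 2 ^ l" using real_arch_pow[of 2 "1 / ?r / (b - t)"] by auto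
      then have "1 / ?r < 2 ^ l * (b - t)" using b(1) by (subst (asm) pos_divide_less_eq) simp_all
      then have "h l < b - t" unfolding h_def by (subst pos_divide_less_eq) (simp_all add: mult.commute)
      then show ?thesis by (rule that)
    qed
    define k where "k = nat \<lceil>t / h l\<rceil>"
    have "0 \<le> t / h l" using t(1) h(1)[of l] by simp
    then have k: "t / h l \<le> real k" "real k < t / h l + 1" unfolding k_def by linarith+
    have "t \<le> real k * h l" using k(1) h(1)[of l] by (simp add: field_simps)
    moreover have "real k * h l < b"
    proof -
      have "real k * h l < (t / h l + 1) * h l" using k(2) h(1)[of l] by (intro mult_strict_right_mono)
      also have "\<dots> = t + h l" using h(1)[of l] by (simp add: field_simps)
      finally show ?thesis using l by linarith
    qed
    ultimately have "\<xi> t \<omega> \<le> \<xi> (real k * h l) \<omega>" "\<xi> (real k * h l) \<omega> < E j \<omega> + ?\<eta>"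
      using b(2) xi_mono[OF \<omega> t(1)] by auto
    with t(2) have "\<bar>\<xi> (real k * h l) \<omega> - E j \<omega>\<bar> \<le> ?\<eta>" by linarith
    with \<omega> have "\<omega> \<in> D n l" unfolding D_def by blast
    then show "\<omega> \<in> (\<Union>l. D n l)" by blast
  qed
  ultimately show ?thesis by (rule AE_I')
qed

text \<open>
  As \<open>\<phi> 1 > 0\<close>, the subordinator tends to infinity in the sense that every sample point is
  eventually passed. So every occupied gap is bounded, a jump of the path.
\<close>

lemma AE_sample_passed:
  assumes j: "1 \<le> j"
  shows "AE \<omega> in M. \<exists>t\<ge>0. E j \<omega> \<le> \<xi> t \<omega>"
proof -
  let ?r = "split_rate \<beta> 1"
  have r: "0 < ?r" by (rule split_rate_1_pos[OF beta])
  define A where "A k = {\<omega> \<in> space M. \<xi> (real k) \<omega> < E j \<omega>}" for k :: nat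
  have [measurable]: "E j \<in> borel_measurable M" by (rule E_measurable[OF j])
  have [measurable]: "\<xi> (real k) \<in> borel_measurable M" for k by (intro random_variable_xi) auto
  have [measurable]: "A k \<in> sets M" for k unfolding A_def by measurable
  have A: "prob (A k) = exp (- ?r) ^ k" for k
    using prob_all_E_gt_xi[of "{j}" "\<lambda>_. real k"] j laplace_nat[of "real k" 1]
    by (simp add: A_def exp_of_nat_mult[symmetric])
  have "prob (\<Inter>k. A k) \<le> 0"
  proof (rule LIMSEQ_le_const)
    show "(\<lambda>k. exp (- ?r) ^ k) \<longlonglongrightarrow> 0" using r by (intro LIMSEQ_realpow_zero) auto
    have "prob (\<Inter>k. A k) \<le> exp (- ?r) ^ k" for k
      unfolding A[symmetric] by (intro finite_measure_mono) auto
    then show "\<exists>N. \<forall>k\<ge>N. prob (\<Inter>k. A k) \<le> exp (- ?r) ^ k" by blast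
  qed
  then have "(\<Inter>k. A k) \<in> null_sets M"
    by (intro null_setsI) (auto simp: emeasure_eq_measure measure_le_0_iff)
  moreover have "{\<omega> \<in> space M. \<not> (\<exists>t\<ge>0. E j \<omega> \<le> \<xi> t \<omega>)} \<subseteq> (\<Inter>k. A k)"
  proof safe
    fix \<omega> and k :: nat
    assume "\<omega> \<in> space M" "\<not> (\<exists>t\<ge>0. E j \<omega> \<le> \<xi> t \<omega>)"
    then show "\<omega> \<in> A k" unfolding A_def by (auto simp: not_le dest: spec[of _ "real k"])
  qed
  ultimately show ?thesis by (rule AE_I')
qed

lemma AE_sample_pos:
  assumes j: "1 \<le> j"
  shows "AE \<omega> in M. 0 < E j \<omega>"
proof -
  have [measurable]: "E j \<in> borel_measurable M" by (rule E_measurable[OF j])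
  have "prob {\<omega> \<in> space M. 0 < E j \<omega>} = 1" using prob_E_gt[OF j, of 0] by simp
  then show ?thesis by (subst (asm) prob_Collect_eq_1) auto
qed

text \<open>
  Which sample points are alive at which rational times. Row \<open>k\<close> belongs to the sample point
  \<open>E (k + 1)\<close>.
\<close>

definition survival_array :: "'a \<Rightarrow> nat \<times> rat \<Rightarrow> bool" where
  "survival_array \<omega> = (\<lambda>(k, q). \<xi> \<bar>of_rat q\<bar> \<omega> < E (Suc k) \<omega>)"

lemma measurable_survival_array: "survival_array \<in> measurable M bool_arrays"
proof (rule measurable_bool_arrays)
  fix i :: "nat \<times> rat"
  have [measurable]: "E (Suc (fst i)) \<in> borel_measurable M" by (rule E_measurable) simp
  have [measurable]: "\<xi> \<bar>of_rat (snd i)\<bar> \<in> borel_measurable M" by (rule random_variable_xi) simp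
  show "(\<lambda>\<omega>. survival_array \<omega> i) \<in> measurable M (count_space UNIV)"
    unfolding survival_array_def case_prod_beta by measurable
qed

lemma occupied_gaps_shift:
  "occupied_gaps \<xi> E m \<omega> = card {G \<in> gaps (\<lambda>t. \<xi> t \<omega>). \<exists>k<m. E (Suc k) \<omega> \<in> G}"
proof -
  have "{1..m} = Suc ` {..<m}" by (simp add: image_Suc_lessThan)
  then have "(\<exists>j\<in>{1..m}. E j \<omega> \<in> G) \<longleftrightarrow> (\<exists>k<m. E (Suc k) \<omega> \<in> G)" for G
    by (simp only: bex_simps) auto
  then show ?thesis by (simp add: occupied_gaps_def)
qed

lemma AE_occupied_gaps:
  "AE \<omega> in M. \<forall>m. occupied_gaps \<xi> E m \<omega> = num_values m (survival_array \<omega>)"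
proof -
  have "AE \<omega> in M. \<forall>k. 0 < E (Suc k) \<omega> \<and> (\<exists>t\<ge>0. E (Suc k) \<omega> \<le> \<xi> t \<omega>) \<and>
      E (Suc k) \<omega> \<notin> closure ((\<lambda>t. \<xi> t \<omega>) ` {0..})"
    unfolding AE_all_countable
    using AE_sample_pos AE_sample_passed AE_sample_not_in_closure by (intro allI AE_conjI) auto
  with AE_space show ?thesis
  proof eventually_elim
    case (elim \<omega>)
    interpret x: increasing_path "\<lambda>t. \<xi> t \<omega>" by (rule increasing_path) (rule elim(1))
    show ?case
      unfolding occupied_gaps_shift survival_array_def
      using elim(2) x.card_occupied_gaps[of _ "\<lambda>k. E (Suc k) \<omega>"] by auto
  qed
qed

lemma measurable_occupied_gaps: "occupied_gaps \<xi> E m \<in> measurable M (count_space UNIV)"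
proof -
  have [measurable]: "E (Suc k) \<in> borel_measurable M" for k by (auto intro: E_measurable)
  have [measurable]: "\<xi> \<bar>of_rat q\<bar> \<in> borel_measurable M" for q by (rule random_variable_xi) simp
  define V where "V k \<omega> \<longleftrightarrow> 0 \<le> E (Suc k) \<omega> \<and> (\<exists>n. \<forall>q::rat. 1 / real (Suc n) \<le> \<bar>\<xi> \<bar>of_rat q\<bar> \<omega> - E (Suc k) \<omega>\<bar>)" for k \<omega>
  have [measurable]: "Measurable.pred M (V k)" for k unfolding V_def[abs_def] by measurable
  define S where "S \<omega> = {k \<in> {..<m}. V k \<omega> \<and> (\<forall>i\<in>{..<k}. V i \<omega> \<longrightarrow>
    \<not> (\<forall>q::rat. \<xi> \<bar>of_rat q\<bar> \<omega> < E (Suc i) \<omega> \<longleftrightarrow> \<xi> \<bar>of_rat q\<bar> \<omega> < E (Suc k) \<omega>))}" for \<omega>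
  have "(\<lambda>\<omega>. card (S \<omega>)) \<in> measurable M (count_space UNIV)"
  proof (rule measurable_card)
    fix k show "{\<omega> \<in> space M. k \<in> S \<omega>} \<in> sets M" unfolding S_def mem_Collect_eq by measurable
  qed
  moreover have "occupied_gaps \<xi> E m \<omega> = card (S \<omega>)" if \<omega>: "\<omega> \<in> space M" for \<omega>
  proof -
    interpret x: increasing_path "\<lambda>t. \<xi> t \<omega>" by (rule increasing_path[OF \<omega>])
    have V: "V k \<omega> \<longleftrightarrow> E (Suc k) \<omega> \<in> x.vacant" for k
      unfolding V_def using x.not_in_closure_iff[of "E (Suc k) \<omega>"] by simp
    show ?thesis
      unfolding occupied_gaps_shift x.card_occupied_gaps_first S_def V by (simp add: Ball_def)
  qed
  ultimately show ?thesis by (simp cong: measurable_cong)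
qed

end

section \<open>Splitting rates of the fragmentation\<close>

text \<open>
  With \<open>u = t / k\<close> we have \<open>ln (g t) = k * ln (g u)\<close>, and \<open>1 - 1 / y \<le> ln y \<le> y - 1\<close> encloses
  the right-hand side between two sequences with limit \<open>- t * c\<close>.
\<close>

lemma multiplicative_eq_exp:
  fixes g :: "real \<Rightarrow> real"
  assumes mult: "\<And>s t. 0 \<le> s \<Longrightarrow> 0 \<le> t \<Longrightarrow> g (s + t) = g s * g t"
    and g0: "g 0 = 1"
    and deriv: "((\<lambda>t. (1 - g t) / t) \<longlongrightarrow> c) (at_right 0)"
    and t: "0 \<le> t"
  shows "g t = exp (- (t * c))"
proof (cases "t = 0")
  case True then show ?thesis by (simp add: g0)
next
  case False
  with t have t: "0 < t" by simp
  have pow: "g (real k * s) = g s ^ k" if "0 \<le> s" for k s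
    using that by (induction k) (auto simp: g0 algebra_simps mult)
  let ?s = "\<lambda>k. t / real (Suc k)"
  have s: "filterlim ?s (at_right 0) sequentially"
    unfolding filterlim_at
  proof
    show "?s \<longlonglongrightarrow> 0" by (rule LIMSEQ_Suc[OF lim_const_over_n])
  qed (use t in simp)
  have lim1: "(\<lambda>k. (1 - g (?s k)) / ?s k) \<longlonglongrightarrow> c"
    by (rule filterlim_compose[OF deriv s])
  have s0: "?s \<longlonglongrightarrow> 0" by (rule LIMSEQ_Suc[OF lim_const_over_n])
  have "(\<lambda>k. 1 - (1 - g (?s k)) / ?s k * ?s k) \<longlonglongrightarrow> 1 - c * 0"
    by (intro tendsto_intros lim1 s0)
  then have g1: "(\<lambda>k. g (?s k)) \<longlonglongrightarrow> 1" using t by simp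
  have lim2: "(\<lambda>k. real (Suc k) * (g (?s k) - 1)) \<longlonglongrightarrow> - (t * c)"
  proof -
    have "(\<lambda>k. - (t * ((1 - g (?s k)) / ?s k))) \<longlonglongrightarrow> - (t * c)"
      by (intro tendsto_intros lim1)
    moreover have "- (t * ((1 - g (?s k)) / ?s k)) = real (Suc k) * (g (?s k) - 1)" for k
      using t by (simp add: field_simps)
    ultimately show ?thesis by simp
  qed
  have pos: "eventually (\<lambda>k. 0 < g (?s k)) sequentially"
    using order_tendstoD(1)[OF g1, of 0] by simp
  have gt: "g t = g (?s k) ^ Suc k" for k
    using pow[of "?s k" "Suc k"] t by simp
  have gpos: "0 < g t"
  proof -
    obtain k where "0 < g (?s k)" using eventually_happens[OF pos] by auto
    then show ?thesis unfolding gt[of k] by (rule zero_less_power)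
  qed
  have "(\<lambda>k. ln (g t)) \<longlonglongrightarrow> - (t * c)"
  proof (rule tendsto_sandwich)
    show "eventually (\<lambda>k. real (Suc k) * (g (?s k) - 1) / g (?s k) \<le> ln (g t)) sequentially"
      using pos
    proof eventually_elim
      case (elim k)
      have "ln (1 / g (?s k)) \<le> 1 / g (?s k) - 1" using elim by (intro ln_le_minus_one) simp
      then have "(g (?s k) - 1) / g (?s k) \<le> ln (g (?s k))"
        using elim by (simp add: ln_div diff_divide_distrib)
      then have "real (Suc k) * ((g (?s k) - 1) / g (?s k)) \<le> real (Suc k) * ln (g (?s k))"
        by (rule mult_left_mono) simp
      also have "\<dots> = ln (g t)" unfolding gt[of k] by (rule ln_realpow[symmetric])
      finally show ?case by simp
    qed
    show "eventually (\<lambda>k. ln (g t) \<le> real (Suc k) * (g (?s k) - 1)) sequentially"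
      using pos
    proof eventually_elim
      case (elim k)
      have "ln (g t) = real (Suc k) * ln (g (?s k))" unfolding gt[of k] by (rule ln_realpow)
      also have "\<dots> \<le> real (Suc k) * (g (?s k) - 1)"
        using elim by (intro mult_left_mono ln_le_minus_one) auto
      finally show ?case .
    qed
    have "(\<lambda>k. real (Suc k) * (g (?s k) - 1) / g (?s k)) \<longlonglongrightarrow> - (t * c) / 1"
      by (intro tendsto_divide lim2 g1) simp
    then show "(\<lambda>k. real (Suc k) * (g (?s k) - 1) / g (?s k)) \<longlonglongrightarrow> - (t * c)" by simp
  qed (rule lim2)
  then have "ln (g t) = - (t * c)" by (simp add: LIMSEQ_const_iff)
  then show ?thesis using gpos by (metis exp_ln)
qed

definition colour_classes :: "nat \<Rightarrow> (nat \<Rightarrow> bool) \<Rightarrow> nat set set" where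
  "colour_classes n c = {{j\<in>{1..n}. c j}, {j\<in>{1..n}. \<not> c j}} - {{}}"

abbreviation colourings :: "nat \<Rightarrow> (nat \<Rightarrow> bool) set" where
  "colourings n \<equiv> (\<lambda>S j. j \<in> S) ` Pow {1..n}"

lemma partition_on_colour_classes: "partition_on {1..n} (colour_classes n c)"
proof -
  have *: "partition_on X ({S, T} - {{}})" if "S \<inter> T = {}" "S \<union> T = X" for S T X :: "nat set"
    using that by (intro partition_onI) (auto simp: disjnt_def Int_commute)
  show ?thesis unfolding colour_classes_def by (rule *) auto
qed

text \<open>
  As a finite sum this is measurable in \<open>x\<close>, which the definition of the paintbox does not
  reveal.
\<close>

lemma pmf_paintbox:
  "pmf (paintbox x n) \<pi> = (\<Sum>c\<in>colourings n. if colour_classes n c = \<pi> then \<Prod>j\<in>{1..n}. pmf (bernoulli_pmf x) (c j) else 0)"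
proof -
  let ?q = "Pi_pmf {1..n} False (\<lambda>_. bernoulli_pmf x)"
  have sub: "set_pmf ?q \<subseteq> colourings n"
  proof
    fix c assume "c \<in> set_pmf ?q"
    then have "c \<in> {f. \<forall>j. j \<notin> {1..n} \<longrightarrow> f j = False}"
      by (rule subsetD[OF set_Pi_pmf_subset, rotated]) simp
    then have "{j. c j} \<in> Pow {1..n}" by blast
    moreover have "c = (\<lambda>j. j \<in> {j. c j})" by simp
    ultimately show "c \<in> colourings n" by (rule rev_image_eqI)
  qed
  have out: "\<not> c j" if "c \<in> colourings n" "j \<notin> {1..n}" for c j using that by auto
  have "pmf (paintbox x n) \<pi> = measure (measure_pmf ?q) (colour_classes n -` {\<pi>})"
    unfolding paintbox_def colour_classes_def[abs_def] by (simp add: pmf_map)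
  also have "\<dots> = measure (measure_pmf ?q) (colour_classes n -` {\<pi>} \<inter> colourings n)"
    using sub by (intro measure_prob_cong_0) (auto simp: set_pmf_eq)
  also have "\<dots> = (\<Sum>c\<in>colour_classes n -` {\<pi>} \<inter> colourings n. pmf ?q c)"
    by (rule measure_measure_pmf_finite) auto
  also have "\<dots> = (\<Sum>c\<in>colour_classes n -` {\<pi>} \<inter> colourings n. \<Prod>j\<in>{1..n}. pmf (bernoulli_pmf x) (c j))"
    using out by (intro sum.cong refl pmf_Pi') auto
  also have "\<dots> = (\<Sum>c\<in>{c\<in>colourings n. colour_classes n c = \<pi>}. \<Prod>j\<in>{1..n}. pmf (bernoulli_pmf x) (c j))"
    by (intro sum.cong) auto
  also have "\<dots> = (\<Sum>c\<in>colourings n. if colour_classes n c = \<pi> then \<Prod>j\<in>{1..n}. pmf (bernoulli_pmf x) (c j) else 0)"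
    by (rule sum.inter_filter) auto
  finally show ?thesis .
qed

lemma measurable_pmf_paintbox: "(\<lambda>x. pmf (paintbox x n) \<pi>) \<in> borel_measurable borel"
proof -
  have "(\<lambda>x. pmf (bernoulli_pmf x) b) \<in> borel_measurable borel" for b
    by (cases b) (simp_all add: bernoulli_pmf.rep_eq)
  note m = this
  show ?thesis
    unfolding pmf_paintbox
  proof (intro borel_measurable_sum)
    fix c
    have "(\<lambda>x. \<Prod>j\<in>{1..n}. pmf (bernoulli_pmf x) (c j)) \<in> borel_measurable borel"
      by (intro borel_measurable_prod m)
    then show "(\<lambda>x. if colour_classes n c = \<pi> then \<Prod>j\<in>{1..n}. pmf (bernoulli_pmf x) (c j) else 0) \<in> borel_measurable borel"
      by (cases "colour_classes n c = \<pi>") simp_all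
  qed
qed

lemma pmf_paintbox_one_block:
  assumes n: "1 \<le> n" and x: "0 \<le> x" "x \<le> 1"
  shows "pmf (paintbox x n) {{1..n}} = x ^ n + (1 - x) ^ n"
proof -
  let ?f = "\<lambda>c. \<Prod>j\<in>{1..n}. pmf (bernoulli_pmf x) (c j)"
  have iff: "colour_classes n (\<lambda>j. j \<in> S) = {{1..n}} \<longleftrightarrow> S = {1..n} \<or> S = {}" if S: "S \<subseteq> {1..n}" for S
  proof -
    have 1: "{j \<in> {1..n}. j \<in> S} = S" "{j \<in> {1..n}. j \<notin> S} = {1..n} - S" using S by auto
    have "{S, {1..n} - S} - {{}} = {{1..n}} \<longleftrightarrow> S = {1..n} \<or> S = {}"
    proof
      assume "{S, {1..n} - S} - {{}} = {{1..n}}"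
      then have "S \<in> {{1..n}} \<or> S = {}" by blast
      then show "S = {1..n} \<or> S = {}" by simp
    next
      assume "S = {1..n} \<or> S = {}"
      then show "{S, {1..n} - S} - {{}} = {{1..n}}" using n by auto
    qed
    then show ?thesis by (simp only: colour_classes_def 1)
  qed
  have "pmf (paintbox x n) {{1..n}} = (\<Sum>c\<in>{c\<in>colourings n. colour_classes n c = {{1..n}}}. ?f c)"
    unfolding pmf_paintbox by (rule sum.inter_filter[symmetric]) auto
  also have "{c\<in>colourings n. colour_classes n c = {{1..n}}} = {\<lambda>j. j \<in> {1..n}, \<lambda>j. j \<in> {}}"
  proof (intro equalityI subsetI)
    fix c assume "c \<in> {c\<in>colourings n. colour_classes n c = {{1..n}}}"
    then obtain S where "S \<subseteq> {1..n}" "c = (\<lambda>j. j \<in> S)" "colour_classes n (\<lambda>j. j \<in> S) = {{1..n}}" by auto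
    then show "c \<in> {\<lambda>j. j \<in> {1..n}, \<lambda>j. j \<in> {}}" using iff by blast
  next
    fix c assume "c \<in> {\<lambda>j. j \<in> {1..n}, \<lambda>j. j \<in> {}}"
    then obtain S where "S = {1..n} \<or> S = {}" "c = (\<lambda>j. j \<in> S)" by blast
    then show "c \<in> {c\<in>colourings n. colour_classes n c = {{1..n}}}" using iff[of S] by auto
  qed
  also have "(\<Sum>c\<in>{\<lambda>j. j \<in> {1..n}, \<lambda>j. j \<in> {}}. ?f c) = ?f (\<lambda>j. j \<in> {1..n}) + ?f (\<lambda>j. j \<in> {})"
  proof (subst sum.insert)
    show "(\<lambda>j. j \<in> {1..n}) \<notin> {\<lambda>j. j \<in> {}}"
      using n by (auto simp: fun_eq_iff intro!: exI[of _ 1])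
  qed auto
  also have "?f (\<lambda>j. j \<in> {1..n}) = (\<Prod>j\<in>{1..n}. x)" using x by (intro prod.cong refl) auto
  also have "?f (\<lambda>j. j \<in> {}) = (\<Prod>j\<in>{1..n}. 1 - x)" using x by (intro prod.cong refl) auto
  finally show ?thesis by simp
qed

lemma AE_nu: "AE x in nu \<beta>. x \<in> {1/2..<1}"
  unfolding nu_def by (subst AE_density) (auto simp: indicator_def split: if_splits)

text \<open>
  The total rate at which \<open>n + 1\<close> labels are separated. Summing first and integrating afterwards
  replaces the individual paintbox probabilities by the probability that both colours occur.
\<close>

lemma total_split_rate:
  assumes \<beta>: "\<beta> > -2"
  shows "(\<Sum>\<pi> | partition_on {1..Suc n} \<pi> \<and> \<pi> \<noteq> {{1..Suc n}}. LINT x|nu \<beta>. pmf (paintbox x (Suc n)) \<pi>) = split_rate \<beta> n"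
proof -
  let ?X = "{1..Suc n}" and ?p = "\<lambda>x. pmf (paintbox x (Suc n))"
  let ?Pi = "{\<pi>. partition_on ?X \<pi>}" and ?Q = "{\<pi>. partition_on ?X \<pi> \<and> \<pi> \<noteq> {?X}}"
  have fin: "finite ?Pi" by (rule finitely_many_partition_on) simp
  have Q: "?Q = ?Pi - {{?X}}" by auto
  have total: "(\<Sum>\<pi>\<in>?Q. ?p x \<pi>) = 1 - ?p x {?X}" for x
  proof -
    have "(\<Sum>\<pi>\<in>?Pi. ?p x \<pi>) = 1"
    proof (rule sum_pmf_eq_1[OF fin])
      show "set_pmf (paintbox x (Suc n)) \<subseteq> ?Pi"
        using partition_on_colour_classes[of "Suc n"] by (auto simp: paintbox_def colour_classes_def)
    qed
    moreover have "{?X} \<in> ?Pi" by (simp add: partition_on_space)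
    ultimately show ?thesis
      unfolding Q using sum.remove[OF fin, of "{?X}" "?p x"] by simp
  qed
  have meas: "(\<lambda>x. ?p x \<pi>) \<in> borel_measurable (nu \<beta>)" for \<pi>
    using measurable_pmf_paintbox by (simp add: nu_def)
  have int: "integrable (nu \<beta>) (\<lambda>x. ?p x \<pi>)" if "\<pi> \<in> ?Q" for \<pi>
  proof (rule Bochner_Integration.integrable_bound[OF nu_integral_split(2)[OF \<beta>, of n] meas])
    show "AE x in nu \<beta>. norm (?p x \<pi>) \<le> norm (1 - x ^ Suc n - (1 - x) ^ Suc n)"
      using AE_nu
    proof eventually_elim
      case (elim x)
      have "?p x \<pi> \<le> (\<Sum>\<pi>\<in>?Q. ?p x \<pi>)" using that fin by (intro member_le_sum) (auto simp: Q)
      also have "\<dots> = 1 - x ^ Suc n - (1 - x) ^ Suc n"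
        unfolding total using elim by (subst pmf_paintbox_one_block) auto
      finally show ?case using pmf_nonneg[of "paintbox x (Suc n)" \<pi>] by simp
    qed
  qed
  have "(\<Sum>\<pi>\<in>?Q. LINT x|nu \<beta>. ?p x \<pi>) = (LINT x|nu \<beta>. (\<Sum>\<pi>\<in>?Q. ?p x \<pi>))"
    by (rule Bochner_Integration.integral_sum[symmetric]) (rule int)
  also have "\<dots> = (LINT x|nu \<beta>. 1 - x ^ Suc n - (1 - x) ^ Suc n)"
  proof (rule integral_cong_AE)
    show "AE x in nu \<beta>. (\<Sum>\<pi>\<in>?Q. ?p x \<pi>) = 1 - x ^ Suc n - (1 - x) ^ Suc n"
      using AE_nu
    proof eventually_elim
      case (elim x)
      then show ?case unfolding total by (subst pmf_paintbox_one_block) auto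
    qed
    show "(\<lambda>x. 1 - x ^ Suc n - (1 - x) ^ Suc n :: real) \<in> borel_measurable (nu \<beta>)" by (simp add: nu_def)
  qed (use meas in auto)
  also have "\<dots> = split_rate \<beta> n" by (rule nu_integral_split(1)[OF \<beta>])
  finally show ?thesis .
qed

section \<open>Partitions and refinements\<close>

lemma partition_on_restr: "partition_on A P \<Longrightarrow> B \<subseteq> A \<Longrightarrow> partition_on B (restr B P)"
  using partition_on_restrict[of A P B] by (simp add: restr_def Int_absorb2)

lemma restr_restr: "B \<subseteq> C \<Longrightarrow> restr B (restr C P) = restr B P"
proof -
  assume BC: "B \<subseteq> C"
  have "restr B (restr C P) = ((\<lambda>D. B \<inter> (C \<inter> D)) ` P) - {{}}"
    unfolding restr_def by (auto simp: image_iff)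
  also have "\<dots> = restr B P"
    unfolding restr_def using BC by (intro arg_cong2[where f = minus] image_cong) auto
  finally show ?thesis .
qed

lemma block_restr_iff:
  assumes "A \<subseteq> B" "A \<noteq> {}"
  shows "(\<exists>C\<in>restr B P. A \<subseteq> C) \<longleftrightarrow> (\<exists>C\<in>P. A \<subseteq> C)"
proof
  assume "\<exists>C\<in>restr B P. A \<subseteq> C"
  then show "\<exists>C\<in>P. A \<subseteq> C" unfolding restr_def by auto
next
  assume "\<exists>C\<in>P. A \<subseteq> C"
  then obtain C where C: "C \<in> P" "A \<subseteq> C" by auto
  then have "B \<inter> C \<in> restr B P" "A \<subseteq> B \<inter> C" using assms unfolding restr_def by auto
  then show "\<exists>C\<in>restr B P. A \<subseteq> C" by blast
qed

text \<open>
  A refinement of \<open>\<pi>\<close> is the same as a choice of a partition of each block of \<open>\<pi>\<close>. Under this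
  bijection the condition that \<open>A\<close> stays in one block concerns only the block \<open>C\<close> that contains
  \<open>A\<close>, so the sum of products factorises.
\<close>

lemma sum_over_refinements:
  fixes f :: "'i set \<Rightarrow> 'i set set \<Rightarrow> real"
  assumes X: "finite X" and \<pi>: "partition_on X \<pi>" and C: "C \<in> \<pi>" "A \<subseteq> C" "A \<noteq> {}"
  shows "(\<Sum>\<sigma> | refines X \<sigma> \<pi> \<and> (\<exists>D\<in>\<sigma>. A \<subseteq> D). \<Prod>B\<in>\<pi>. f B (restr B \<sigma>)) =
    (\<Prod>B\<in>\<pi>. \<Sum>\<rho> | partition_on B \<rho> \<and> (B = C \<longrightarrow> (\<exists>D\<in>\<rho>. A \<subseteq> D)). f B \<rho>)"
proof -
  let ?S = "{\<sigma>. refines X \<sigma> \<pi> \<and> (\<exists>D\<in>\<sigma>. A \<subseteq> D)}"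
  let ?R = "\<lambda>B. {\<rho>. partition_on B \<rho> \<and> (B = C \<longrightarrow> (\<exists>D\<in>\<rho>. A \<subseteq> D))}"
  have BX: "B \<subseteq> X" "B \<noteq> {}" if "B \<in> \<pi>" for B using \<pi> that by (auto simp: partition_on_def)
  have disj: "B \<inter> B' = {}" if "B \<in> \<pi>" "B' \<in> \<pi>" "B \<noteq> B'" for B B'
    using partition_onD2[OF \<pi>] that by (auto simp: disjoint_def)
  have fin\<pi>: "finite \<pi>" by (rule finite_elements[OF X \<pi>])
  have finR: "finite (?R B)" if "B \<in> \<pi>" for B
    by (rule finite_subset[OF _ finitely_many_partition_on[of B]]) (use BX(1)[OF that] X in \<open>auto dest: finite_subset\<close>)
  have glue: "partition_on X (\<Union>B\<in>\<pi>. g B)" and restr_glue: "\<And>B. B \<in> \<pi> \<Longrightarrow> restr B (\<Union>B\<in>\<pi>. g B) = g B"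
    if g: "\<And>B. B \<in> \<pi> \<Longrightarrow> partition_on B (g B)" for g
  proof -
    have sub: "S \<subseteq> B" "S \<noteq> {}" if "B \<in> \<pi>" "S \<in> g B" for S B
      using g[OF that(1)] that(2) by (auto simp: partition_on_def)
    show "partition_on X (\<Union>B\<in>\<pi>. g B)"
    proof (rule partition_onI)
      show "\<Union> (\<Union>B\<in>\<pi>. g B) = X"
        using partition_onD1[OF \<pi>] partition_onD1[OF g] by fastforce
      show "disjnt p q" if "p \<in> (\<Union>B\<in>\<pi>. g B)" "q \<in> (\<Union>B\<in>\<pi>. g B)" "p \<noteq> q" for p q
      proof -
        from that obtain B B' where B: "B \<in> \<pi>" "p \<in> g B" "B' \<in> \<pi>" "q \<in> g B'" by auto
        show ?thesis
        proof (cases "B = B'")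
          case True
          then show ?thesis using partition_onD2[OF g[OF B(1)]] B that(3) by (auto simp: disjoint_def disjnt_def)
        next
          case False
          then show ?thesis using disj[OF B(1,3)] sub[OF B(1,2)] sub[OF B(3,4)] by (auto simp: disjnt_def)
        qed
      qed
      show "{} \<notin> (\<Union>B\<in>\<pi>. g B)" using sub by blast
    qed
    fix B assume B: "B \<in> \<pi>"
    show "restr B (\<Union>B\<in>\<pi>. g B) = g B"
    proof (intro equalityI subsetI)
      fix S assume "S \<in> restr B (\<Union>B\<in>\<pi>. g B)"
      then obtain B' T where T: "B' \<in> \<pi>" "T \<in> g B'" "S = B \<inter> T" "S \<noteq> {}" by (auto simp: restr_def)
      then have "B' = B" using disj[OF T(1) B] sub[OF T(1,2)] by auto
      then show "S \<in> g B" using T sub[OF T(1,2)] by (simp add: Int_absorb1)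
    next
      fix S assume S: "S \<in> g B"
      then have "S = B \<inter> S" using sub[OF B S] by auto
      then show "S \<in> restr B (\<Union>B\<in>\<pi>. g B)" using S B sub[OF B S] unfolding restr_def by blast
    qed
  qed
  have unglue: "(\<Union>B\<in>\<pi>. restr B \<sigma>) = \<sigma>" if \<sigma>: "refines X \<sigma> \<pi>" for \<sigma>
  proof (intro equalityI subsetI)
    fix S assume S: "S \<in> \<sigma>"
    then obtain B where B: "B \<in> \<pi>" "S \<subseteq> B" using \<sigma> by (auto simp: refines_def)
    moreover have "S \<noteq> {}" using \<sigma> S by (auto simp: refines_def partition_on_def)
    ultimately have "S \<in> restr B \<sigma>" using S unfolding restr_def by (auto simp: image_iff intro!: bexI[of _ S])
    then show "S \<in> (\<Union>B\<in>\<pi>. restr B \<sigma>)" using B by blast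
  next
    fix S assume "S \<in> (\<Union>B\<in>\<pi>. restr B \<sigma>)"
    then obtain B T where T: "B \<in> \<pi>" "T \<in> \<sigma>" "S = B \<inter> T" "S \<noteq> {}" by (auto simp: restr_def)
    then obtain B' where B': "B' \<in> \<pi>" "T \<subseteq> B'" using \<sigma> by (auto simp: refines_def)
    then have "B' = B" using disj[OF T(1) B'(1)] T by auto
    then show "S \<in> \<sigma>" using T B' by (simp add: Int_absorb1)
  qed
  have "(\<Sum>\<sigma>\<in>?S. \<Prod>B\<in>\<pi>. f B (restr B \<sigma>)) = (\<Sum>g\<in>PiE \<pi> ?R. \<Prod>B\<in>\<pi>. f B (g B))"
  proof (rule sum.reindex_bij_witness[where i = "\<lambda>g. \<Union>B\<in>\<pi>. g B" and j = "\<lambda>\<sigma>. \<lambda>B\<in>\<pi>. restr B \<sigma>"])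
    fix \<sigma> assume "\<sigma> \<in> ?S"
    then have \<sigma>: "refines X \<sigma> \<pi>" and D: "\<exists>D\<in>\<sigma>. A \<subseteq> D" by auto
    show "(\<Union>B\<in>\<pi>. (\<lambda>B\<in>\<pi>. restr B \<sigma>) B) = \<sigma>" using unglue[OF \<sigma>] by simp
    show "(\<lambda>B\<in>\<pi>. restr B \<sigma>) \<in> PiE \<pi> ?R"
    proof (intro restrict_PiE_iff[THEN iffD2] ballI CollectI conjI impI)
      fix B assume B: "B \<in> \<pi>"
      show "partition_on B (restr B \<sigma>)"
        using \<sigma> BX[OF B] by (intro partition_on_restr[of X]) (auto simp: refines_def)
      show "\<exists>D\<in>restr B \<sigma>. A \<subseteq> D" if "B = C"
        using D C that by (subst block_restr_iff) auto
    qed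
    show "(\<Prod>B\<in>\<pi>. f B ((\<lambda>B\<in>\<pi>. restr B \<sigma>) B)) = (\<Prod>B\<in>\<pi>. f B (restr B \<sigma>))" by simp
  next
    fix g assume g: "g \<in> PiE \<pi> ?R"
    then have gB: "partition_on B (g B)" if "B \<in> \<pi>" for B using that by (auto simp: PiE_iff)
    show "(\<lambda>B\<in>\<pi>. restr B (\<Union>B\<in>\<pi>. g B)) = g"
      using restr_glue[OF gB] g by (auto simp: PiE_iff extensional_def restrict_def fun_eq_iff)
    have "\<exists>D\<in>g C. A \<subseteq> D" using g C by (auto simp: PiE_iff)
    then have "\<exists>D\<in>(\<Union>B\<in>\<pi>. g B). A \<subseteq> D" using C by blast
    moreover have "refines X (\<Union>B\<in>\<pi>. g B) \<pi>"
      unfolding refines_def using glue[OF gB] \<pi> partition_onD1[OF gB] by blast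
    ultimately show "(\<Union>B\<in>\<pi>. g B) \<in> ?S" by simp
  qed
  also have "\<dots> = (\<Prod>B\<in>\<pi>. \<Sum>\<rho>\<in>?R B. f B \<rho>)"
    by (rule prod_sum_PiE[symmetric, OF fin\<pi> finR])
  finally show ?thesis .
qed

section \<open>The law of the block of a label\<close>

lemma partition_on_mono_blocks:
  assumes "refines X Q P" "\<exists>B\<in>Q. A \<subseteq> B"
  shows "\<exists>B\<in>P. A \<subseteq> B"
  using assms unfolding refines_def by (meson order_trans)

lemma together_iff_pairs:
  assumes P: "partition_on X P" and a: "a \<in> X"
  shows "(\<exists>B\<in>P. insert a A \<subseteq> B) \<longleftrightarrow> (\<forall>b\<in>A. \<exists>B\<in>P. {a, b} \<subseteq> B)"
proof
  assume all: "\<forall>b\<in>A. \<exists>B\<in>P. {a, b} \<subseteq> B"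
  obtain C where C: "C \<in> P" "a \<in> C" using partition_onD1[OF P] a by auto
  have "b \<in> C" if b: "b \<in> A" for b
  proof -
    obtain B where B: "B \<in> P" "{a, b} \<subseteq> B" using all b by blast
    then have "B = C" using partition_onD2[OF P] C by (auto simp: disjoint_def)
    with B show ?thesis by simp
  qed
  then have "insert a A \<subseteq> C" using C by auto
  with C show "\<exists>B\<in>P. insert a A \<subseteq> B" by blast
next
  assume "\<exists>B\<in>P. insert a A \<subseteq> B"
  then show "\<forall>b\<in>A. \<exists>B\<in>P. {a, b} \<subseteq> B" by blast
qed

lemma ex_permutes_image:
  assumes X: "finite X" and A: "A \<subseteq> X" "B \<subseteq> X" "card A = card B"
  obtains p where "p permutes X" "p ` A = B"
proof -
  have fin: "finite A" "finite B" using A X finite_subset by auto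
  obtain f where f: "bij_betw f A B" using finite_same_card_bij[OF fin A(3)] by auto
  have "card (X - A) = card (X - B)" using A fin by (simp add: card_Diff_subset)
  then obtain g where g: "bij_betw g (X - A) (X - B)"
    using finite_same_card_bij[of "X - A" "X - B"] X by auto
  define p where "p x = (if x \<in> A then f x else if x \<in> X then g x else x)" for x
  have pA: "bij_betw p A B" using f by (rule bij_betw_cong[THEN iffD1, rotated]) (simp add: p_def)
  moreover have "bij_betw p (X - A) (X - B)"
    using g by (rule bij_betw_cong[THEN iffD1, rotated]) (auto simp: p_def)
  ultimately have "bij_betw p (A \<union> (X - A)) (B \<union> (X - B))"
    by (rule bij_betw_combine) auto
  then have "bij_betw p X X" using A by (simp add: Un_absorb1)
  then have "p permutes X" by (rule bij_imp_permutes) (use A in \<open>auto simp: p_def\<close>)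
  with pA show ?thesis by (intro that[of p]) (auto simp: bij_betw_def)
qed

locale beta_fragmentation = homogeneous_fragmentation M "nu \<beta>" P
  for M :: "'a measure" and \<beta> :: real and P :: "real \<Rightarrow> 'a \<Rightarrow> nat set set" +
  assumes beta: "\<beta> > -2"
begin

text \<open>
  The events that the branching property admits as past of time \<open>s\<close>.
\<close>

definition history :: "real \<Rightarrow> 'a measure" where
  "history s = sigma (space M) {{\<omega> \<in> space M. restr {1..m} (P u \<omega>) = \<rho>} |m u \<rho>. 0 \<le> u \<and> u \<le> s}"

lemma sets_history: "sets (history s) = sigma_sets (space M) {{\<omega> \<in> space M. restr {1..m} (P u \<omega>) = \<rho>} |m u \<rho>. 0 \<le> u \<and> u \<le> s}"
  unfolding history_def by (rule sets_measure_of) auto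

lemma space_history [simp]: "space (history s) = space M"
  unfolding history_def by (rule space_measure_of) auto

lemma history_restr:
  assumes "0 \<le> u" "u \<le> s"
  shows "{\<omega> \<in> space M. restr {1..m} (P u \<omega>) = \<rho>} \<in> sets (history s)"
  unfolding sets_history using assms by (intro sigma_sets.Basic) auto

lemma restr_event [measurable]:
  assumes "0 \<le> t"
  shows "{\<omega> \<in> space M. Q (restr {1..n} (P t \<omega>))} \<in> sets M"
proof -
  have "(\<lambda>\<omega>. restr {1..n} (P t \<omega>)) -` Collect Q \<inter> space M \<in> sets M"
    by (rule measurable_sets[OF random_variable_restr[OF assms]]) simp
  then show ?thesis by (simp add: vimage_def Int_def conj_commute)
qed

lemma sets_history_subset: "sets (history s) \<subseteq> sets M"
  unfolding sets_history by (rule sets.sigma_sets_subset) (use restr_event in auto)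

lemma partition_restr: "\<omega> \<in> space M \<Longrightarrow> 0 \<le> t \<Longrightarrow> partition_on {1..n} (restr {1..n} (P t \<omega>))"
  by (rule partition_on_restr[OF partition]) auto

definition together :: "nat set \<Rightarrow> real \<Rightarrow> 'a set" where
  "together A t = {\<omega> \<in> space M. \<exists>B\<in>P t \<omega>. A \<subseteq> B}"

definition partitions_with :: "nat \<Rightarrow> nat set \<Rightarrow> nat set set set" where
  "partitions_with n A = {\<pi>. partition_on {1..n} \<pi> \<and> (\<exists>B\<in>\<pi>. A \<subseteq> B)}"

lemma finite_partitions_with: "finite (partitions_with n A)"
  by (rule finite_subset[OF _ finitely_many_partition_on[of "{1..n}"]]) (auto simp: partitions_with_def)

lemma together_restr:
  assumes "A \<subseteq> {1..n}" "A \<noteq> {}" "0 \<le> t"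
  shows "together A t = {\<omega> \<in> space M. restr {1..n} (P t \<omega>) \<in> partitions_with n A}"
  unfolding together_def partitions_with_def
  using block_restr_iff[OF assms(1,2)] partition_restr[OF _ assms(3)] by auto

lemma together_history:
  assumes "finite A" "A \<subseteq> {1..}" "A \<noteq> {}" "0 \<le> u" "u \<le> s"
  shows "together A u \<in> sets (history s)"
proof -
  have A: "A \<subseteq> {1..Max A}" using assms by auto
  have "together A u = (\<Union>\<rho>\<in>partitions_with (Max A) A. {\<omega> \<in> space M. restr {1..Max A} (P u \<omega>) = \<rho>})"
    unfolding together_restr[OF A assms(3,4)] by auto
  also have "\<dots> \<in> sets (history s)"
    by (intro sets.finite_UN finite_partitions_with history_restr assms)
  finally show ?thesis .
qed

lemma together_event: "finite A \<Longrightarrow> A \<subseteq> {1..} \<Longrightarrow> A \<noteq> {} \<Longrightarrow> 0 \<le> u \<Longrightarrow> together A u \<in> sets M"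
  using together_history[of A u u] sets_history_subset by auto

lemma together_antimono:
  assumes "A \<subseteq> B" "0 \<le> s" "s \<le> t"
  shows "together B t \<subseteq> together A s"
proof
  fix \<omega> assume "\<omega> \<in> together B t"
  then have \<omega>: "\<omega> \<in> space M" "\<exists>C\<in>P t \<omega>. B \<subseteq> C" by (auto simp: together_def)
  then have "\<exists>C\<in>P s \<omega>. B \<subseteq> C"
    using partition_on_mono_blocks[OF refining[OF \<omega>(1) assms(2,3)]] by blast
  then show "\<omega> \<in> together A s" using assms(1) \<omega>(1) unfolding together_def by (blast intro: order_trans)
qed

lemma together_0:
  assumes "A \<subseteq> {1..}"
  shows "together A 0 = space M"
  unfolding together_def using one_block assms by auto

lemma prob_together_sum:
  assumes A: "A \<subseteq> {1..n}" "A \<noteq> {}" "0 \<le> t" and H: "H \<in> sets M"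
  shows "prob (H \<inter> together A t) = (\<Sum>\<pi>\<in>partitions_with n A. prob {\<omega> \<in> H. restr {1..n} (P t \<omega>) = \<pi>})"
proof -
  have HM: "H \<subseteq> space M" using H sets.sets_into_space by auto
  have ev: "{\<omega> \<in> H. restr {1..n} (P t \<omega>) = \<pi>} \<in> sets M" for \<pi>
  proof -
    have "{\<omega> \<in> H. restr {1..n} (P t \<omega>) = \<pi>} = H \<inter> {\<omega> \<in> space M. restr {1..n} (P t \<omega>) = \<pi>}" using HM by auto
    then show ?thesis using H restr_event[OF A(3)] by auto
  qed
  have "H \<inter> together A t = (\<Union>\<pi>\<in>partitions_with n A. {\<omega> \<in> H. restr {1..n} (P t \<omega>) = \<pi>})"
    unfolding together_restr[OF A] using HM by auto
  also have "prob \<dots> = (\<Sum>\<pi>\<in>partitions_with n A. prob {\<omega> \<in> H. restr {1..n} (P t \<omega>) = \<pi>})"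
    by (rule finite_measure_finite_Union) (use finite_partitions_with ev in \<open>auto simp: disjoint_family_on_def\<close>)
  finally show ?thesis .
qed

text \<open>
  Two total probabilities in one: all partitions of \<open>B\<close> (for empty \<open>A\<close>), or only those that keep
  \<open>A\<close> together.
\<close>

lemma prob_restr_total:
  assumes B: "B \<subseteq> {1..n}" "B \<noteq> {}" and t: "0 \<le> t" and A: "A = {} \<or> (A \<subseteq> B \<and> A \<noteq> {})"
  shows "(\<Sum>\<rho> | partition_on B \<rho> \<and> (A \<noteq> {} \<longrightarrow> (\<exists>D\<in>\<rho>. A \<subseteq> D)). prob {\<omega> \<in> space M. restr B (P t \<omega>) = \<rho>}) =
    (if A = {} then 1 else prob (together A t))"
proof -
  let ?R = "{\<rho>. partition_on B \<rho> \<and> (A \<noteq> {} \<longrightarrow> (\<exists>D\<in>\<rho>. A \<subseteq> D))}"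
  have fin: "finite ?R"
    by (rule finite_subset[OF _ finitely_many_partition_on[of B]]) (use B finite_subset in auto)
  have rr: "restr B (P t \<omega>) = restr B (restr {1..n} (P t \<omega>))" for \<omega>
    using restr_restr[OF B(1)] by simp
  have ev: "{\<omega> \<in> space M. restr B (P t \<omega>) = \<rho>} \<in> sets M" for \<rho>
    unfolding rr by (rule restr_event[OF t])
  have part: "partition_on B (restr B (P t \<omega>))" if "\<omega> \<in> space M" for \<omega>
    by (rule partition_on_restr[OF partition[OF that t]]) (use B in auto)
  have "(\<Sum>\<rho>\<in>?R. prob {\<omega> \<in> space M. restr B (P t \<omega>) = \<rho>}) = prob (\<Union>\<rho>\<in>?R. {\<omega> \<in> space M. restr B (P t \<omega>) = \<rho>})"
    by (rule finite_measure_finite_Union[symmetric]) (use fin ev in \<open>auto simp: disjoint_family_on_def\<close>)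
  also have "(\<Union>\<rho>\<in>?R. {\<omega> \<in> space M. restr B (P t \<omega>) = \<rho>}) = (if A = {} then space M else together A t)"
  proof (cases "A = {}")
    case True then show ?thesis using part by auto
  next
    case False
    then have AB: "A \<subseteq> B" "A \<noteq> {}" using A by auto
    have "(\<Union>\<rho>\<in>?R. {\<omega> \<in> space M. restr B (P t \<omega>) = \<rho>}) = {\<omega> \<in> space M. \<exists>D\<in>restr B (P t \<omega>). A \<subseteq> D}"
      using False part by auto
    then show ?thesis
      unfolding together_def block_restr_iff[OF AB] using False by simp
  qed
  finally show ?thesis by (simp add: prob_space)
qed

text \<open>
  The Markov property for keeping the labels \<open>A\<close> together. The branching property speaks of
  complete partitions of \<open>{1..n}\<close>; summed over the refinements that keep \<open>A\<close> together, the
  factors of all blocks but the one that contains \<open>A\<close> add up to 1.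
\<close>

lemma prob_together_step:
  assumes A: "finite A" "A \<subseteq> {1..}" "A \<noteq> {}" and st: "0 \<le> s" "0 \<le> t" and H: "H \<in> sets (history s)"
  shows "prob (H \<inter> together A s \<inter> together A (s + t)) = prob (H \<inter> together A s) * prob (together A t)"
proof -
  define n where "n = Max A"
  have An: "A \<subseteq> {1..n}" using A by (auto simp: n_def)
  let ?Q = "partitions_with n A"
  let ?p = "\<lambda>B \<rho>. prob {\<omega> \<in> space M. restr B (P t \<omega>) = \<rho>}"
  have HM: "H \<in> sets M" using H sets_history_subset by auto
  have HS: "H \<subseteq> space M" using HM sets.sets_into_space by auto
  have st': "0 \<le> s + t" using st by simp
  have H\<pi>: "{\<omega> \<in> H. restr {1..n} (P s \<omega>) = \<pi>} \<in> sets M" for \<pi>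
  proof -
    have "{\<omega> \<in> H. restr {1..n} (P s \<omega>) = \<pi>} = H \<inter> {\<omega> \<in> space M. restr {1..n} (P s \<omega>) = \<pi>}" using HS by auto
    then show ?thesis using HM restr_event[OF st(1)] by auto
  qed
  have "prob (H \<inter> together A s \<inter> together A (s + t)) =
      (\<Sum>\<sigma>\<in>?Q. prob {\<omega> \<in> H \<inter> together A s. restr {1..n} (P (s + t) \<omega>) = \<sigma>})"
    using together_event[OF A st(1)] HM by (intro prob_together_sum An A st') auto
  also have "\<dots> = (\<Sum>\<sigma>\<in>?Q. \<Sum>\<pi>\<in>?Q. prob {\<omega> \<in> H. restr {1..n} (P s \<omega>) = \<pi> \<and> restr {1..n} (P (s + t) \<omega>) = \<sigma>})"
  proof (rule sum.cong[OF refl])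
    fix \<sigma>
    let ?H = "H \<inter> {\<omega> \<in> space M. restr {1..n} (P (s + t) \<omega>) = \<sigma>}"
    have "{\<omega> \<in> H \<inter> together A s. restr {1..n} (P (s + t) \<omega>) = \<sigma>} = ?H \<inter> together A s"
      using HS by auto
    also have "prob \<dots> = (\<Sum>\<pi>\<in>?Q. prob {\<omega> \<in> ?H. restr {1..n} (P s \<omega>) = \<pi>})"
      using HM restr_event[OF st'] by (intro prob_together_sum An A st) auto
    also have "\<dots> = (\<Sum>\<pi>\<in>?Q. prob {\<omega> \<in> H. restr {1..n} (P s \<omega>) = \<pi> \<and> restr {1..n} (P (s + t) \<omega>) = \<sigma>})"
      using HS by (intro sum.cong refl arg_cong[where f = prob]) auto
    finally show "prob {\<omega> \<in> H \<inter> together A s. restr {1..n} (P (s + t) \<omega>) = \<sigma>} =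
      (\<Sum>\<pi>\<in>?Q. prob {\<omega> \<in> H. restr {1..n} (P s \<omega>) = \<pi> \<and> restr {1..n} (P (s + t) \<omega>) = \<sigma>})" .
  qed
  also have "\<dots> = (\<Sum>\<sigma>\<in>?Q. \<Sum>\<pi>\<in>?Q. prob {\<omega> \<in> H. restr {1..n} (P s \<omega>) = \<pi>} *
      (if refines {1..n} \<sigma> \<pi> then \<Prod>B\<in>\<pi>. ?p B (restr B \<sigma>) else 0))"
    using H by (intro sum.cong refl branching[OF st]) (auto simp: partitions_with_def sets_history)
  also have "\<dots> = (\<Sum>\<pi>\<in>?Q. \<Sum>\<sigma>\<in>?Q. prob {\<omega> \<in> H. restr {1..n} (P s \<omega>) = \<pi>} *
      (if refines {1..n} \<sigma> \<pi> then \<Prod>B\<in>\<pi>. ?p B (restr B \<sigma>) else 0))"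
    by (rule sum.swap)
  also have "\<dots> = (\<Sum>\<pi>\<in>?Q. prob {\<omega> \<in> H. restr {1..n} (P s \<omega>) = \<pi>} * prob (together A t))"
  proof (rule sum.cong[OF refl])
    fix \<pi> assume "\<pi> \<in> ?Q"
    then obtain C where \<pi>: "partition_on {1..n} \<pi>" and C: "C \<in> \<pi>" "A \<subseteq> C" by (auto simp: partitions_with_def)
    have "(\<Sum>\<sigma>\<in>?Q. if refines {1..n} \<sigma> \<pi> then \<Prod>B\<in>\<pi>. ?p B (restr B \<sigma>) else 0) =
        (\<Sum>\<sigma>\<in>{\<sigma>\<in>?Q. refines {1..n} \<sigma> \<pi>}. \<Prod>B\<in>\<pi>. ?p B (restr B \<sigma>))"
      by (rule sum.inter_filter[symmetric, OF finite_partitions_with])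
    also have "{\<sigma>\<in>?Q. refines {1..n} \<sigma> \<pi>} = {\<sigma>. refines {1..n} \<sigma> \<pi> \<and> (\<exists>D\<in>\<sigma>. A \<subseteq> D)}"
      by (auto simp: partitions_with_def refines_def)
    also have "(\<Sum>\<sigma>\<in>\<dots>. \<Prod>B\<in>\<pi>. ?p B (restr B \<sigma>)) =
        (\<Prod>B\<in>\<pi>. \<Sum>\<rho> | partition_on B \<rho> \<and> (B = C \<longrightarrow> (\<exists>D\<in>\<rho>. A \<subseteq> D)). ?p B \<rho>)"
      by (rule sum_over_refinements[OF _ \<pi> C A(3)]) simp
    also have "\<dots> = (\<Prod>B\<in>\<pi>. if B = C then prob (together A t) else 1)"
    proof (rule prod.cong[OF refl])
      fix B assume "B \<in> \<pi>"
      then have B: "B \<subseteq> {1..n}" "B \<noteq> {}" using \<pi> by (auto simp: partition_on_def)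
      show "(\<Sum>\<rho> | partition_on B \<rho> \<and> (B = C \<longrightarrow> (\<exists>D\<in>\<rho>. A \<subseteq> D)). ?p B \<rho>) = (if B = C then prob (together A t) else 1)"
        using prob_restr_total[OF B st(2), of A] prob_restr_total[OF B st(2), of "{}"] C A(3) by (cases "B = C") auto
    qed
    also have "\<dots> = prob (together A t)"
      using C(1) finite_elements[OF _ \<pi>] by (simp add: prod.delta)
    finally show "(\<Sum>\<sigma>\<in>?Q. prob {\<omega> \<in> H. restr {1..n} (P s \<omega>) = \<pi>} *
        (if refines {1..n} \<sigma> \<pi> then \<Prod>B\<in>\<pi>. ?p B (restr B \<sigma>) else 0)) =
      prob {\<omega> \<in> H. restr {1..n} (P s \<omega>) = \<pi>} * prob (together A t)"
      by (simp only: sum_distrib_left[symmetric])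
  qed
  also have "\<dots> = prob (H \<inter> together A s) * prob (together A t)"
    unfolding prob_together_sum[OF An A(3) st(1) HM] by (rule sum_distrib_right[symmetric])
  finally show ?thesis .
qed

text \<open>
  Exchangeability at a single time, applied to a permutation that moves an initial segment onto
  \<open>A\<close>. Together with the Markov property, which holds for every set of labels, it yields the law
  of the block of every label.
\<close>

lemma prob_together_card:
  assumes A: "finite A" "A \<subseteq> {1..}" "A \<noteq> {}" and t: "0 \<le> t"
  shows "prob (together A t) = prob (together {1..card A} t)"
proof -
  define n where "n = Max A"
  have An: "A \<subseteq> {1..n}" using A by (auto simp: n_def)
  have cA: "1 \<le> card A" using A by (simp add: Suc_leI card_gt_0_iff)
  have "card A \<le> n" using card_mono[OF _ An] by simp
  then have A0: "{1..card A} \<subseteq> {1..n}" "{1..card A} \<noteq> {}" using cA by auto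
  obtain p where p: "p permutes {1..n}" "p ` {1..card A} = A"
    using ex_permutes_image[of "{1..n}" "{1..card A}" A] A0 An by auto
  have inj: "inj p" by (rule permutes_inj[OF p(1)])
  have pX: "p ` {1..n} = {1..n}" by (rule permutes_image[OF p(1)])
  have img: "(`) p ` \<pi> \<in> partitions_with n (p ` B) \<longleftrightarrow> \<pi> \<in> partitions_with n B" for \<pi> B
  proof -
    have "partition_on {1..n} ((`) p ` \<pi>) \<longleftrightarrow> partition_on {1..n} \<pi>"
    proof
      assume "partition_on {1..n} \<pi>"
      then have "partition_on (p ` {1..n}) ((`) p ` \<pi> - {{}})"
        using inj by (intro partition_on_inj_image) (auto intro: inj_on_subset)
      moreover have "(`) p ` \<pi> - {{}} = (`) p ` \<pi>" using \<open>partition_on {1..n} \<pi>\<close> by (auto simp: partition_on_def)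
      ultimately show "partition_on {1..n} ((`) p ` \<pi>)" by (simp only: pX)
    next
      assume *: "partition_on {1..n} ((`) p ` \<pi>)"
      show "partition_on {1..n} \<pi>"
      proof (rule partition_onI)
        have "p ` (\<Union>\<pi>) = p ` {1..n}" unfolding pX using partition_onD1[OF *] by (simp add: image_Union)
        then show "\<Union>\<pi> = {1..n}" using inj by (simp add: inj_image_eq_iff)
        show "{} \<notin> \<pi>" using partition_onD3[OF *] by auto
        fix S T assume ST: "S \<in> \<pi>" "T \<in> \<pi>" "S \<noteq> T"
        then have "p ` S \<noteq> p ` T" using inj by (simp add: inj_image_eq_iff)
        then have "p ` S \<inter> p ` T = {}" using partition_onD2[OF *] ST by (auto simp: disjoint_def)
        then show "disjnt S T" by (auto simp: disjnt_def)
      qed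
    qed
    moreover have "(\<exists>D\<in>(`) p ` \<pi>. p ` B \<subseteq> D) \<longleftrightarrow> (\<exists>D\<in>\<pi>. B \<subseteq> D)"
      using inj by (simp add: inj_image_subset_iff)
    ultimately show ?thesis by (simp add: partitions_with_def)
  qed
  have "prob (together A t) = (\<Sum>\<pi>\<in>partitions_with n A. prob {\<omega> \<in> space M. restr {1..n} (P t \<omega>) = \<pi>})"
    using prob_together_sum[OF An A(3) t sets.top] together_event[OF A t, THEN sets.sets_into_space] by (simp add: Int_absorb1)
  also have "\<dots> = (\<Sum>\<pi>\<in>partitions_with n {1..card A}. prob {\<omega> \<in> space M. restr {1..n} (P t \<omega>) = \<pi>})"
  proof (rule sum.reindex_bij_witness[where i = "\<lambda>\<pi>. (`) p ` \<pi>" and j = "\<lambda>\<pi>. (`) (inv p) ` \<pi>"])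
    have inv: "(`) p ` (`) (inv p) ` \<pi> = \<pi>" "(`) (inv p) ` (`) p ` \<pi> = \<pi>" for \<pi> :: "nat set set"
    proof -
      have "p ` inv p ` S = S" "inv p ` p ` S = S" for S
        by (simp_all add: image_comp permutes_inv_o[OF p(1)])
      then show "(`) p ` (`) (inv p) ` \<pi> = \<pi>" "(`) (inv p) ` (`) p ` \<pi> = \<pi>"
        by (simp_all only: image_image image_ident)
    qed
    fix \<pi>
    show "(`) p ` (`) (inv p) ` \<pi> = \<pi>" "(`) (inv p) ` (`) p ` \<pi> = \<pi>" by (rule inv)+
    show "(`) (inv p) ` \<pi> \<in> partitions_with n {1..card A}" if "\<pi> \<in> partitions_with n A"
      using img[of "(`) (inv p) ` \<pi>" "{1..card A}"] that unfolding inv p(2) by simp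
    show "(`) p ` \<pi> \<in> partitions_with n A" if "\<pi> \<in> partitions_with n {1..card A}"
      using img[of \<pi> "{1..card A}"] that unfolding p(2) by simp
    show "prob {\<omega> \<in> space M. restr {1..n} (P t \<omega>) = (`) (inv p) ` \<pi>} = prob {\<omega> \<in> space M. restr {1..n} (P t \<omega>) = \<pi>}"
      using exchangeable[OF t p(1), of "(`) (inv p) ` \<pi>"] unfolding inv by simp
  qed
  also have "\<dots> = prob (together {1..card A} t)"
    using prob_together_sum[OF A0 t sets.top] together_event[of "{1..card A}" t, THEN sets.sets_into_space] A0 t
    by (simp add: Int_absorb1)
  finally show ?thesis .
qed

text \<open>
  Multiplicativity is the Markov property, and the derivative at 0 is minus the sum of the
  dislocation rates. For a single label both sides are 1.
\<close>

lemma prob_together_interval: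
  assumes t: "0 \<le> t"
  shows "prob (together {1..Suc m} t) = exp (- (t * split_rate \<beta> m))"
proof (cases "m = 0")
  case True
  have "together {1..Suc m} t = space M"
  proof -
    have "\<exists>B\<in>P t \<omega>. {1} \<subseteq> B" if "\<omega> \<in> space M" for \<omega>
      using partition_onD1[OF partition[OF that t]] by auto
    then show ?thesis using True by (auto simp: together_def)
  qed
  then show ?thesis using True by (simp add: prob_space split_rate_def)
next
  case False
  let ?A = "{1..Suc m}" and ?g = "\<lambda>t. prob (together {1..Suc m} t)"
  have ev: "together ?A t \<in> sets M" if "0 \<le> t" for t by (rule together_event) (use that in auto)
  show ?thesis
  proof (rule multiplicative_eq_exp[OF _ _ _ t])
    show "?g 0 = 1" by (subst together_0) (auto simp: prob_space)
    fix s t :: real assume st: "0 \<le> s" "0 \<le> t"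
    have "?g (s + t) = prob (space M \<inter> together ?A s \<inter> together ?A (s + t))"
      using together_antimono[of ?A ?A s "s + t"] ev[OF st(1), THEN sets.sets_into_space] st
      by (intro arg_cong[where f = prob]) auto
    also have "\<dots> = prob (space M \<inter> together ?A s) * ?g t"
      using sets.top[of "history s"] by (intro prob_together_step st) auto
    also have "space M \<inter> together ?A s = together ?A s"
      using ev[OF st(1), THEN sets.sets_into_space] by auto
    finally show "?g (s + t) = ?g s * ?g t" .
  next
    let ?Q = "{\<pi>. partition_on ?A \<pi> \<and> \<pi> \<noteq> {?A}}"
    have "((\<lambda>t. \<Sum>\<pi>\<in>?Q. prob {\<omega> \<in> space M. restr ?A (P t \<omega>) = \<pi>} / t) \<longlongrightarrow>
        (\<Sum>\<pi>\<in>?Q. LINT x|nu \<beta>. pmf (paintbox x (Suc m)) \<pi>)) (at_right 0)"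
      using False by (intro tendsto_sum dislocation) auto
    then have "((\<lambda>t. \<Sum>\<pi>\<in>?Q. prob {\<omega> \<in> space M. restr ?A (P t \<omega>) = \<pi>} / t) \<longlongrightarrow> split_rate \<beta> m) (at_right 0)"
      by (simp only: total_split_rate[OF beta])
    moreover have "eventually (\<lambda>t. (\<Sum>\<pi>\<in>?Q. prob {\<omega> \<in> space M. restr ?A (P t \<omega>) = \<pi>} / t) = (1 - ?g t) / t) (at_right 0)"
      using eventually_at_right_less[of 0]
    proof eventually_elim
      case (elim t)
      then have t: "0 \<le> t" by simp
      let ?Pi = "{\<rho>. partition_on ?A \<rho> \<and> (({} :: nat set) \<noteq> {} \<longrightarrow> (\<exists>D\<in>\<rho>. {} \<subseteq> D))}"
      have fin: "finite ?Pi" by (simp add: finitely_many_partition_on)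
      have Q: "?Q = ?Pi - {{?A}}" by auto
      have "(\<Sum>\<rho>\<in>?Pi. prob {\<omega> \<in> space M. restr ?A (P t \<omega>) = \<rho>}) = 1"
        using prob_restr_total[of ?A "Suc m" t "{}"] t by simp
      moreover have "{?A} \<in> ?Pi" by (simp add: partition_on_space)
      ultimately have "(\<Sum>\<pi>\<in>?Q. prob {\<omega> \<in> space M. restr ?A (P t \<omega>) = \<pi>}) =
          1 - prob {\<omega> \<in> space M. restr ?A (P t \<omega>) = {?A}}"
        unfolding Q using sum.remove[OF fin, of "{?A}" "\<lambda>\<pi>. prob {\<omega> \<in> space M. restr ?A (P t \<omega>) = \<pi>}"]
        by linarith
      also have "{\<omega> \<in> space M. restr ?A (P t \<omega>) = {?A}} = together ?A t"
      proof -
        have "restr ?A (P t \<omega>) = {?A} \<longleftrightarrow> (\<exists>B\<in>P t \<omega>. ?A \<subseteq> B)" if "\<omega> \<in> space M" for \<omega>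
        proof -
          have part: "partition_on ?A (restr ?A (P t \<omega>))" by (rule partition_restr[OF that t])
          have "(\<exists>B\<in>restr ?A (P t \<omega>). ?A \<subseteq> B) \<longleftrightarrow> restr ?A (P t \<omega>) = {?A}"
          proof
            assume "\<exists>B\<in>restr ?A (P t \<omega>). ?A \<subseteq> B"
            then obtain B where B: "B \<in> restr ?A (P t \<omega>)" "?A \<subseteq> B" by auto
            then have BA: "B = ?A" using part by (auto simp: partition_on_def)
            have "C = B" if C: "C \<in> restr ?A (P t \<omega>)" for C
            proof (rule ccontr)
              assume "C \<noteq> B"
              then have "C \<inter> B = {}" using partition_onD2[OF part] B(1) C by (auto simp: disjoint_def)
              moreover have "C \<subseteq> ?A" "C \<noteq> {}" using part C by (auto simp: partition_on_def)
              ultimately show False using BA by auto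
            qed
            then show "restr ?A (P t \<omega>) = {?A}" using B BA by auto
          qed simp
          then show ?thesis using block_restr_iff[of ?A ?A "P t \<omega>"] by simp
        qed
        then show ?thesis unfolding together_def by auto
      qed
      finally show ?case by (simp add: sum_divide_distrib[symmetric])
    qed
    ultimately show "((\<lambda>t. (1 - ?g t) / t) \<longlongrightarrow> split_rate \<beta> m) (at_right 0)"
      by (rule Lim_transform_eventually)
  qed
qed

lemma prob_together:
  assumes "finite A" "A \<subseteq> {1..}" "j \<in> {1..}" "j \<notin> A" "0 \<le> t"
  shows "prob (together (insert j A) t) = exp (- (t * split_rate \<beta> (card A)))"
  using prob_together_card[of "insert j A" t] prob_together_interval[of t "card A"] assms by simp

text \<open>
  Peel off the last time: the event up to time \<open>\<tau> k\<close> already contains that the smaller set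
  \<open>A (k + 1)\<close> is together with \<open>j\<close> at time \<open>\<tau> k\<close>.
\<close>

lemma prob_together_chain:
  fixes A :: "nat \<Rightarrow> nat set"
  assumes \<tau>: "\<tau> 0 = 0" "mono \<tau>" and j: "1 \<le> j"
    and A: "\<And>i. finite (A i)" "\<And>i. A i \<subseteq> {1..} - {j}" "\<And>i. A (Suc i) \<subseteq> A i"
  shows "prob (space M \<inter> (\<Inter>i\<in>{1..k}. together (insert j (A i)) (\<tau> i))) =
    (\<Prod>i<k. exp (- ((\<tau> (Suc i) - \<tau> i) * split_rate \<beta> (card (A (Suc i))))))"
proof (induction k)
  case 0 then show ?case by (simp add: prob_space)
next
  case (Suc k)
  let ?H = "space M \<inter> (\<Inter>i\<in>{1..k}. together (insert j (A i)) (\<tau> i))"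
  let ?B = "insert j (A (Suc k))"
  have B: "finite ?B" "?B \<subseteq> {1..}" "?B \<noteq> {}" using A j by auto
  have \<tau>0: "0 \<le> \<tau> i" for i using monoD[OF \<tau>(2), of 0 i] \<tau>(1) by simp
  have "?H \<in> sets (history (\<tau> k))"
  proof -
    have "together (insert j (A i)) (\<tau> i) \<in> sets (history (\<tau> k))" if "i \<in> {1..k}" for i
      using that A[of i] A(2)[of i] j by (intro together_history \<tau>0 monoD[OF \<tau>(2)]) auto
    then show ?thesis
      using sets.top[of "history (\<tau> k)"] by (cases "k = 0") (auto intro!: sets.Int sets.finite_INT)
  qed
  moreover have sub: "?H \<subseteq> together ?B (\<tau> k)"
  proof (cases "k = 0")
    case True then show ?thesis using together_0[of ?B] \<tau>(1) B by auto
  next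
    case False
    then have "?H \<subseteq> together (insert j (A k)) (\<tau> k)" by auto
    also have "\<dots> \<subseteq> together ?B (\<tau> k)" using A(3)[of k] \<tau>0 by (intro together_antimono) auto
    finally show ?thesis .
  qed
  moreover have "0 \<le> \<tau> (Suc k) - \<tau> k" using monoD[OF \<tau>(2), of k "Suc k"] by simp
  ultimately have "prob (?H \<inter> together ?B (\<tau> k) \<inter> together ?B (\<tau> k + (\<tau> (Suc k) - \<tau> k))) =
      prob (?H \<inter> together ?B (\<tau> k)) * prob (together ?B (\<tau> (Suc k) - \<tau> k))"
    by (intro prob_together_step B \<tau>0)
  moreover have "?H \<inter> together ?B (\<tau> k) = ?H" using sub by auto
  moreover have "space M \<inter> (\<Inter>i\<in>{1..Suc k}. together (insert j (A i)) (\<tau> i)) = ?H \<inter> together ?B (\<tau> (Suc k))"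
    by (auto simp: atLeastAtMostSuc_conv)
  moreover have "prob (together ?B (\<tau> (Suc k) - \<tau> k)) = exp (- ((\<tau> (Suc k) - \<tau> k) * split_rate \<beta> (card (A (Suc k)))))"
    using A[of "Suc k"] A(2)[of "Suc k"] j \<open>0 \<le> \<tau> (Suc k) - \<tau> k\<close> by (intro prob_together) auto
  ultimately show ?case using Suc.IH by simp
qed

end

section \<open>Discrete heights\<close>

definition joined :: "(real \<Rightarrow> nat set set) \<Rightarrow> nat \<Rightarrow> nat \<Rightarrow> real \<Rightarrow> bool" where
  "joined p a b t \<longleftrightarrow> (\<exists>B\<in>p t. {a, b} \<subseteq> B)"

text \<open>
  Countably many truth values, which determine a right-continuous path of partitions.
\<close>

definition path_code :: "(real \<Rightarrow> nat set set) \<Rightarrow> nat \<times> nat \<times> rat \<Rightarrow> bool" where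
  "path_code p = (\<lambda>(a, b, q). joined p a b \<bar>of_rat q\<bar>)"

text \<open>
  The partition of \<open>{1..n}\<close> at a real time \<open>t\<close>, recovered from the code: two labels are together
  at time \<open>t\<close> iff they are together at some later rational time.
\<close>

definition restr_of_code :: "nat \<Rightarrow> real \<Rightarrow> (nat \<times> nat \<times> rat \<Rightarrow> bool) \<Rightarrow> nat set set" where
  "restr_of_code n t c =
    {1..n} // {(a, b). a \<in> {1..n} \<and> b \<in> {1..n} \<and> (\<exists>q. t < \<bar>of_rat q\<bar> \<and> c (a, b, q))}"

text \<open>
  Enumerates the labels other than \<open>j\<close> in increasing order, starting with index 0.
\<close>

definition other_label :: "nat \<Rightarrow> nat \<Rightarrow> nat" where
  "other_label j k = (if Suc k < j then Suc k else Suc (Suc k))"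

lemma inj_other_label: "inj (other_label j)"
  by (rule injI) (auto simp: other_label_def split: if_splits)

lemma other_label_range: "other_label j k \<noteq> j" "1 \<le> other_label j k"
  by (auto simp: other_label_def)

lemma image_other_label:
  assumes "j \<in> {1..n}"
  shows "other_label j ` {..<n - 1} = {1..n} - {j}"
proof (intro equalityI subsetI)
  fix a assume a: "a \<in> {1..n} - {j}"
  define k where "k = (if a < j then a - 1 else a - 2)"
  have "other_label j k = a" "k < n - 1" using a assms by (auto simp: other_label_def k_def)
  then show "a \<in> other_label j ` {..<n - 1}" by blast
qed (use assms in \<open>auto simp: other_label_def split: if_splits\<close>)

lemma restr_eq_quotient:
  assumes "partition_on {1..} \<pi>"
  shows "restr {1..n} \<pi> = {1..n} // {(a, b). a \<in> {1..n} \<and> b \<in> {1..n} \<and> (\<exists>B\<in>\<pi>. {a, b} \<subseteq> B)}"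
proof -
  have part: "partition_on {1..n} (restr {1..n} \<pi>)"
    by (rule partition_on_restr[OF assms]) auto
  have "(\<exists>D\<in>restr {1..n} \<pi>. a \<in> D \<and> b \<in> D) \<longleftrightarrow> a \<in> {1..n} \<and> b \<in> {1..n} \<and> (\<exists>B\<in>\<pi>. {a, b} \<subseteq> B)" for a b
  proof (cases "a \<in> {1..n} \<and> b \<in> {1..n}")
    case True
    then show ?thesis using block_restr_iff[of "{a, b}" "{1..n}" \<pi>] by simp
  next
    case False
    then show ?thesis using partition_onD1[OF part] by blast
  qed
  then have "{(a, b). \<exists>D\<in>restr {1..n} \<pi>. a \<in> D \<and> b \<in> D} =
      {(a, b). a \<in> {1..n} \<and> b \<in> {1..n} \<and> (\<exists>B\<in>\<pi>. {a, b} \<subseteq> B)}" by (simp only:)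
  then show ?thesis using partition_on_eq_quotient[OF part] by simp
qed

lemma measurable_restr_of_code [measurable]:
  "restr_of_code n t \<in> measurable bool_arrays (count_space UNIV)"
proof -
  let ?X = "{1..n} \<times> {1..n}"
  let ?r = "\<lambda>c :: nat \<times> nat \<times> rat \<Rightarrow> bool. {(a, b). a \<in> {1..n} \<and> b \<in> {1..n} \<and> (\<exists>q. t < \<bar>of_rat q\<bar> \<and> c (a, b, q))}"
  have fin: "finite (Pow ?X)" by simp
  have "?r \<in> measurable bool_arrays (count_space (Pow ?X))"
    unfolding measurable_count_space_eq2[OF fin]
  proof (intro conjI ballI)
    fix R assume R: "R \<in> Pow ?X"
    have eq: "?r c = R \<longleftrightarrow> (\<forall>z\<in>?X. (\<exists>q. t < \<bar>of_rat q\<bar> \<and> c (fst z, snd z, q)) \<longleftrightarrow> z \<in> R)" for c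
    proof
      assume *: "\<forall>z\<in>?X. (\<exists>q. t < \<bar>of_rat q\<bar> \<and> c (fst z, snd z, q)) \<longleftrightarrow> z \<in> R"
      have "(a, b) \<in> ?r c \<longleftrightarrow> (a, b) \<in> R" for a b
        using *[rule_format, of "(a, b)"] R by auto
      then show "?r c = R" by (intro set_eqI) (simp only: split_paired_all)
    next
      assume "?r c = R"
      then show "\<forall>z\<in>?X. (\<exists>q. t < \<bar>of_rat q\<bar> \<and> c (fst z, snd z, q)) \<longleftrightarrow> z \<in> R" by auto
    qed
    have "?r -` {R} \<inter> space bool_arrays =
        {c \<in> space bool_arrays. \<forall>z\<in>?X. (\<exists>q. t < \<bar>of_rat q\<bar> \<and> c (fst z, snd z, q)) \<longleftrightarrow> z \<in> R}"
      by (simp only: vimage_def Int_def mem_Collect_eq singleton_iff eq conj_commute)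
    also have "\<dots> \<in> sets bool_arrays"
      by measurable
    finally show "?r -` {R} \<inter> space bool_arrays \<in> sets bool_arrays" .
  qed auto
  then have "(\<lambda>r. {1..n} // r) \<circ> ?r \<in> measurable bool_arrays (count_space UNIV)"
    by (rule measurable_comp) simp
  then show ?thesis by (simp add: comp_def restr_of_code_def[abs_def])
qed

locale fragmentation_path =
  fixes p :: "real \<Rightarrow> nat set set"
  assumes partition: "\<And>t. 0 \<le> t \<Longrightarrow> partition_on {1..} (p t)"
    and one_block: "p 0 = {{1..}}"
    and refining: "\<And>s t. 0 \<le> s \<Longrightarrow> s \<le> t \<Longrightarrow> refines {1..} (p t) (p s)"
    and right_continuous: "\<And>t n. 0 \<le> t \<Longrightarrow> eventually (\<lambda>s. restr {1..n} (p s) = restr {1..n} (p t)) (at_right t)"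
begin

lemma joined_antimono: "0 \<le> s \<Longrightarrow> s \<le> t \<Longrightarrow> joined p a b t \<Longrightarrow> joined p a b s"
  unfolding joined_def by (rule partition_on_mono_blocks[OF refining])

lemma joined_pos: "0 \<le> t \<Longrightarrow> joined p a b t \<Longrightarrow> 1 \<le> a \<and> 1 \<le> b"
  unfolding joined_def using partition_onD1[OF partition, of t] by auto

text \<open>
  Right-continuity makes the time of separation of two labels the first time at which they are
  apart.
\<close>

lemma joined_iff_code:
  assumes t: "0 \<le> t"
  shows "joined p a b t \<longleftrightarrow> (\<exists>q. t < \<bar>of_rat q\<bar> \<and> path_code p (a, b, q))"
proof
  assume ab: "joined p a b t"
  let ?n = "max a b"
  have sub: "{a, b} \<subseteq> {1..?n}" using joined_pos[OF t ab] by auto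
  obtain u where u: "u > t" "\<And>s. t < s \<Longrightarrow> s < u \<Longrightarrow> restr {1..?n} (p s) = restr {1..?n} (p t)"
    using right_continuous[OF t, of ?n] unfolding eventually_at_right_field by blast
  obtain q :: rat where q: "t < of_rat q" "of_rat q < u" using of_rat_dense[OF u(1)] by auto
  have abs: "\<bar>of_rat q\<bar> = (of_rat q :: real)" using q t by linarith
  have "\<exists>B\<in>restr {1..?n} (p t). {a, b} \<subseteq> B"
    using ab block_restr_iff[OF sub] by (simp add: joined_def)
  then have "\<exists>B\<in>restr {1..?n} (p (of_rat q)). {a, b} \<subseteq> B" by (simp only: u(2)[OF q])
  then have "joined p a b (of_rat q)"
    using block_restr_iff[OF sub] by (simp add: joined_def)
  then show "\<exists>q. t < \<bar>of_rat q\<bar> \<and> path_code p (a, b, q)"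
    using q(1) abs by (intro exI[of _ q]) (simp only: path_code_def prod.case)
next
  assume "\<exists>q. t < \<bar>of_rat q\<bar> \<and> path_code p (a, b, q)"
  then obtain q where "t < \<bar>of_rat q\<bar>" "joined p a b \<bar>of_rat q\<bar>" by (auto simp: path_code_def)
  then show "joined p a b t" using joined_antimono[OF t] by (meson order_less_imp_le)
qed

lemma restr_path:
  assumes "0 \<le> t"
  shows "restr {1..n} (p t) = restr_of_code n t (path_code p)"
  unfolding restr_of_code_def joined_iff_code[OF assms, symmetric]
  using restr_eq_quotient[OF partition[OF assms]] by (simp add: joined_def)

lemma block_of_restr:
  assumes "0 \<le> t"
  shows "block_of j (restr {1..n} (p t)) = {a \<in> {1..n}. j \<in> {1..n} \<and> joined p j a t}"
proof -
  have "a \<in> block_of j (restr {1..n} (p t)) \<longleftrightarrow> a \<in> {1..n} \<and> j \<in> {1..n} \<and> joined p j a t" for a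
  proof -
    have part: "partition_on {1..n} (restr {1..n} (p t))"
      by (rule partition_on_restr[OF partition[OF assms]]) auto
    have "a \<in> block_of j (restr {1..n} (p t)) \<longleftrightarrow> (\<exists>B\<in>restr {1..n} (p t). {j, a} \<subseteq> B)"
      by (auto simp: block_of_def)
    also have "\<dots> \<longleftrightarrow> a \<in> {1..n} \<and> j \<in> {1..n} \<and> joined p j a t"
    proof (cases "{j, a} \<subseteq> {1..n}")
      case True
      then show ?thesis using block_restr_iff[of "{j, a}" "{1..n}" "p t"] by (simp add: joined_def)
    next
      case False
      then show ?thesis using partition_onD1[OF part] by blast
    qed
    finally show ?thesis .
  qed
  then show ?thesis by auto
qed

lemma decreasing_block: "decreasing_step_path (\<lambda>t. block_of j (restr {1..n} (p t)))"
proof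
  fix s t :: real assume "0 \<le> s" "s \<le> t"
  then show "block_of j (restr {1..n} (p t)) \<subseteq> block_of j (restr {1..n} (p s))"
    using block_of_restr[of s] block_of_restr[of t] joined_antimono[of s t] by auto
next
  fix t :: real assume "0 \<le> t"
  from right_continuous[OF this, of n]
  show "eventually (\<lambda>s. block_of j (restr {1..n} (p s)) = block_of j (restr {1..n} (p t))) (at_right t)"
    by eventually_elim simp
qed

text \<open>
  The block of \<open>j\<close> is a decreasing step path, whose values are determined by the other labels in
  it.
\<close>

lemma card_split_times:
  assumes j: "j \<in> {1..n}"
  shows "card (jump_times (\<lambda>t. block_of j (restr {1..n} (p t)))) =
    num_values (n - 1) (\<lambda>(k, q). path_code p (j, other_label j k, q))"
proof -
  let ?f = "\<lambda>t. block_of j (restr {1..n} (p t))"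
  let ?K = "\<lambda>q. {k. k < n - 1 \<and> path_code p (j, other_label j k, q)}"
  interpret f: decreasing_step_path ?f by (rule decreasing_block)
  have jj: "joined p j j t" if "0 \<le> t" for t
    using partition_onD1[OF partition[OF that]] j unfolding joined_def by auto
  have K: "?f \<bar>of_rat q\<bar> = insert j (other_label j ` ?K q)" for q
  proof -
    have "a \<in> ?f \<bar>of_rat q\<bar> \<longleftrightarrow> a \<in> insert j (other_label j ` ?K q)" for a
    proof (cases "a = j")
      case True then show ?thesis using j jj by (subst block_of_restr) auto
    next
      case False
      have "a \<in> ?f \<bar>of_rat q\<bar> \<longleftrightarrow> a \<in> {1..n} - {j} \<and> path_code p (j, a, q)"
        using j False by (subst block_of_restr) (auto simp: path_code_def)
      also have "\<dots> \<longleftrightarrow> a \<in> other_label j ` ?K q"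
        unfolding image_other_label[OF j, symmetric] by auto
      finally show ?thesis using False by simp
    qed
    then show ?thesis by blast
  qed
  have "card (?f ` {0..}) = card (range (\<lambda>q. ?f \<bar>of_rat q\<bar>))"
    by (simp only: f.values_at_rationals)
  also have "\<dots> = card (range ?K)"
  proof (rule card_image_same_kernel)
    fix q q' :: rat
    have nj: "j \<notin> other_label j ` S" for S by (metis imageE other_label_range(1))
    show "?f \<bar>of_rat q\<bar> = ?f \<bar>of_rat q'\<bar> \<longleftrightarrow> ?K q = ?K q'"
      unfolding K insert_ident[OF nj nj] by (rule inj_image_eq_iff[OF inj_other_label])
  qed
  finally show ?thesis
    unfolding f.card_jump_times num_values_def by simp
qed

lemma no_split_times:
  assumes j: "j \<notin> {1..n}"
  shows "jump_times (\<lambda>t. block_of j (restr {1..n} (p t))) = {}"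
proof -
  have empty: "block_of j (restr {1..n} (p t)) = {}" if "0 \<le> t" for t
    using block_of_restr[OF that] j by auto
  have "eventually (\<lambda>s. block_of j (restr {1..n} (p s)) = block_of j (restr {1..n} (p t))) (at_left t)"
    if "0 < t" for t
    using eventually_at_left_real[OF that]
  proof eventually_elim
    case (elim s)
    then show ?case using empty[of s] empty[of t] that by auto
  qed
  then show ?thesis by (auto simp: jump_times_def)
qed

end

lemma discrete_height_eq: "discrete_height P n j \<omega> = card (jump_times (\<lambda>t. block_of j (restr {1..n} (P t \<omega>))))"
  unfolding discrete_height_def jump_times_def ..

context beta_fragmentation
begin

lemma fragmentation_path: "\<omega> \<in> space M \<Longrightarrow> fragmentation_path (\<lambda>t. P t \<omega>)"
  by (rule fragmentation_path.intro) (rule partition one_block refining right_continuous, assumption+)+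

definition code :: "'a \<Rightarrow> nat \<times> nat \<times> rat \<Rightarrow> bool" where
  "code \<omega> = path_code (\<lambda>t. P t \<omega>)"

text \<open>
  Which of the other labels share the block of \<open>j\<close> at which rational times; the analogue of the
  array of living sample points.
\<close>

definition leaf_array :: "nat \<Rightarrow> 'a \<Rightarrow> nat \<times> rat \<Rightarrow> bool" where
  "leaf_array j \<omega> = (\<lambda>(k, q). code \<omega> (j, other_label j k, q))"

lemma measurable_code [measurable]: "code \<in> measurable M bool_arrays"
proof (rule measurable_bool_arrays)
  fix i :: "nat \<times> nat \<times> rat"
  obtain a b q where i: "i = (a, b, q)" by (cases i) auto
  have ev: "{\<omega> \<in> space M. code \<omega> i} = together {a, b} \<bar>of_rat q\<bar>"
    by (simp add: i code_def path_code_def joined_def together_def)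
  have "{\<omega> \<in> space M. code \<omega> i} \<in> sets M"
  proof (cases "1 \<le> a \<and> 1 \<le> b")
    case True
    then show ?thesis unfolding ev by (intro together_event) auto
  next
    case False
    have "{\<omega> \<in> space M. code \<omega> i} = {}"
      using fragmentation_path.joined_pos[OF fragmentation_path, of _ "\<bar>of_rat q\<bar>" a b] False
      by (auto simp: i code_def path_code_def)
    then show ?thesis by (simp only: sets.empty_sets)
  qed
  then show "(\<lambda>\<omega>. code \<omega> i) \<in> measurable M (count_space UNIV)" by (simp add: pred_def)
qed

lemma measurable_leaf_array [measurable]: "leaf_array j \<in> measurable M bool_arrays"
proof (rule measurable_bool_arrays)
  fix i :: "nat \<times> rat"
  show "(\<lambda>\<omega>. leaf_array j \<omega> i) \<in> measurable M (count_space UNIV)"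
    unfolding leaf_array_def case_prod_beta
    by (rule measurable_compose[OF measurable_code measurable_bool_arrays_coord])
qed

lemma discrete_height_leaf_array:
  assumes "\<omega> \<in> space M" "j \<in> {1..n}"
  shows "discrete_height P n j \<omega> = num_values (n - 1) (leaf_array j \<omega>)"
  using fragmentation_path.card_split_times[OF fragmentation_path, OF assms]
  by (simp add: discrete_height_eq leaf_array_def code_def)

lemma measurable_discrete_height: "discrete_height P n j \<in> measurable M (count_space UNIV)"
proof (cases "j \<in> {1..n}")
  case True
  have "(\<lambda>\<omega>. num_values (n - 1) (leaf_array j \<omega>)) \<in> measurable M (count_space UNIV)"
    by measurable
  then show ?thesis using discrete_height_leaf_array[OF _ True] by (simp cong: measurable_cong)
next
  case False
  have "discrete_height P n j \<omega> = 0" if "\<omega> \<in> space M" for \<omega>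
    using fragmentation_path.no_split_times[OF fragmentation_path[OF that] False] by (simp add: discrete_height_eq)
  then show ?thesis by (simp cong: measurable_cong)
qed

lemma prob_leaf_array:
  assumes "\<tau> 0 = 0" "mono \<tau>" "1 \<le> j" "\<And>i. finite (A i)" "\<And>i. A (Suc i) \<subseteq> A i"
  shows "prob {\<omega> \<in> space M. \<forall>i\<in>{1..k}. \<forall>l\<in>A i. joined (\<lambda>t. P t \<omega>) j (other_label j l) (\<tau> i)} =
    (\<Prod>i<k. exp (- ((\<tau> (Suc i) - \<tau> i) * split_rate \<beta> (card (A (Suc i))))))"
proof -
  let ?A = "\<lambda>i. other_label j ` A i"
  have \<tau>0: "0 \<le> \<tau> i" for i using monoD[OF assms(2), of 0 i] assms(1) by simp
  have "together (insert j (?A i)) (\<tau> i) = {\<omega> \<in> space M. \<forall>l\<in>A i. joined (\<lambda>t. P t \<omega>) j (other_label j l) (\<tau> i)}" for i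
    unfolding together_def joined_def
    using together_iff_pairs[OF partition[OF _ \<tau>0[of i]], of _ j "?A i"] assms(3) by auto
  then have "{\<omega> \<in> space M. \<forall>i\<in>{1..k}. \<forall>l\<in>A i. joined (\<lambda>t. P t \<omega>) j (other_label j l) (\<tau> i)} =
      space M \<inter> (\<Inter>i\<in>{1..k}. together (insert j (?A i)) (\<tau> i))" by auto
  also have "prob \<dots> = (\<Prod>i<k. exp (- ((\<tau> (Suc i) - \<tau> i) * split_rate \<beta> (card (?A (Suc i))))))"
    using assms(4,5) other_label_range[of j]
    by (intro prob_together_chain assms image_mono) (auto simp: image_subset_iff)
  also have "\<dots> = (\<Prod>i<k. exp (- ((\<tau> (Suc i) - \<tau> i) * split_rate \<beta> (card (A (Suc i))))))"
    by (subst card_image) (auto intro: inj_on_subset[OF inj_other_label])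
  finally show ?thesis .
qed

end

section \<open>Equality of the two laws\<close>

text \<open>
  Finitely many survival conditions as a chain: \<open>\<tau> 1, \<tau> 2, \<dots>\<close> are the times that occur, and
  \<open>A i\<close> consists of the labels with a condition at time \<open>\<tau> i\<close> or later. The time 0 is listed as
  \<open>\<tau> 1\<close> too, as conditions at time 0 count.
\<close>

lemma chain_of_finite_set:
  fixes F :: "(nat \<times> rat) set"
  assumes F: "finite F"
  obtains k :: nat and \<tau> :: "nat \<Rightarrow> real" and A :: "nat \<Rightarrow> nat set" where
    "\<tau> 0 = 0" "mono \<tau>" "\<And>i. finite (A i)" "\<And>i. A (Suc i) \<subseteq> A i"
    "\<And>b. (\<And>j s t. 0 \<le> s \<Longrightarrow> s \<le> t \<Longrightarrow> b j t \<Longrightarrow> b j s) \<Longrightarrow>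
       (\<forall>(j, q)\<in>F. b j \<bar>of_rat q\<bar>) \<longleftrightarrow> (\<forall>i\<in>{1..k}. \<forall>j\<in>A i. b j (\<tau> i))"
proof -
  define V where "V = insert 0 ((\<lambda>(j, q). \<bar>real_of_rat q\<bar>) ` F)"
  define L where "L = sorted_list_of_set V"
  have V: "finite V" "\<And>v. v \<in> V \<Longrightarrow> 0 \<le> v" unfolding V_def using F by auto
  have L: "set L = V" "sorted L"
    by (simp_all only: L_def set_sorted_list_of_set[OF V(1)] sorted_sorted_list_of_set)
  have L0: "0 < length L" by (rule length_pos_if_in_set[of 0]) (simp add: L V_def)
  note L = L L0
  \<comment> \<open>Constant after the last time, so that it is monotone on all of \<open>nat\<close>.\<close>
  define \<tau> where "\<tau> i = (if i = 0 then 0 else L ! min (i - 1) (length L - 1))" for i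
  define A where "A i = {j. \<exists>q. (j, q) \<in> F \<and> \<tau> i \<le> \<bar>real_of_rat q\<bar>}" for i
  have \<tau>0: "0 \<le> \<tau> i" for i
  proof -
    have "min (i - 1) (length L - 1) < length L" using L(3) by linarith
    then have "0 \<le> L ! min (i - 1) (length L - 1)" using V(2) L(1) nth_mem by metis
    then show ?thesis by (simp add: \<tau>_def)
  qed
  have mono: "mono \<tau>"
  proof (rule monoI)
    fix i j :: nat assume "i \<le> j"
    show "\<tau> i \<le> \<tau> j"
    proof (cases "i = 0")
      case True then show ?thesis using \<tau>0[of j] by (simp add: \<tau>_def)
    next
      case False
      have "min (i - 1) (length L - 1) \<le> min (j - 1) (length L - 1)" "min (j - 1) (length L - 1) < length L"
        using \<open>i \<le> j\<close> L(3) by linarith+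
      then show ?thesis
        using sorted_nth_mono[OF L(2)] False \<open>i \<le> j\<close> by (simp add: \<tau>_def)
    qed
  qed
  show ?thesis
  proof (rule that[of \<tau> A "length L"])
    show "finite (A i)" for i
    proof (rule finite_subset)
      show "A i \<subseteq> fst ` F" by (force simp: A_def)
    qed (use F in simp)
    show "A (Suc i) \<subseteq> A i" for i
      using monoD[OF mono, of i "Suc i"] by (auto simp: A_def intro: order_trans)
    fix b :: "nat \<Rightarrow> real \<Rightarrow> bool" assume b: "\<And>j s t. 0 \<le> s \<Longrightarrow> s \<le> t \<Longrightarrow> b j t \<Longrightarrow> b j s"
    show "(\<forall>(j, q)\<in>F. b j \<bar>of_rat q\<bar>) \<longleftrightarrow> (\<forall>i\<in>{1..length L}. \<forall>j\<in>A i. b j (\<tau> i))"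
    proof (intro iffI ballI)
      fix i j assume *: "\<forall>(j, q)\<in>F. b j \<bar>of_rat q\<bar>" "j \<in> A i"
      then obtain q where "(j, q) \<in> F" "\<tau> i \<le> \<bar>real_of_rat q\<bar>" by (auto simp: A_def)
      with * show "b j (\<tau> i)" using b[OF \<tau>0] by blast
    next
      fix p assume *: "\<forall>i\<in>{1..length L}. \<forall>j\<in>A i. b j (\<tau> i)" and p: "p \<in> F"
      obtain j q where jq: "p = (j, q)" by (cases p)
      have "\<bar>real_of_rat q\<bar> \<in> set L" unfolding L V_def using p jq by force
      then obtain i where i: "i < length L" "L ! i = \<bar>real_of_rat q\<bar>" by (auto simp: in_set_conv_nth)
      have "min (Suc i - 1) (length L - 1) = i" using i(1) by linarith
      then have \<tau>i: "\<tau> (Suc i) = \<bar>real_of_rat q\<bar>" using i(2) unfolding \<tau>_def by simp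
      then have "j \<in> A (Suc i)" using p jq by (auto simp: A_def)
      with * i have "b j (\<tau> (Suc i))" by auto
      then show "case p of (j, q) \<Rightarrow> b j \<bar>of_rat q\<bar>" using \<tau>i jq by simp
    qed
  qed (use mono in \<open>auto simp: \<tau>_def\<close>)
qed

text \<open>
  Both arrays give the same probability to each chain of survival conditions.
\<close>

lemma survival_leaf_law:
  assumes M: "beta_sample M \<beta> \<xi> E" and N: "beta_fragmentation N \<beta> P" and j: "1 \<le> j"
  shows "distr M bool_arrays (beta_sample.survival_array \<xi> E) = distr N bool_arrays (beta_fragmentation.leaf_array P j)"
proof -
  interpret M: beta_sample M \<beta> \<xi> E by fact
  interpret N: beta_fragmentation N \<beta> P by fact
  show ?thesis
  proof (rule bool_arrays_eqI)
    show "finite_measure (distr M bool_arrays M.survival_array)"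
      by (rule M.finite_measure_distr[OF M.measurable_survival_array])
    fix F :: "(nat \<times> rat) set" assume F: "finite F"
    let ?C = "{x. \<forall>i\<in>F. x i}"
    have C: "?C \<in> sets bool_arrays" by (rule sets_bool_arrays_cylinder[OF F])
    obtain k :: nat and \<tau> :: "nat \<Rightarrow> real" and A :: "nat \<Rightarrow> nat set" where
      ch: "\<tau> 0 = 0" "mono \<tau>" "\<And>i. finite (A i)" "\<And>i. A (Suc i) \<subseteq> A i"
      "\<And>b. (\<And>j s t. 0 \<le> s \<Longrightarrow> s \<le> t \<Longrightarrow> b j t \<Longrightarrow> b j s) \<Longrightarrow>
         (\<forall>(j, q)\<in>F. b j \<bar>of_rat q\<bar>) \<longleftrightarrow> (\<forall>i\<in>{1..k}. \<forall>j\<in>A i. b j (\<tau> i))"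
    proof (rule chain_of_finite_set[OF F], goal_cases)
      case (1 k \<tau> A)
      show ?case by (rule 1(1)[OF 1(2-)])
    qed
    let ?R = "\<Prod>i<k. exp (- ((\<tau> (Suc i) - \<tau> i) * split_rate \<beta> (card (A (Suc i)))))"
    have "emeasure (distr M bool_arrays M.survival_array) ?C = emeasure M {\<omega> \<in> space M. \<forall>(l, q)\<in>F. \<xi> \<bar>of_rat q\<bar> \<omega> < E (Suc l) \<omega>}"
      unfolding emeasure_distr[OF M.measurable_survival_array C]
      by (intro arg_cong[where f = "emeasure M"]) (auto simp: M.survival_array_def)
    also have "{\<omega> \<in> space M. \<forall>(l, q)\<in>F. \<xi> \<bar>of_rat q\<bar> \<omega> < E (Suc l) \<omega>} =
        {\<omega> \<in> space M. \<forall>i\<in>{1..k}. \<forall>l\<in>A i. \<xi> (\<tau> i) \<omega> < E (Suc l) \<omega>}"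
    proof (intro Collect_cong conj_cong refl)
      fix \<omega> assume \<omega>: "\<omega> \<in> space M"
      show "(\<forall>(l, q)\<in>F. \<xi> \<bar>of_rat q\<bar> \<omega> < E (Suc l) \<omega>) \<longleftrightarrow>
          (\<forall>i\<in>{1..k}. \<forall>l\<in>A i. \<xi> (\<tau> i) \<omega> < E (Suc l) \<omega>)"
        by (rule ch(5)) (rule order_le_less_trans[OF M.xi_mono[OF \<omega>]])
    qed
    also have "\<dots> = {\<omega> \<in> space M. \<forall>i\<in>{1..k}. \<forall>l\<in>Suc ` A i. \<xi> (\<tau> i) \<omega> < E l \<omega>}" by simp
    also have "emeasure M \<dots> = ?R"
    proof -
      have "M.prob {\<omega> \<in> space M. \<forall>i\<in>{1..k}. \<forall>l\<in>Suc ` A i. \<xi> (\<tau> i) \<omega> < E l \<omega>} =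
          (\<Prod>i<k. exp (- ((\<tau> (Suc i) - \<tau> i) * split_rate \<beta> (card (Suc ` A (Suc i))))))"
        by (rule M.prob_chain[OF ch(1,2)]) (use ch(3,4) in auto)
      then show ?thesis by (simp add: M.emeasure_eq_measure card_image)
    qed
    also have "?R = emeasure (distr N bool_arrays (N.leaf_array j)) ?C"
    proof -
      have "emeasure (distr N bool_arrays (N.leaf_array j)) ?C =
          emeasure N {\<omega> \<in> space N. \<forall>(l, q)\<in>F. joined (\<lambda>t. P t \<omega>) j (other_label j l) \<bar>of_rat q\<bar>}"
        unfolding emeasure_distr[OF N.measurable_leaf_array C]
        by (intro arg_cong[where f = "emeasure N"]) (auto simp: N.leaf_array_def N.code_def path_code_def)
      also have "{\<omega> \<in> space N. \<forall>(l, q)\<in>F. joined (\<lambda>t. P t \<omega>) j (other_label j l) \<bar>of_rat q\<bar>} =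
          {\<omega> \<in> space N. \<forall>i\<in>{1..k}. \<forall>l\<in>A i. joined (\<lambda>t. P t \<omega>) j (other_label j l) (\<tau> i)}"
      proof (intro Collect_cong conj_cong refl)
        fix \<omega> assume \<omega>: "\<omega> \<in> space N"
        show "(\<forall>(l, q)\<in>F. joined (\<lambda>t. P t \<omega>) j (other_label j l) \<bar>of_rat q\<bar>) \<longleftrightarrow>
            (\<forall>i\<in>{1..k}. \<forall>l\<in>A i. joined (\<lambda>t. P t \<omega>) j (other_label j l) (\<tau> i))"
          by (rule ch(5)) (rule fragmentation_path.joined_antimono[OF N.fragmentation_path[OF \<omega>]])
      qed
      also have "emeasure N \<dots> = ?R"
        using N.prob_leaf_array[of \<tau> j A k, OF ch(1,2) j ch(3,4)] by (simp add: N.emeasure_eq_measure)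
      finally show ?thesis by simp
    qed
    finally show "emeasure (distr M bool_arrays M.survival_array) ?C = emeasure (distr N bool_arrays (N.leaf_array j)) ?C" .
  qed auto
qed

text \<open>
  The height of each fixed leaf has the law of the number of occupied gaps, hence so has the
  height of an independent uniform leaf.
\<close>

theorem height_uniform_leaf:
  assumes M: "beta_sample M \<beta> \<xi> E" and N: "beta_fragmentation N \<beta> P" and n: "1 \<le> n"
  shows "same_law (N \<Otimes>\<^sub>M measure_pmf (pmf_of_set {1..n})) (\<lambda>(\<omega>, j). discrete_height P n j \<omega>)
    M (occupied_gaps \<xi> E (n - 1))"
proof -
  interpret M: beta_sample M \<beta> \<xi> E by fact
  interpret N: beta_fragmentation N \<beta> P by fact
  let ?J = "pmf_of_set {1..n}" and ?h = "\<lambda>z. discrete_height P n (snd z) (fst z)"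
  let ?K = "occupied_gaps \<xi> E (n - 1)"
  interpret J: prob_space "measure_pmf ?J" by (rule prob_space_measure_pmf)
  have h: "?h \<in> measurable (N \<Otimes>\<^sub>M measure_pmf ?J) (count_space UNIV)"
  proof (rule measurable_compose_countable[where f = "\<lambda>j z. discrete_height P n j (fst z)" and g = snd])
    show "(\<lambda>z. discrete_height P n j (fst z)) \<in> measurable (N \<Otimes>\<^sub>M measure_pmf ?J) (count_space UNIV)" for j
      by (rule measurable_compose[OF measurable_fst N.measurable_discrete_height])
    show "snd \<in> measurable (N \<Otimes>\<^sub>M measure_pmf ?J) (count_space UNIV)"
      using measurable_compose[OF measurable_snd[of N "measure_pmf ?J"], of "\<lambda>j. j" "count_space UNIV"] by simp
  qed
  have single: "emeasure N {\<omega> \<in> space N. discrete_height P n j \<omega> \<in> B} = emeasure M {\<omega> \<in> space M. ?K \<omega> \<in> B}"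
    if j: "j \<in> {1..n}" for j B
  proof -
    let ?V = "num_values (n - 1) -` B :: (nat \<times> rat \<Rightarrow> bool) set"
    have V: "?V \<in> sets bool_arrays"
      using measurable_sets[OF measurable_num_values, of B "n - 1"] by simp
    have "emeasure N {\<omega> \<in> space N. discrete_height P n j \<omega> \<in> B} = emeasure (distr N bool_arrays (N.leaf_array j)) ?V"
      unfolding emeasure_distr[OF N.measurable_leaf_array V]
      using N.discrete_height_leaf_array[OF _ j] by (intro arg_cong[where f = "emeasure N"]) auto
    also have "\<dots> = emeasure (distr M bool_arrays M.survival_array) ?V"
      using survival_leaf_law[OF M N, of j] j by simp
    also have "\<dots> = emeasure M {\<omega> \<in> space M. num_values (n - 1) (M.survival_array \<omega>) \<in> B}"
      unfolding emeasure_distr[OF M.measurable_survival_array V]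
      by (intro arg_cong[where f = "emeasure M"]) auto
    also have "\<dots> = emeasure M {\<omega> \<in> space M. ?K \<omega> \<in> B}"
    proof (rule emeasure_eq_AE)
      show "AE \<omega> in M. \<omega> \<in> {\<omega> \<in> space M. num_values (n - 1) (M.survival_array \<omega>) \<in> B} \<longleftrightarrow> \<omega> \<in> {\<omega> \<in> space M. ?K \<omega> \<in> B}"
        using M.AE_occupied_gaps by eventually_elim auto
      show "{\<omega> \<in> space M. num_values (n - 1) (M.survival_array \<omega>) \<in> B} \<in> sets M"
        using measurable_sets[OF measurable_compose[OF M.measurable_survival_array measurable_num_values], of B "n - 1"]
        by (simp add: vimage_def Int_def conj_commute)
      show "{\<omega> \<in> space M. ?K \<omega> \<in> B} \<in> sets M"
        using measurable_sets[OF M.measurable_occupied_gaps, of B "n - 1"]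
        by (simp add: vimage_def Int_def conj_commute)
    qed
    finally show ?thesis .
  qed
  have "distr (N \<Otimes>\<^sub>M measure_pmf ?J) (count_space UNIV) ?h = distr M (count_space UNIV) ?K"
  proof (rule measure_eqI)
    fix B assume "B \<in> sets (distr (N \<Otimes>\<^sub>M measure_pmf ?J) (count_space UNIV) ?h)"
    let ?H = "{z \<in> space (N \<Otimes>\<^sub>M measure_pmf ?J). ?h z \<in> B}"
    interpret NJ: pair_sigma_finite N "measure_pmf ?J" ..
    have H: "?H \<in> sets (N \<Otimes>\<^sub>M measure_pmf ?J)"
      using measurable_sets[OF h, of B] by (simp add: vimage_def Int_def conj_commute)
    have "emeasure (distr (N \<Otimes>\<^sub>M measure_pmf ?J) (count_space UNIV) ?h) B = emeasure (N \<Otimes>\<^sub>M measure_pmf ?J) ?H"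
      using h by (simp add: emeasure_distr vimage_def Int_def conj_commute)
    also have "\<dots> = (\<integral>\<^sup>+j. emeasure N ((\<lambda>\<omega>. (\<omega>, j)) -` ?H) \<partial>measure_pmf ?J)"
      by (rule NJ.emeasure_pair_measure_alt2[OF H])
    also have "\<dots> = (\<integral>\<^sup>+j. emeasure M {\<omega> \<in> space M. ?K \<omega> \<in> B} \<partial>measure_pmf ?J)"
    proof (rule nn_integral_cong_AE, rule AE_pmfI)
      fix j assume "j \<in> set_pmf ?J"
      then have j: "j \<in> {1..n}" using n by (subst (asm) set_pmf_of_set) auto
      have "(\<lambda>\<omega>. (\<omega>, j)) -` ?H = {\<omega> \<in> space N. discrete_height P n j \<omega> \<in> B}"
        by (auto simp: space_pair_measure)
      then show "emeasure N ((\<lambda>\<omega>. (\<omega>, j)) -` ?H) = emeasure M {\<omega> \<in> space M. ?K \<omega> \<in> B}"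
        using single[OF j] by simp
    qed
    also have "\<dots> = emeasure M {\<omega> \<in> space M. ?K \<omega> \<in> B}" by simp
    also have "\<dots> = emeasure (distr M (count_space UNIV) ?K) B"
      using M.measurable_occupied_gaps by (simp add: emeasure_distr vimage_def Int_def conj_commute)
    finally show "emeasure (distr (N \<Otimes>\<^sub>M measure_pmf ?J) (count_space UNIV) ?h) B = emeasure (distr M (count_space UNIV) ?K) B" .
  qed simp
  with h show ?thesis
    unfolding same_law_def case_prod_beta using M.measurable_occupied_gaps by simp
qed

section \<open>Fragmentations from arrays\<close>

definition code_rel :: "(nat \<times> nat \<times> rat \<Rightarrow> bool) \<Rightarrow> real \<Rightarrow> (nat \<times> nat) set" where
  "code_rel c t = {(a, b). 1 \<le> a \<and> 1 \<le> b \<and> (\<exists>q. t < \<bar>of_rat q\<bar> \<and> c (a, b, q))}"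

definition path_of_code :: "(nat \<times> nat \<times> rat \<Rightarrow> bool) \<Rightarrow> real \<Rightarrow> nat set set" where
  "path_of_code c t = {1..} // code_rel c t"

text \<open>
  The codes of paths of partitions. The last two conditions express right-continuity and that
  all labels start in one block. These are countably many conditions, so the set of good codes
  is measurable.
\<close>

definition good_code :: "(nat \<times> nat \<times> rat \<Rightarrow> bool) \<Rightarrow> bool" where
  "good_code c \<longleftrightarrow>
    (\<forall>a b q. c (a, b, q) \<longrightarrow> 1 \<le> a \<and> 1 \<le> b) \<and>
    (\<forall>a q. 1 \<le> a \<longrightarrow> c (a, a, q)) \<and>
    (\<forall>a b q. c (a, b, q) \<longrightarrow> c (b, a, q)) \<and>
    (\<forall>a b d q. c (a, b, q) \<and> c (b, d, q) \<longrightarrow> c (a, d, q)) \<and>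
    (\<forall>a b q q'. \<bar>q\<bar> \<le> \<bar>q'\<bar> \<and> c (a, b, q') \<longrightarrow> c (a, b, q)) \<and>
    (\<forall>a b q. c (a, b, q) \<longrightarrow> (\<exists>q'. \<bar>q\<bar> < \<bar>q'\<bar> \<and> c (a, b, q'))) \<and>
    (\<forall>a b. 1 \<le> a \<and> 1 \<le> b \<longrightarrow> c (a, b, 0))"

lemma measurable_good_code [measurable]: "Measurable.pred bool_arrays good_code"
  unfolding good_code_def[abs_def] by measurable

lemma joined_quotient_iff:
  assumes r: "equiv {1..} r" and p: "p t = {1..} // r"
  shows "joined p a b t \<longleftrightarrow> (a, b) \<in> r"
proof
  assume "joined p a b t"
  then obtain B where B: "B \<in> {1..} // r" "a \<in> B" "b \<in> B" by (auto simp: joined_def p)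
  then show "(a, b) \<in> r" using in_quotient_imp_in_rel[OF r B(1)] by simp
next
  assume ab: "(a, b) \<in> r"
  then have "a \<in> {1..}" using r by (auto simp: equiv_def refl_on_def)
  moreover from this have "(a, a) \<in> r" using r by (auto simp: equiv_def refl_on_def)
  ultimately show "joined p a b t"
    unfolding joined_def p using ab by (intro bexI[of _ "r `` {a}"] quotientI) auto
qed

context
  fixes c
  assumes good: "good_code c"
begin

lemma good_pos: "c (a, b, q) \<Longrightarrow> 1 \<le> a \<and> 1 \<le> b"
  by (rule good[unfolded good_code_def, THEN conjunct1, rule_format])

lemma good_refl: "1 \<le> a \<Longrightarrow> c (a, a, q)"
  by (rule good[unfolded good_code_def, THEN conjunct2, THEN conjunct1, rule_format])

lemma good_sym: "c (a, b, q) \<Longrightarrow> c (b, a, q)"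
  by (rule good[unfolded good_code_def, THEN conjunct2, THEN conjunct2, THEN conjunct1, rule_format])

lemma good_trans: "c (a, b, q) \<Longrightarrow> c (b, d, q) \<Longrightarrow> c (a, d, q)"
  by (rule good[unfolded good_code_def, THEN conjunct2, THEN conjunct2, THEN conjunct2, THEN conjunct1, rule_format]) (rule conjI)

lemma good_mono: "\<bar>q\<bar> \<le> \<bar>q'\<bar> \<Longrightarrow> c (a, b, q') \<Longrightarrow> c (a, b, q)"
  by (rule good[unfolded good_code_def, THEN conjunct2, THEN conjunct2, THEN conjunct2, THEN conjunct2, THEN conjunct1, rule_format]) (rule conjI)

lemma good_right: "c (a, b, q) \<Longrightarrow> \<exists>q'. \<bar>q\<bar> < \<bar>q'\<bar> \<and> c (a, b, q')"
  by (rule good[unfolded good_code_def, THEN conjunct2, THEN conjunct2, THEN conjunct2, THEN conjunct2, THEN conjunct2, THEN conjunct1, rule_format])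

lemma good_start: "1 \<le> a \<Longrightarrow> 1 \<le> b \<Longrightarrow> c (a, b, 0)"
  by (rule good[unfolded good_code_def, THEN conjunct2, THEN conjunct2, THEN conjunct2, THEN conjunct2, THEN conjunct2, THEN conjunct2, rule_format]) (rule conjI)

lemma equiv_code_rel: "equiv {1..} (code_rel c t)"
proof (rule equivI)
  show "code_rel c t \<subseteq> {1..} \<times> {1..}" by (auto simp: code_rel_def)
  show "refl_on {1..} (code_rel c t)"
  proof (rule refl_onI)
    fix a :: nat assume "a \<in> {1..}"
    moreover obtain q :: rat where "\<bar>t\<bar> < of_rat q" using of_rat_dense[of "\<bar>t\<bar>" "\<bar>t\<bar> + 1"] by auto
    moreover from this have "t < \<bar>of_rat q\<bar>" by linarith
    ultimately show "(a, a) \<in> code_rel c t" using good_refl by (auto simp: code_rel_def)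
  qed
  show "sym (code_rel c t)" by (rule symI) (auto simp: code_rel_def dest: good_sym)
  show "trans (code_rel c t)"
  proof (rule transI)
    fix a b d assume "(a, b) \<in> code_rel c t" "(b, d) \<in> code_rel c t"
    then obtain q q' where q: "1 \<le> a" "1 \<le> d" "t < \<bar>of_rat q\<bar>" "c (a, b, q)" "t < \<bar>of_rat q'\<bar>" "c (b, d, q')"
      by (auto simp: code_rel_def)
    show "(a, d) \<in> code_rel c t"
    proof (cases "\<bar>q\<bar> \<le> \<bar>q'\<bar>")
      case True
      then have "c (a, d, q)" using good_trans[OF q(4)] good_mono[OF True q(6)] by blast
      with q show ?thesis by (auto simp: code_rel_def)
    next
      case False
      then have "\<bar>q'\<bar> \<le> \<bar>q\<bar>" by simp
      then have "c (a, d, q')" using good_trans[OF good_mono q(6)] q(4) by blast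
      with q show ?thesis by (auto simp: code_rel_def)
    qed
  qed
qed

lemma joined_path_of_code: "joined (path_of_code c) a b t \<longleftrightarrow> (a, b) \<in> code_rel c t"
  by (rule joined_quotient_iff[OF equiv_code_rel]) (simp add: path_of_code_def)

lemma fragmentation_path_of_code: "fragmentation_path (path_of_code c)"
proof
  show part: "partition_on {1..} (path_of_code c t)" if "0 \<le> t" for t
    unfolding path_of_code_def by (rule partition_on_quotient[OF equiv_code_rel])
  have mono: "code_rel c t \<subseteq> code_rel c s" if "s \<le> t" for s t
    unfolding code_rel_def using that by (auto intro: order_le_less_trans)
  show "path_of_code c 0 = {{1..}}"
  proof -
    have "(a, b) \<in> code_rel c 0" if ab: "1 \<le> a" "1 \<le> b" for a b
    proof -
      obtain q' where q': "\<bar>0\<bar> < \<bar>q'\<bar>" "c (a, b, q')" using good_right[OF good_start[OF ab]] by blast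
      then have "(0::real) < \<bar>of_rat q'\<bar>" by simp
      with q' ab show ?thesis by (auto simp: code_rel_def)
    qed
    then have rel: "code_rel c 0 = {1..} \<times> {1..}"
      by (auto simp: code_rel_def)
    have "code_rel c 0 `` {a} = {1..}" if "a \<in> {1..}" for a unfolding rel using that by auto
    then show ?thesis unfolding path_of_code_def quotient_def by force
  qed
  show "refines {1..} (path_of_code c t) (path_of_code c s)" if st: "0 \<le> s" "s \<le> t" for s t
    unfolding refines_def
  proof (intro conjI ballI)
    show "partition_on {1..} (path_of_code c t)" "partition_on {1..} (path_of_code c s)" using part st by auto
    fix B assume "B \<in> path_of_code c t"
    then obtain a where a: "a \<in> {1..}" "B = code_rel c t `` {a}"
      unfolding path_of_code_def by (elim quotientE)
    have "B \<subseteq> code_rel c s `` {a}" unfolding a(2) using mono[OF st(2)] by (rule Image_mono) simp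
    moreover have "code_rel c s `` {a} \<in> path_of_code c s"
      unfolding path_of_code_def by (rule quotientI[OF a(1)])
    ultimately show "\<exists>C\<in>path_of_code c s. B \<subseteq> C" by blast
  qed
  show "eventually (\<lambda>s. restr {1..n} (path_of_code c s) = restr {1..n} (path_of_code c t)) (at_right t)"
    if t: "0 \<le> t" for t n
  proof -
    let ?X = "{1..n} \<times> {1..n}"
    have "eventually (\<lambda>s. \<forall>z\<in>?X. z \<in> code_rel c s \<longleftrightarrow> z \<in> code_rel c t) (at_right t)"
    proof (rule eventually_ball_finite)
      show "\<forall>z\<in>?X. eventually (\<lambda>s. z \<in> code_rel c s \<longleftrightarrow> z \<in> code_rel c t) (at_right t)"
      proof
        fix z assume "z \<in> ?X"
        obtain a b where z: "z = (a, b)" by (cases z)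
        show "eventually (\<lambda>s. z \<in> code_rel c s \<longleftrightarrow> z \<in> code_rel c t) (at_right t)"
        proof (cases "z \<in> code_rel c t")
          case True
          then obtain q where q: "1 \<le> a" "1 \<le> b" "t < \<bar>of_rat q\<bar>" "c (a, b, q)" by (auto simp: z code_rel_def)
          have "eventually (\<lambda>s. s \<in> {t<..<\<bar>of_rat q\<bar>}) (at_right t)"
            by (rule eventually_at_right_real[OF q(3)])
          then show ?thesis
          proof eventually_elim
            case (elim s)
            then have "s < \<bar>of_rat q\<bar>" by simp
            then have "z \<in> code_rel c s" using q unfolding z code_rel_def by blast
            with True show ?case by simp
          qed
        next
          case False
          have "eventually (\<lambda>s. t < s) (at_right t)" by (rule eventually_at_right_less)
          then show ?thesis
          proof eventually_elim
            case (elim s)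
            then show ?case using False mono[of t s] by auto
          qed
        qed
      qed
    qed simp
    moreover have "eventually (\<lambda>s. t < s) (at_right t)" by (rule eventually_at_right_less)
    ultimately show ?thesis
    proof eventually_elim
      case (elim s)
      have "{(a, b). a \<in> {1..n} \<and> b \<in> {1..n} \<and> (a, b) \<in> code_rel c s} =
          {(a, b). a \<in> {1..n} \<and> b \<in> {1..n} \<and> (a, b) \<in> code_rel c t}"
        using elim(1) by auto
      moreover have "restr {1..n} (path_of_code c u) = {1..n} // {(a, b). a \<in> {1..n} \<and> b \<in> {1..n} \<and> (a, b) \<in> code_rel c u}"
        if "0 \<le> u" for u
        unfolding restr_eq_quotient[OF part[OF that]] joined_path_of_code[symmetric] joined_def ..
      ultimately show ?case using t elim(2) by simp
    qed
  qed
qed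

lemma path_code_of_code: "path_code (path_of_code c) = c"
proof (rule ext)
  fix i :: "nat \<times> nat \<times> rat"
  obtain a b q where i: "i = (a, b, q)" by (cases i) auto
  have "path_code (path_of_code c) i \<longleftrightarrow> (a, b) \<in> code_rel c \<bar>of_rat q\<bar>"
    by (simp add: i path_code_def joined_path_of_code)
  also have "\<dots> \<longleftrightarrow> c (a, b, q)"
  proof
    assume "(a, b) \<in> code_rel c \<bar>of_rat q\<bar>"
    then obtain q' where q': "\<bar>of_rat q\<bar> < \<bar>of_rat q' :: real\<bar>" "c (a, b, q')" by (auto simp: code_rel_def)
    then have "\<bar>q\<bar> \<le> \<bar>q'\<bar>" by (simp add: of_rat_less)
    then show "c (a, b, q)" using good_mono q'(2) by blast
  next
    assume ab: "c (a, b, q)"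
    then obtain q' where q': "\<bar>q\<bar> < \<bar>q'\<bar>" "c (a, b, q')" using good_right by blast
    then have "\<bar>of_rat q\<bar> < \<bar>of_rat q' :: real\<bar>" by (simp add: of_rat_less)
    then show "(a, b) \<in> code_rel c \<bar>of_rat q\<bar>" using q'(2) good_pos[OF ab] unfolding code_rel_def by blast
  qed
  finally show "path_code (path_of_code c) i = c i" by (simp add: i)
qed

end

lemma (in fragmentation_path) good_code_path_code: "good_code (path_code p)"
proof -
  have j: "path_code p (a, b, q) \<longleftrightarrow> joined p a b \<bar>of_rat q\<bar>" for a b q by (simp add: path_code_def)
  have abs: "0 \<le> \<bar>of_rat q :: real\<bar>" for q by simp
  show ?thesis
    unfolding good_code_def
  proof (intro conjI allI impI)
    fix a b d :: nat and q q' :: rat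
    show "1 \<le> a" "1 \<le> b" if "path_code p (a, b, q)"
      using joined_pos[OF abs] that unfolding j by blast+
    show "path_code p (a, a, q)" if "1 \<le> a"
      using partition_onD1[OF partition[OF abs]] that unfolding j joined_def by auto
    show "path_code p (b, a, q)" if "path_code p (a, b, q)"
      using that unfolding j joined_def by (simp add: insert_commute)
    show "path_code p (a, d, q)" if abd: "path_code p (a, b, q) \<and> path_code p (b, d, q)"
    proof -
      obtain B D where BD: "B \<in> p \<bar>of_rat q\<bar>" "{a, b} \<subseteq> B" "D \<in> p \<bar>of_rat q\<bar>" "{b, d} \<subseteq> D"
        using abd unfolding j joined_def by auto
      then have "B = D" using partition_onD2[OF partition[OF abs[of q]]] by (auto simp: disjoint_def)
      with BD show ?thesis unfolding j joined_def by auto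
    qed
    show "path_code p (a, b, q)" if "\<bar>q\<bar> \<le> \<bar>q'\<bar> \<and> path_code p (a, b, q')"
    proof -
      have "\<bar>of_rat q\<bar> \<le> \<bar>of_rat q' :: real\<bar>" using that by (simp add: of_rat_less_eq)
      then show ?thesis using that joined_antimono[OF abs] unfolding j by blast
    qed
    show "\<exists>q'. \<bar>q\<bar> < \<bar>q'\<bar> \<and> path_code p (a, b, q')" if ab: "path_code p (a, b, q)"
    proof -
      obtain q' where "\<bar>of_rat q\<bar> < \<bar>of_rat q' :: real\<bar>" "path_code p (a, b, q')"
        using joined_iff_code[OF abs[of q], of a b] ab unfolding j by blast
      then show ?thesis by (intro exI[of _ q']) (simp add: of_rat_less)
    qed
    show "path_code p (a, b, 0)" if "1 \<le> a \<and> 1 \<le> b"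
      using that one_block by (auto simp: path_code_def joined_def)
  qed
qed

text \<open>
  Puts the generators of the past into the form of preimages of sets of codes.
\<close>

lemma indexed_events_cong:
  fixes g :: "nat \<Rightarrow> real \<Rightarrow> 'r \<Rightarrow> 'c set"
  assumes "\<And>u m \<rho>. 0 \<le> u \<Longrightarrow> f m u \<rho> = X -` g m u \<rho> \<inter> \<Omega>"
  shows "{f m u \<rho> |m u \<rho>. 0 \<le> u \<and> u \<le> s} = {X -` A \<inter> \<Omega> |A. A \<in> {g m u \<rho> |m u \<rho>. 0 \<le> u \<and> u \<le> s}}"
proof (intro equalityI subsetI)
  fix B assume "B \<in> {f m u \<rho> |m u \<rho>. 0 \<le> u \<and> u \<le> s}"
  then obtain m u \<rho> where "B = f m u \<rho>" "0 \<le> u" "u \<le> s" by blast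
  with assms[of u m \<rho>] show "B \<in> {X -` A \<inter> \<Omega> |A. A \<in> {g m u \<rho> |m u \<rho>. 0 \<le> u \<and> u \<le> s}}" by blast
next
  fix B assume "B \<in> {X -` A \<inter> \<Omega> |A. A \<in> {g m u \<rho> |m u \<rho>. 0 \<le> u \<and> u \<le> s}}"
  then obtain m u \<rho> where "B = X -` g m u \<rho> \<inter> \<Omega>" "0 \<le> u" "u \<le> s" by blast
  with assms[of u m \<rho>] show "B \<in> {f m u \<rho> |m u \<rho>. 0 \<le> u \<and> u \<le> s}" by blast
qed

text \<open>
  Being a fragmentation is a property of the law of the code together with the regularity of all
  paths: every event in the axioms, in particular every event of the past, is the preimage of a
  set of codes.
\<close>

lemma fragmentation_transport:
  assumes N: "beta_fragmentation N \<beta> P" and Q: "prob_space Q"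
    and path: "\<And>\<omega>. \<omega> \<in> space Q \<Longrightarrow> fragmentation_path (\<lambda>t. P' t \<omega>)"
    and meas: "(\<lambda>\<omega>. path_code (\<lambda>t. P' t \<omega>)) \<in> measurable Q bool_arrays"
    and law: "distr Q bool_arrays (\<lambda>\<omega>. path_code (\<lambda>t. P' t \<omega>)) = distr N bool_arrays (beta_fragmentation.code P)"
  shows "homogeneous_fragmentation Q (nu \<beta>) P'"
proof -
  interpret N: beta_fragmentation N \<beta> P by fact
  interpret Q: prob_space Q by fact
  let ?c = "\<lambda>\<omega>. path_code (\<lambda>t. P' t \<omega>)"
  have restrN: "restr {1..n} (P t \<omega>) = restr_of_code n t (N.code \<omega>)" if "\<omega> \<in> space N" "0 \<le> t" for n t \<omega>
    unfolding N.code_def by (rule fragmentation_path.restr_path[OF N.fragmentation_path[OF that(1)] that(2)])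
  have restrQ: "restr {1..n} (P' t \<omega>) = restr_of_code n t (?c \<omega>)" if "\<omega> \<in> space Q" "0 \<le> t" for n t \<omega>
    by (rule fragmentation_path.restr_path[OF path[OF that(1)] that(2)])
  have S: "{x. U (restr_of_code n t x)} \<in> sets bool_arrays" for n t U
    using measurable_sets[OF measurable_restr_of_code[of n t], of "Collect U"] by (simp add: vimage_def)
  have pr: "Q.prob {\<omega> \<in> space Q. ?c \<omega> \<in> D} = N.prob {\<omega> \<in> space N. N.code \<omega> \<in> D}" if "D \<in> sets bool_arrays" for D
  proof -
    have "Q.prob {\<omega> \<in> space Q. ?c \<omega> \<in> D} = measure (distr Q bool_arrays ?c) D"
      using that meas by (simp add: measure_distr vimage_def Int_def conj_commute)
    also have "\<dots> = N.prob {\<omega> \<in> space N. N.code \<omega> \<in> D}"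
      unfolding law using that N.measurable_code by (simp add: measure_distr vimage_def Int_def conj_commute)
    finally show ?thesis .
  qed
  have event: "Q.prob {\<omega> \<in> space Q. U (restr {1..n} (P' t \<omega>))} = N.prob {\<omega> \<in> space N. U (restr {1..n} (P t \<omega>))}"
    if "0 \<le> t" for U n t
  proof -
    have "{\<omega> \<in> space Q. U (restr {1..n} (P' t \<omega>))} = {\<omega> \<in> space Q. ?c \<omega> \<in> {x. U (restr_of_code n t x)}}"
      using restrQ that by auto
    moreover have "{\<omega> \<in> space N. U (restr {1..n} (P t \<omega>))} = {\<omega> \<in> space N. N.code \<omega> \<in> {x. U (restr_of_code n t x)}}"
      using restrN that by auto
    ultimately show ?thesis using pr[OF S[of U n t]] by simp
  qed
  show ?thesis
  proof (intro homogeneous_fragmentation.intro homogeneous_fragmentation_axioms.intro)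
    show "prob_space Q" by fact
    show "partition_on {1..} (P' t \<omega>)" if "\<omega> \<in> space Q" "0 \<le> t" for \<omega> t
      by (rule fragmentation_path.partition[OF path[OF that(1)] that(2)])
    show "(\<lambda>\<omega>. restr {1..n} (P' t \<omega>)) \<in> measurable Q (count_space UNIV)" if "0 \<le> t" for t n
      using measurable_compose[OF meas measurable_restr_of_code[of n t]] restrQ[OF _ that]
      by (simp cong: measurable_cong)
    show "P' 0 \<omega> = {{1..}}" if "\<omega> \<in> space Q" for \<omega>
      by (rule fragmentation_path.one_block[OF path[OF that]])
    show "refines {1..} (P' t \<omega>) (P' s \<omega>)" if "\<omega> \<in> space Q" "0 \<le> s" "s \<le> t" for \<omega> s t
      by (rule fragmentation_path.refining[OF path[OF that(1)] that(2,3)])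
    show "eventually (\<lambda>s. restr {1..n} (P' s \<omega>) = restr {1..n} (P' t \<omega>)) (at_right t)" if "\<omega> \<in> space Q" "0 \<le> t" for \<omega> t n
      by (rule fragmentation_path.right_continuous[OF path[OF that(1)] that(2)])
    show "Q.prob {\<omega> \<in> space Q. restr {1..n} (P' t \<omega>) = (`) p ` \<pi>} = Q.prob {\<omega> \<in> space Q. restr {1..n} (P' t \<omega>) = \<pi>}"
      if "0 \<le> t" "p permutes {1..n}" for t p n \<pi>
      using N.exchangeable[OF that, of \<pi>] event[OF that(1), of "\<lambda>x. x = (`) p ` \<pi>" n] event[OF that(1), of "\<lambda>x. x = \<pi>" n] by simp
    show "((\<lambda>t. Q.prob {\<omega> \<in> space Q. restr {1..n} (P' t \<omega>) = \<pi>} / t) \<longlongrightarrow> (LINT x|nu \<beta>. pmf (paintbox x n) \<pi>)) (at_right 0)"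
      if "2 \<le> n" "partition_on {1..n} \<pi>" "\<pi> \<noteq> {{1..n}}" for n \<pi>
    proof (rule Lim_transform_eventually[OF N.dislocation[OF that]])
      show "eventually (\<lambda>t. N.prob {\<omega> \<in> space N. restr {1..n} (P t \<omega>) = \<pi>} / t =
          Q.prob {\<omega> \<in> space Q. restr {1..n} (P' t \<omega>) = \<pi>} / t) (at_right 0)"
        using eventually_at_right_less[of 0]
        by eventually_elim (use event[of _ "\<lambda>x. x = \<pi>" n] in simp)
    qed
    fix s t :: real and n :: nat and \<pi> \<sigma> :: "nat set set" and H
    assume st: "0 \<le> s" "0 \<le> t" and \<pi>: "partition_on {1..n} \<pi>" and \<sigma>: "partition_on {1..n} \<sigma>"
      and H: "H \<in> sigma_sets (space Q) {{\<omega> \<in> space Q. restr {1..m} (P' u \<omega>) = \<rho>} |m u \<rho>. 0 \<le> u \<and> u \<le> s}"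
    let ?GN = "{{\<omega> \<in> space N. restr {1..m} (P u \<omega>) = \<rho>} |m u \<rho>. 0 \<le> u \<and> u \<le> s}"
    let ?GQ = "{{\<omega> \<in> space Q. restr {1..m} (P' u \<omega>) = \<rho>} |m u \<rho>. 0 \<le> u \<and> u \<le> s}"
    let ?K = "{{x. restr_of_code m u x = \<rho>} |m u \<rho>. 0 \<le> u \<and> u \<le> s}"
    have GQ: "?GQ = {?c -` A \<inter> space Q |A. A \<in> ?K}"
    proof -
      have "{\<omega> \<in> space Q. restr {1..m} (P' u \<omega>) = \<rho>} = ?c -` {x. restr_of_code m u x = \<rho>} \<inter> space Q"
        if "0 \<le> u" for m u \<rho> using restrQ[OF _ that] by auto
      then show ?thesis by (rule indexed_events_cong)
    qed
    have GN: "?GN = {N.code -` A \<inter> space N |A. A \<in> ?K}"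
    proof -
      have "{\<omega> \<in> space N. restr {1..m} (P u \<omega>) = \<rho>} = N.code -` {x. restr_of_code m u x = \<rho>} \<inter> space N"
        if "0 \<le> u" for m u \<rho> using restrN[OF _ that] by auto
      then show ?thesis by (rule indexed_events_cong)
    qed
    have "H \<in> {?c -` A \<inter> space Q |A. A \<in> sigma_sets UNIV ?K}"
      using H unfolding GQ by (subst sigma_sets_vimage_commute) auto
    then obtain D where D': "D \<in> sigma_sets UNIV ?K" "H = ?c -` D \<inter> space Q" by blast
    have "N.code -` D \<inter> space N \<in> {N.code -` A \<inter> space N |A. A \<in> sigma_sets UNIV ?K}"
      using D'(1) by blast
    also have "\<dots> = sigma_sets (space N) ?GN"
      unfolding GN by (rule sigma_sets_vimage_commute) simp
    finally have DN: "N.code -` D \<inter> space N \<in> sigma_sets (space N) ?GN" .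
    have "sigma_sets UNIV ?K \<subseteq> sets bool_arrays"
    proof -
      have "?K \<subseteq> sets bool_arrays"
        using S[of "\<lambda>x. x = \<rho>" m u for m u \<rho>] by blast
      from sets.sigma_sets_subset[OF this] show ?thesis by simp
    qed
    then have D: "D \<in> sets bool_arrays" "H = {\<omega> \<in> space Q. ?c \<omega> \<in> D}"
      "{\<omega> \<in> space N. N.code \<omega> \<in> D} \<in> sigma_sets (space N) ?GN"
      using D' DN by (auto simp: vimage_def Int_def conj_commute)
    let ?HN = "{\<omega> \<in> space N. N.code \<omega> \<in> D}"
    have st': "0 \<le> s + t" using st by simp
    let ?D1 = "D \<inter> {x. restr_of_code n s x = \<pi>}"
    let ?D2 = "?D1 \<inter> {x. restr_of_code n (s + t) x = \<sigma>}"
    have D12: "?D1 \<in> sets bool_arrays" "?D2 \<in> sets bool_arrays"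
      using D(1) S[of "\<lambda>x. x = \<pi>" n s] S[of "\<lambda>x. x = \<sigma>" n "s + t"] by auto
    have "{\<omega> \<in> H. restr {1..n} (P' s \<omega>) = \<pi> \<and> restr {1..n} (P' (s + t) \<omega>) = \<sigma>} = {\<omega> \<in> space Q. ?c \<omega> \<in> ?D2}"
      unfolding D(2) using restrQ[OF _ st(1), of _ n] restrQ[OF _ st', of _ n] by auto
    moreover have "{\<omega> \<in> ?HN. restr {1..n} (P s \<omega>) = \<pi> \<and> restr {1..n} (P (s + t) \<omega>) = \<sigma>} = {\<omega> \<in> space N. N.code \<omega> \<in> ?D2}"
      using restrN[OF _ st(1), of _ n] restrN[OF _ st', of _ n] by auto
    moreover have "{\<omega> \<in> H. restr {1..n} (P' s \<omega>) = \<pi>} = {\<omega> \<in> space Q. ?c \<omega> \<in> ?D1}"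
      unfolding D(2) using restrQ[OF _ st(1), of _ n] by auto
    moreover have "{\<omega> \<in> ?HN. restr {1..n} (P s \<omega>) = \<pi>} = {\<omega> \<in> space N. N.code \<omega> \<in> ?D1}"
      using restrN[OF _ st(1), of _ n] by auto
    moreover have "(\<Prod>B\<in>\<pi>. Q.prob {\<omega> \<in> space Q. restr B (P' t \<omega>) = restr B \<sigma>}) =
        (\<Prod>B\<in>\<pi>. N.prob {\<omega> \<in> space N. restr B (P t \<omega>) = restr B \<sigma>})"
    proof (rule prod.cong[OF refl])
      fix B assume "B \<in> \<pi>"
      then have B: "B \<subseteq> {1..n}" using partition_onD1[OF \<pi>] by auto
      show "Q.prob {\<omega> \<in> space Q. restr B (P' t \<omega>) = restr B \<sigma>} = N.prob {\<omega> \<in> space N. restr B (P t \<omega>) = restr B \<sigma>}"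
        using event[OF st(2), of "\<lambda>x. restr B x = restr B \<sigma>" n] by (simp only: restr_restr[OF B])
    qed
    moreover note N.branching[OF st \<pi> \<sigma> D(3)]
    ultimately show "Q.prob {\<omega> \<in> H. restr {1..n} (P' s \<omega>) = \<pi> \<and> restr {1..n} (P' (s + t) \<omega>) = \<sigma>} =
       Q.prob {\<omega> \<in> H. restr {1..n} (P' s \<omega>) = \<pi>} *
         (if refines {1..n} \<sigma> \<pi>
          then \<Prod>B\<in>\<pi>. Q.prob {\<omega> \<in> space Q. restr B (P' t \<omega>) = restr B \<sigma>}
          else 0)"
      using pr[OF D12(1)] pr[OF D12(2)] by simp
  qed
qed

section \<open>The coupling\<close>

text \<open>
  The image of a measure under \<open>T\<close>, with the range of \<open>T\<close> as space and the largest \<open>\<sigma>\<close>-algebra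
  for which \<open>T\<close> is measurable. Properties that hold at every point, such as regularity of paths,
  are inherited by every point of this space, and measurability can be checked before the map is
  applied.
\<close>

definition image_measure :: "'a measure \<Rightarrow> ('a \<Rightarrow> 'b) \<Rightarrow> 'b measure" where
  "image_measure A T = distr A (sigma (T ` space A) {B. B \<subseteq> T ` space A \<and> T -` B \<inter> space A \<in> sets A}) T"

lemma space_image_measure: "space (image_measure A T) = T ` space A"
  unfolding image_measure_def by (simp add: space_measure_of_conv)

lemma sets_image_measure:
  fixes A :: "'a measure" and T :: "'a \<Rightarrow> 'b"
  shows "sets (image_measure A T) = {B. B \<subseteq> T ` space A \<and> T -` B \<inter> space A \<in> sets A}"
proof -
  let ?G = "{B. B \<subseteq> T ` space A \<and> T -` B \<inter> space A \<in> sets A}"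
  have "sigma_algebra (T ` space A) ?G"
  proof (rule sigma_algebra_iff2[THEN iffD2], intro conjI ballI allI impI)
    show "?G \<subseteq> Pow (T ` space A)" by auto
    show "{} \<in> ?G" by simp
    fix B assume "B \<in> ?G"
    moreover have "T -` (T ` space A - B) \<inter> space A = space A - (T -` B \<inter> space A)" by auto
    ultimately show "T ` space A - B \<in> ?G" by (auto intro: sets.compl_sets)
  next
    fix B :: "nat \<Rightarrow> 'b set" assume "range B \<subseteq> ?G"
    then have B: "B i \<subseteq> T ` space A" "T -` B i \<inter> space A \<in> sets A" for i by auto
    have "T -` (\<Union>i. B i) \<inter> space A = (\<Union>i. T -` B i \<inter> space A)" by auto
    also have "\<dots> \<in> sets A" using B(2) by (intro sets.countable_nat_UN) blast
    finally show "(\<Union>i. B i) \<in> ?G" using B(1) by auto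
  qed
  then have "sigma_sets (T ` space A) ?G = ?G" by (rule sigma_algebra.sigma_sets_eq)
  moreover have "?G \<subseteq> Pow (T ` space A)" by auto
  ultimately show ?thesis unfolding image_measure_def by (simp add: sets_measure_of)
qed

lemma measurable_image_measure: "T \<in> measurable A (image_measure A T)"
  by (rule measurableI) (auto simp: space_image_measure sets_image_measure)

lemma image_measure_distr: "image_measure A T = distr A (image_measure A T) T"
proof -
  have "sets (image_measure A T) = sets (sigma (T ` space A) {B. B \<subseteq> T ` space A \<and> T -` B \<inter> space A \<in> sets A})"
    unfolding image_measure_def by simp
  then have "distr A (sigma (T ` space A) {B. B \<subseteq> T ` space A \<and> T -` B \<inter> space A \<in> sets A}) T = distr A (image_measure A T) T"
    by (intro distr_cong) simp_all
  then show ?thesis by (simp only: image_measure_def[symmetric])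
qed

lemma measurable_from_image_measure:
  assumes "(\<lambda>z. f (T z)) \<in> measurable A R"
  shows "f \<in> measurable (image_measure A T) R"
proof (rule measurableI)
  show "f w \<in> space R" if "w \<in> space (image_measure A T)" for w
    using that measurable_space[OF assms] by (auto simp: space_image_measure)
  fix B assume "B \<in> sets R"
  from measurable_sets[OF assms this]
  have "T -` (f -` B \<inter> T ` space A) \<inter> space A \<in> sets A"
    by (rule back_subst[of "\<lambda>C. C \<in> sets A"]) auto
  then show "f -` B \<inter> space (image_measure A T) \<in> sets (image_measure A T)"
    by (simp add: space_image_measure sets_image_measure)
qed

lemma distr_image_measure:
  assumes "(\<lambda>z. f (T z)) \<in> measurable A R"
  shows "distr (image_measure A T) R f = distr A R (\<lambda>z. f (T z))"
  by (subst image_measure_distr)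
     (simp add: distr_distr[OF measurable_from_image_measure[of f T A R, OF assms] measurable_image_measure] comp_def)

lemma prob_space_image_measure: "prob_space A \<Longrightarrow> prob_space (image_measure A T)"
  by (subst image_measure_distr) (rule prob_space.prob_space_distr[OF _ measurable_image_measure])

definition joint_path :: "(real \<Rightarrow> 'a \<Rightarrow> real) \<Rightarrow> (nat \<Rightarrow> 'a \<Rightarrow> real) \<Rightarrow> 'a \<Rightarrow> (real \<Rightarrow> real) \<times> (nat \<Rightarrow> real)" where
  "joint_path \<xi> E \<omega> = (\<lambda>t\<in>{0..}. \<xi> t \<omega>, \<lambda>j\<in>{1..}. E j \<omega>)"

text \<open>
  Independence of functions of a random element depends only on the law of that element.
\<close>

lemma indep_vars_same_law:
  fixes F :: "'i \<Rightarrow> 's \<Rightarrow> real"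
  assumes M: "prob_space M" and Q: "prob_space Q"
    and X: "X \<in> measurable M S" and Y: "Y \<in> measurable Q S" and law: "distr Q S Y = distr M S X"
    and F: "\<And>i. i \<in> I \<Longrightarrow> F i \<in> borel_measurable S"
    and indep: "prob_space.indep_vars M (\<lambda>_. borel) (\<lambda>i \<omega>. F i (X \<omega>)) I"
  shows "prob_space.indep_vars Q (\<lambda>_. borel) (\<lambda>i \<omega>. F i (Y \<omega>)) I"
proof (cases "I = {}")
  case True
  interpret Q: prob_space Q by fact
  show ?thesis unfolding True by (simp add: Q.indep_vars_def Q.indep_sets_def)
next
  case False
  interpret M: prob_space M by fact
  interpret Q: prob_space Q by fact
  have P: "(\<lambda>z. \<lambda>i\<in>I. F i z) \<in> measurable S (\<Pi>\<^sub>M i\<in>I. borel)"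
    using F by (rule measurable_restrict)
  have FX: "(\<lambda>\<omega>. F i (X \<omega>)) \<in> borel_measurable M" and FY: "(\<lambda>\<omega>. F i (Y \<omega>)) \<in> borel_measurable Q" if "i \<in> I" for i
    using measurable_compose[OF X F[OF that]] measurable_compose[OF Y F[OF that]] by auto
  have single: "distr Q borel (\<lambda>\<omega>. F i (Y \<omega>)) = distr M borel (\<lambda>\<omega>. F i (X \<omega>))" if "i \<in> I" for i
    using arg_cong[OF law, of "\<lambda>A. distr A borel (F i)"] X Y F[OF that] by (simp add: distr_distr comp_def)
  have "distr Q (\<Pi>\<^sub>M i\<in>I. borel) (\<lambda>\<omega>. \<lambda>i\<in>I. F i (Y \<omega>)) = distr M (\<Pi>\<^sub>M i\<in>I. borel) (\<lambda>\<omega>. \<lambda>i\<in>I. F i (X \<omega>))"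
    using arg_cong[OF law, of "\<lambda>A. distr A (\<Pi>\<^sub>M i\<in>I. borel) (\<lambda>z. \<lambda>i\<in>I. F i z)"] X Y P by (simp add: distr_distr comp_def)
  also have "\<dots> = (\<Pi>\<^sub>M i\<in>I. distr M borel (\<lambda>\<omega>. F i (X \<omega>)))"
    using M.indep_vars_iff_distr_eq_PiM'[where M' = "\<lambda>_. borel" and X = "\<lambda>i \<omega>. F i (X \<omega>)", OF False FX] indep by blast
  also have "\<dots> = (\<Pi>\<^sub>M i\<in>I. distr Q borel (\<lambda>\<omega>. F i (Y \<omega>)))"
    by (rule PiM_cong[OF refl]) (rule single[symmetric])
  finally show ?thesis
    using Q.indep_vars_iff_distr_eq_PiM'[where M' = "\<lambda>_. borel" and X = "\<lambda>i \<omega>. F i (Y \<omega>)", OF False FY] by blast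
qed

text \<open>
  Being a sampled subordinator is a property of the joint law of path and sample together with
  the regularity of all paths.
\<close>

lemma subordinator_transport:
  assumes M: "sampled_subordinator M \<psi> \<xi> E" and Q: "prob_space Q"
    and path: "\<And>\<omega>. \<omega> \<in> space Q \<Longrightarrow> increasing_path (\<lambda>t. \<xi>' t \<omega>)"
    and meas: "joint_path \<xi>' E' \<in> measurable Q (path_space \<Otimes>\<^sub>M sample_space)"
    and law: "distr Q (path_space \<Otimes>\<^sub>M sample_space) (joint_path \<xi>' E') =
      distr M (path_space \<Otimes>\<^sub>M sample_space) (joint_path \<xi> E)"
  shows "sampled_subordinator Q \<psi> \<xi>' E'"
proof -
  interpret M: sampled_subordinator M \<psi> \<xi> E by fact
  interpret Q: prob_space Q by fact
  let ?S = "path_space \<Otimes>\<^sub>M sample_space"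
  let ?X = "joint_path \<xi> E" and ?Y = "joint_path \<xi>' E'"
  have EM: "E j \<in> borel_measurable M" if "1 \<le> j" for j
    using M.exponential[OF that] by (simp add: distributed_def)
  have X1: "(\<lambda>\<omega>. \<lambda>t\<in>{0..}. \<xi> t \<omega>) \<in> measurable M path_space"
    by (rule measurable_restrict) (auto intro: M.random_variable_xi)
  have X2: "(\<lambda>\<omega>. \<lambda>j\<in>{1..}. E j \<omega>) \<in> measurable M sample_space"
    by (rule measurable_restrict) (auto intro: EM)
  have X: "?X \<in> measurable M ?S"
    unfolding joint_path_def[abs_def] by (rule measurable_Pair[OF X1 X2])
  have Y1: "(\<lambda>\<omega>. \<lambda>t\<in>{0..}. \<xi>' t \<omega>) \<in> measurable Q path_space"
    using measurable_compose[OF meas measurable_fst] by (simp add: joint_path_def)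
  have Y2: "(\<lambda>\<omega>. \<lambda>j\<in>{1..}. E' j \<omega>) \<in> measurable Q sample_space"
    using measurable_compose[OF meas measurable_snd] by (simp add: joint_path_def)
  have c1: "(\<lambda>z. fst z t) \<in> borel_measurable ?S" if "0 \<le> t" for t
    using that by (intro measurable_compose[OF measurable_fst] measurable_component_singleton) auto
  have c2: "(\<lambda>z. snd z j) \<in> borel_measurable ?S" if "1 \<le> j" for j
    using that by (intro measurable_compose[OF measurable_snd] measurable_component_singleton) auto
  have xi: "\<xi> t \<omega> = fst (?X \<omega>) t" "\<xi>' t \<omega>' = fst (?Y \<omega>') t" if "0 \<le> t" for t \<omega> \<omega>'
    using that by (simp_all add: joint_path_def)
  have EE: "E j \<omega> = snd (?X \<omega>) j" "E' j \<omega>' = snd (?Y \<omega>') j" if "1 \<le> j" for j \<omega> \<omega>'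
    using that by (simp_all add: joint_path_def)
  have xi_eta: "\<xi> t = (\<lambda>\<omega>. fst (?X \<omega>) t)" "\<xi>' t = (\<lambda>\<omega>. fst (?Y \<omega>) t)" if "0 \<le> t" for t
    using xi[OF that] by (intro ext; blast)+
  have EE_eta: "E j = (\<lambda>\<omega>. snd (?X \<omega>) j)" "E' j = (\<lambda>\<omega>. snd (?Y \<omega>) j)" if "1 \<le> j" for j
    using EE[OF that] by (intro ext; blast)+
  have same: "distr Q R (\<lambda>\<omega>. f (?Y \<omega>)) = distr M R (\<lambda>\<omega>. f (?X \<omega>))" if f: "f \<in> measurable ?S R" for f R
    using arg_cong[OF law, of "\<lambda>A. distr A R f"] X meas f by (simp add: distr_distr comp_def)
  have xim: "\<xi>' t \<in> borel_measurable Q" if "0 \<le> t" for t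
    unfolding xi_eta(2)[OF that] by (rule measurable_compose[OF meas c1[OF that]])
  have same_xi: "distr Q borel (\<xi>' t) = distr M borel (\<xi> t)" if "0 \<le> t" for t
    unfolding xi_eta[OF that] by (rule same[OF c1[OF that]])
  show ?thesis
  proof (intro sampled_subordinator.intro subordinator.intro subordinator_axioms.intro sampled_subordinator_axioms.intro)
    show "prob_space Q" by fact
    show "\<xi>' t \<in> borel_measurable Q" if "0 \<le> t" for t by (rule xim[OF that])
    show "\<xi>' 0 \<omega> = 0" if "\<omega> \<in> space Q" for \<omega> by (rule increasing_path.path_start[OF path[OF that]])
    show "mono_on {0..} (\<lambda>t. \<xi>' t \<omega>)" if "\<omega> \<in> space Q" for \<omega> by (rule increasing_path.path_mono[OF path[OF that]])
    show "continuous (at_right t) (\<lambda>s. \<xi>' s \<omega>)" if "\<omega> \<in> space Q" "0 \<le> t" for \<omega> t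
      by (rule increasing_path.path_right_cont[OF path[OF that(1)] that(2)])
    show "distr Q borel (\<lambda>\<omega>. \<xi>' (s + t) \<omega> - \<xi>' s \<omega>) = distr Q borel (\<xi>' t)" if st: "0 \<le> s" "0 \<le> t" for s t
    proof -
      have st': "0 \<le> s + t" using st by simp
      have "distr Q borel (\<lambda>\<omega>. \<xi>' (s + t) \<omega> - \<xi>' s \<omega>) = distr M borel (\<lambda>\<omega>. \<xi> (s + t) \<omega> - \<xi> s \<omega>)"
        unfolding xi_eta[OF st'] xi_eta[OF st(1)]
        by (rule same[of "\<lambda>z. fst z (s + t) - fst z s" borel]) (intro borel_measurable_diff c1 st' st)
      then show ?thesis by (simp add: M.stationary_increments[OF st] same_xi[OF st(2)])
    qed
    show "Q.indep_vars (\<lambda>_. borel) (\<lambda>i \<omega>. \<xi>' (\<tau> (Suc i)) \<omega> - \<xi>' (\<tau> i) \<omega>) {..<k}" if \<tau>: "0 \<le> \<tau> 0" "mono \<tau>" for \<tau> :: "nat \<Rightarrow> real" and k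
    proof -
      have \<tau>0: "0 \<le> \<tau> i" for i using monoD[OF \<tau>(2), of 0 i] \<tau>(1) by simp
      have "Q.indep_vars (\<lambda>_. borel) (\<lambda>i \<omega>. fst (?Y \<omega>) (\<tau> (Suc i)) - fst (?Y \<omega>) (\<tau> i)) {..<k}"
      proof (rule indep_vars_same_law[OF M.prob_space_axioms Q X meas law])
        show "(\<lambda>z. fst z (\<tau> (Suc i)) - fst z (\<tau> i)) \<in> borel_measurable ?S" for i
          by (intro borel_measurable_diff c1 \<tau>0)
        show "M.indep_vars (\<lambda>_. borel) (\<lambda>i \<omega>. fst (?X \<omega>) (\<tau> (Suc i)) - fst (?X \<omega>) (\<tau> i)) {..<k}"
          using M.independent_increments[OF \<tau>, of k] by (simp add: xi(1)[OF \<tau>0])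
      qed
      then show ?thesis by (simp add: xi(2)[OF \<tau>0])
    qed
    show "(LINT \<omega>|Q. exp (- (z * of_real (\<xi>' t \<omega>)))) = exp (- (of_real t * \<psi> z))" if tz: "0 \<le> t" "0 \<le> Re z" for t z
    proof -
      have m: "(\<lambda>y. exp (- (z * of_real y))) \<in> borel_measurable (borel :: real measure)" by measurable
      have "(LINT \<omega>|Q. exp (- (z * of_real (\<xi>' t \<omega>)))) = (LINT y|distr Q borel (\<xi>' t). exp (- (z * of_real y)))"
        by (rule integral_distr[symmetric, OF xim[OF tz(1)] m])
      also have "\<dots> = (LINT \<omega>|M. exp (- (z * of_real (\<xi> t \<omega>))))"
        unfolding same_xi[OF tz(1)] by (rule integral_distr[OF M.random_variable_xi[OF tz(1)] m])
      finally show ?thesis using M.laplace_exponent[OF tz] by simp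
    qed
    show "distributed Q lborel (E' j) (exponential_density 1)" if j: "1 \<le> j" for j
    proof -
      have "E' j \<in> borel_measurable Q"
        unfolding EE_eta(2)[OF j] by (rule measurable_compose[OF meas c2[OF j]])
      moreover have "distr Q lborel (E' j) = distr M lborel (E j)"
      proof -
        have "(\<lambda>z. snd z j) \<in> measurable ?S lborel" using c2[OF j] by simp
        then show ?thesis unfolding EE_eta[OF j] by (rule same)
      qed
      ultimately show ?thesis using M.exponential[OF j] by (simp add: distributed_def)
    qed
    show "Q.indep_vars (\<lambda>_. borel) E' {1..}"
    proof -
      have "Q.indep_vars (\<lambda>_. borel) (\<lambda>j \<omega>. snd (?Y \<omega>) j) {1..}"
      proof (rule indep_vars_same_law[OF M.prob_space_axioms Q X meas law])
        show "(\<lambda>z. snd z j) \<in> borel_measurable ?S" if "j \<in> {1..}" for j using that by (intro c2) simp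
        show "M.indep_vars (\<lambda>_. borel) (\<lambda>j \<omega>. snd (?X \<omega>) j) {1..}"
          by (rule M.indep_vars_cong[THEN iffD1, OF refl _ refl M.independent_sample]) (rule EE_eta(1), simp)
      qed
      then show ?thesis
        by (rule Q.indep_vars_cong[THEN iffD1, OF refl _ refl, rotated]) (rule EE_eta(2)[symmetric], simp)
    qed
    have "distr M path_space (\<lambda>\<omega>. \<lambda>t\<in>{0..}. \<xi> t \<omega>) \<Otimes>\<^sub>M distr M sample_space (\<lambda>\<omega>. \<lambda>j\<in>{1..}. E j \<omega>) = distr M ?S ?X"
      using M.sample_indep_xi unfolding M.indep_set_vimage_iff[OF X1 X2] by (simp add: joint_path_def[abs_def])
    moreover have "distr Q path_space (\<lambda>\<omega>. \<lambda>t\<in>{0..}. \<xi>' t \<omega>) = distr M path_space (\<lambda>\<omega>. \<lambda>t\<in>{0..}. \<xi> t \<omega>)"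
      using same[OF measurable_fst] by (simp add: joint_path_def)
    moreover have "distr Q sample_space (\<lambda>\<omega>. \<lambda>j\<in>{1..}. E' j \<omega>) = distr M sample_space (\<lambda>\<omega>. \<lambda>j\<in>{1..}. E j \<omega>)"
      using same[OF measurable_snd] by (simp add: joint_path_def)
    ultimately have "distr Q path_space (\<lambda>\<omega>. \<lambda>t\<in>{0..}. \<xi>' t \<omega>) \<Otimes>\<^sub>M distr Q sample_space (\<lambda>\<omega>. \<lambda>j\<in>{1..}. E' j \<omega>) = distr Q ?S ?Y"
      using law by simp
    then show "Q.indep_set
         (sets (vimage_algebra (space Q) (\<lambda>\<omega>. \<lambda>t\<in>{0..}. \<xi>' t \<omega>) (\<Pi>\<^sub>M t\<in>{0..}. borel)))
         (sets (vimage_algebra (space Q) (\<lambda>\<omega>. \<lambda>j\<in>{1..}. E' j \<omega>) (\<Pi>\<^sub>M j\<in>{1..}. borel)))"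
      unfolding Q.indep_set_vimage_iff[OF Y1 Y2] by (simp add: joint_path_def[abs_def])
  qed
qed

text \<open>
  A random code with the law of the fragmentation whose row for label 1 is the array of living
  sample points. That the row of a code is a function of the code holds for the fragmentation,
  hence it is part of the joint law and carries over almost surely. On the null set where the
  transferred array is not good, some fixed good code replaces it.
\<close>

lemma fragmentation_given_sample:
  assumes M: "beta_sample M \<beta> \<xi> E" and N: "beta_fragmentation N \<beta> P"
  obtains c :: "'a \<times> (nat \<Rightarrow> real) \<Rightarrow> nat \<times> nat \<times> rat \<Rightarrow> bool" where
    "c \<in> measurable (M \<Otimes>\<^sub>M uniforms) bool_arrays"
    "\<And>z. good_code (c z)"
    "distr (M \<Otimes>\<^sub>M uniforms) bool_arrays c = distr N bool_arrays (beta_fragmentation.code P)"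
    "AE z in M \<Otimes>\<^sub>M uniforms. \<forall>k q. beta_sample.survival_array \<xi> E (fst z) (k, q) = c z (1, other_label 1 k, q)"
proof -
  interpret M: beta_sample M \<beta> \<xi> E by fact
  interpret N: beta_fragmentation N \<beta> P by fact
  let ?A = "M \<Otimes>\<^sub>M uniforms"
  let ?B1 = "bool_arrays :: (nat \<times> rat \<Rightarrow> bool) measure" and ?B2 = "bool_arrays :: (nat \<times> nat \<times> rat \<Rightarrow> bool) measure"
  let ?X = "\<lambda>\<omega> k. N.code \<omega> (from_nat k)"
  have Xm: "?X \<in> measurable N bool_arrays"
    by (intro measurable_bool_arrays measurable_compose[OF N.measurable_code measurable_bool_arrays_coord])
  obtain Z where Z: "Z \<in> measurable ?A bool_arrays"
    and lawZ: "distr ?A (?B1 \<Otimes>\<^sub>M bool_arrays) (\<lambda>z. (M.survival_array (fst z), Z z)) =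
      distr N (?B1 \<Otimes>\<^sub>M bool_arrays) (\<lambda>\<omega>. (N.leaf_array 1 \<omega>, ?X \<omega>))"
    using transfer_bool_array[OF M.prob_space_axioms N.prob_space_axioms M.measurable_survival_array
        N.measurable_leaf_array survival_leaf_law[OF M N order_refl] Xm] by blast
  define c' :: "'a \<times> (nat \<Rightarrow> real) \<Rightarrow> nat \<times> nat \<times> rat \<Rightarrow> bool" where "c' z = (\<lambda>i. Z z (to_nat i))" for z
  have c': "c' \<in> measurable ?A ?B2"
    unfolding c'_def by (intro measurable_bool_arrays measurable_compose[OF Z measurable_bool_arrays_coord])
  have Sm: "(\<lambda>z. M.survival_array (fst z)) \<in> measurable ?A ?B1"
    by (rule measurable_compose[OF measurable_fst M.measurable_survival_array])
  have dec: "(\<lambda>w. (fst w, \<lambda>i. snd w (to_nat i))) \<in> measurable (?B1 \<Otimes>\<^sub>M bool_arrays) (?B1 \<Otimes>\<^sub>M ?B2)"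
    by (intro measurable_Pair measurable_fst measurable_bool_arrays measurable_compose[OF measurable_snd measurable_bool_arrays_coord])
  have SZ: "(\<lambda>z. (M.survival_array (fst z), Z z)) \<in> measurable ?A (?B1 \<Otimes>\<^sub>M bool_arrays)"
    by (intro measurable_Pair Sm Z)
  have LX: "(\<lambda>\<omega>. (N.leaf_array 1 \<omega>, ?X \<omega>)) \<in> measurable N (?B1 \<Otimes>\<^sub>M bool_arrays)"
    by (intro measurable_Pair N.measurable_leaf_array Xm)
  have Sc: "(\<lambda>z. (M.survival_array (fst z), c' z)) \<in> measurable ?A (?B1 \<Otimes>\<^sub>M ?B2)"
    by (intro measurable_Pair Sm c')
  have LC: "(\<lambda>\<omega>. (N.leaf_array 1 \<omega>, N.code \<omega>)) \<in> measurable N (?B1 \<Otimes>\<^sub>M ?B2)"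
    by (intro measurable_Pair N.measurable_leaf_array N.measurable_code)
  have law: "distr ?A (?B1 \<Otimes>\<^sub>M ?B2) (\<lambda>z. (M.survival_array (fst z), c' z)) =
      distr N (?B1 \<Otimes>\<^sub>M ?B2) (\<lambda>\<omega>. (N.leaf_array 1 \<omega>, N.code \<omega>))"
    using arg_cong[OF lawZ, of "\<lambda>R. distr R (?B1 \<Otimes>\<^sub>M ?B2) (\<lambda>w. (fst w, \<lambda>i. snd w (to_nat i)))"]
    by (simp only: distr_distr[OF dec SZ] distr_distr[OF dec LX] comp_def c'_def fst_conv snd_conv from_nat_to_nat)
  let ?good = "\<lambda>w. good_code (snd w) \<and> (\<forall>k q. fst w (k, q) = snd w (1, other_label 1 k, q))"
  have goodm: "Measurable.pred (?B1 \<Otimes>\<^sub>M ?B2) ?good"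
  proof -
    have [measurable]: "Measurable.pred (?B1 \<Otimes>\<^sub>M ?B2) (\<lambda>w. good_code (snd w))"
      by (rule measurable_compose[OF measurable_snd measurable_good_code])
    have [measurable]: "Measurable.pred (?B1 \<Otimes>\<^sub>M ?B2) (\<lambda>w. fst w i)" "Measurable.pred (?B1 \<Otimes>\<^sub>M ?B2) (\<lambda>w. snd w i')" for i i'
      by (rule measurable_compose[OF measurable_fst measurable_bool_arrays_coord],
          rule measurable_compose[OF measurable_snd measurable_bool_arrays_coord])
    show ?thesis by measurable
  qed
  have "AE \<omega> in N. ?good (N.leaf_array 1 \<omega>, N.code \<omega>)"
    using fragmentation_path.good_code_path_code[OF N.fragmentation_path]
    by (intro AE_I2) (simp add: N.leaf_array_def N.code_def)
  then have "AE w in distr N (?B1 \<Otimes>\<^sub>M ?B2) (\<lambda>\<omega>. (N.leaf_array 1 \<omega>, N.code \<omega>)). ?good w"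
    using goodm by (subst AE_distr_iff[OF LC]) (auto simp: pred_def)
  then have AEgood: "AE z in ?A. ?good (M.survival_array (fst z), c' z)"
    unfolding law[symmetric] using goodm by (subst (asm) AE_distr_iff[OF Sc]) (auto simp: pred_def)
  obtain \<omega>0 where \<omega>0: "\<omega>0 \<in> space N" using N.not_empty by auto
  define c where "c z = (if good_code (c' z) then c' z else N.code \<omega>0)" for z
  have cm: "c \<in> measurable ?A ?B2"
    unfolding c_def
    using measurable_compose[OF c' measurable_good_code] c' by (intro measurable_If) (auto simp: pred_def)
  have AEc: "AE z in ?A. c z = c' z"
    using AEgood by eventually_elim (simp add: c_def)
  show ?thesis
  proof (rule that[of c])
    show "c \<in> measurable ?A ?B2" by (rule cm)
    show "good_code (c z)" for z
      using fragmentation_path.good_code_path_code[OF N.fragmentation_path[OF \<omega>0]] by (simp add: c_def N.code_def)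
    have "distr ?A ?B2 c = distr ?A ?B2 c'"
      by (rule distr_cong_AE[OF refl refl AEc cm c'])
    also have "\<dots> = distr (distr ?A (?B1 \<Otimes>\<^sub>M ?B2) (\<lambda>z. (M.survival_array (fst z), c' z))) ?B2 snd"
      by (simp only: distr_distr[OF measurable_snd Sc] comp_def snd_conv)
    also have "\<dots> = distr N ?B2 N.code"
      by (simp only: law distr_distr[OF measurable_snd LC] comp_def snd_conv)
    finally show "distr ?A ?B2 c = distr N ?B2 N.code" .
    show "AE z in ?A. \<forall>k q. M.survival_array (fst z) (k, q) = c z (1, other_label 1 k, q)"
      using AEgood AEc by eventually_elim simp
  qed
qed

text \<open>
  The coupling lives on the triples of paths, samples and partition paths that actually occur.
\<close>

lemma gap_height_coupling:
  assumes M: "beta_sample M \<beta> \<xi> E" and N: "beta_fragmentation N \<beta> P"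
  shows "\<exists>(Q :: ((real \<Rightarrow> real) \<times> (nat \<Rightarrow> real) \<times> (real \<Rightarrow> nat set set)) measure) \<xi>' E' P'.
            sampled_subordinator Q (phi \<beta>) \<xi>' E' \<and>
            homogeneous_fragmentation Q (nu \<beta>) P' \<and>
            (AE \<omega> in Q. \<forall>n\<ge>2. occupied_gaps \<xi>' E' (n - 1) \<omega> = discrete_height P' n 1 \<omega>)"
proof -
  interpret M: beta_sample M \<beta> \<xi> E by fact
  interpret N: beta_fragmentation N \<beta> P by fact
  interpret U: prob_space uniforms by (rule prob_space_uniforms)
  interpret MU: pair_prob_space M uniforms ..
  let ?A = "M \<Otimes>\<^sub>M uniforms" and ?S = "path_space \<Otimes>\<^sub>M sample_space"
  obtain c where c: "c \<in> measurable ?A bool_arrays" "\<And>z. good_code (c z)"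
    "distr ?A bool_arrays c = distr N bool_arrays N.code"
    "AE z in ?A. \<forall>k q. M.survival_array (fst z) (k, q) = c z (1, other_label 1 k, q)"
    using fragmentation_given_sample[OF M N] by blast
  define T where "T z = (\<lambda>t. \<xi> t (fst z), \<lambda>j. E j (fst z), path_of_code (c z))" for z
  define Q where "Q = image_measure ?A T"
  define \<xi>' where "\<xi>' t w = fst w t" for t :: real and w :: "(real \<Rightarrow> real) \<times> (nat \<Rightarrow> real) \<times> (real \<Rightarrow> nat set set)"
  define E' where "E' j w = fst (snd w) j" for j :: nat and w :: "(real \<Rightarrow> real) \<times> (nat \<Rightarrow> real) \<times> (real \<Rightarrow> nat set set)"
  define P' where "P' t w = snd (snd w) t" for t :: real and w :: "(real \<Rightarrow> real) \<times> (nat \<Rightarrow> real) \<times> (real \<Rightarrow> nat set set)"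
  have Q: "prob_space Q" unfolding Q_def by (rule prob_space_image_measure) (rule MU.prob_space_axioms)
  have X: "joint_path \<xi> E \<in> measurable M ?S"
    using measurable_Pair[OF M.path_measurable M.sample_measurable]
    by (simp add: joint_path_def[abs_def] M.path_def M.sample_def)
  have jT: "joint_path \<xi>' E' (T z) = joint_path \<xi> E (fst z)" for z
    by (simp add: joint_path_def \<xi>'_def E'_def T_def)
  have jm: "(\<lambda>z. joint_path \<xi>' E' (T z)) \<in> measurable ?A ?S"
    unfolding jT by (rule measurable_compose[OF measurable_fst X])
  have sub: "sampled_subordinator Q (phi \<beta>) \<xi>' E'"
  proof (rule subordinator_transport[OF M.sampled_subordinator_axioms Q])
    show "increasing_path (\<lambda>t. \<xi>' t w)" if w: "w \<in> space Q" for w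
    proof -
      obtain z where "z \<in> space ?A" "w = T z" using w by (auto simp: Q_def space_image_measure)
      then show ?thesis using M.increasing_path[of "fst z"] by (simp add: \<xi>'_def T_def space_pair_measure mem_Times_iff)
    qed
    show "joint_path \<xi>' E' \<in> measurable Q ?S"
      unfolding Q_def by (rule measurable_from_image_measure[of "joint_path \<xi>' E'" T, OF jm])
    have "distr Q ?S (joint_path \<xi>' E') = distr ?A ?S (\<lambda>z. joint_path \<xi> E (fst z))"
      unfolding Q_def distr_image_measure[of "joint_path \<xi>' E'" T, OF jm] by (simp only: jT)
    also have "\<dots> = distr (distr ?A M fst) ?S (joint_path \<xi> E)"
      by (simp only: distr_distr[OF X measurable_fst] comp_def)
    also have "distr ?A M fst = M"
      by (rule U.distr_pair_fst)
    finally show "distr Q ?S (joint_path \<xi>' E') = distr M ?S (joint_path \<xi> E)" .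
  qed
  have codeT: "path_code (\<lambda>t. P' t (T z)) = c z" for z
    using path_code_of_code[OF c(2)[of z]] by (simp add: P'_def T_def)
  have codem: "(\<lambda>z. path_code (\<lambda>t. P' t (T z))) \<in> measurable ?A bool_arrays"
    unfolding codeT by (rule c(1))
  have frag: "homogeneous_fragmentation Q (nu \<beta>) P'"
  proof (rule fragmentation_transport[OF N Q])
    show "fragmentation_path (\<lambda>t. P' t w)" if w: "w \<in> space Q" for w
    proof -
      obtain z where "w = T z" using w by (auto simp: Q_def space_image_measure)
      then show ?thesis using fragmentation_path_of_code[OF c(2)[of z]] by (simp add: P'_def T_def)
    qed
    show "(\<lambda>w. path_code (\<lambda>t. P' t w)) \<in> measurable Q bool_arrays"
      unfolding Q_def by (rule measurable_from_image_measure[of "\<lambda>w. path_code (\<lambda>t. P' t w)" T, OF codem])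
    show "distr Q bool_arrays (\<lambda>w. path_code (\<lambda>t. P' t w)) = distr N bool_arrays N.code"
      unfolding Q_def distr_image_measure[of "\<lambda>w. path_code (\<lambda>t. P' t w)" T, OF codem] codeT by (rule c(3))
  qed
  interpret S: beta_sample Q \<beta> \<xi>' E'
    by (intro beta_sample.intro beta_sample_axioms.intro sub M.beta)
  interpret F: beta_fragmentation Q \<beta> P'
    by (intro beta_fragmentation.intro beta_fragmentation_axioms.intro frag M.beta)
  have agree: "AE w in Q. \<forall>i. S.survival_array w i = F.leaf_array 1 w i"
  proof -
    have [measurable]: "Measurable.pred Q (\<lambda>w. S.survival_array w i)" "Measurable.pred Q (\<lambda>w. F.leaf_array 1 w i)" for i
      by (rule measurable_compose[OF S.measurable_survival_array measurable_bool_arrays_coord],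
          rule measurable_compose[OF F.measurable_leaf_array measurable_bool_arrays_coord])
    have ev: "{w \<in> space Q. \<forall>i. S.survival_array w i = F.leaf_array 1 w i} \<in> sets Q" by measurable
    have ST: "S.survival_array (T z) = M.survival_array (fst z)" for z
      by (simp add: S.survival_array_def M.survival_array_def \<xi>'_def E'_def T_def)
    have FT: "F.leaf_array 1 (T z) (k, q) = c z (1, other_label 1 k, q)" for z k q
      by (simp add: F.leaf_array_def F.code_def codeT)
    have "AE z in ?A. \<forall>i. S.survival_array (T z) i = F.leaf_array 1 (T z) i"
      using c(4)
    proof eventually_elim
      case (elim z)
      show ?case
      proof
        fix i :: "nat \<times> rat"
        obtain k q where i: "i = (k, q)" by (cases i)
        show "S.survival_array (T z) i = F.leaf_array 1 (T z) i"
          using elim by (simp only: i ST FT)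
      qed
    qed
    moreover have Tm: "T \<in> measurable ?A Q" unfolding Q_def by (rule measurable_image_measure)
    ultimately have "AE w in distr ?A Q T. \<forall>i. S.survival_array w i = F.leaf_array 1 w i"
      by (subst AE_distr_iff[OF Tm ev])
    moreover have "distr ?A Q T = Q" unfolding Q_def by (rule image_measure_distr[symmetric])
    ultimately show ?thesis by (simp only:)
  qed
  have "AE w in Q. \<forall>n\<ge>2. occupied_gaps \<xi>' E' (n - 1) w = discrete_height P' n 1 w"
    using S.AE_occupied_gaps agree AE_space
  proof eventually_elim
    case (elim w)
    have eq: "S.survival_array w = F.leaf_array 1 w" using elim(2) by (intro ext) blast
    show ?case
    proof (intro allI impI)
      fix n :: nat assume "2 \<le> n"
      then show "occupied_gaps \<xi>' E' (n - 1) w = discrete_height P' n 1 w"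
        using elim(1) F.discrete_height_leaf_array[OF elim(3), of 1 n] by (simp add: eq)
    qed
  qed
  with sub frag show ?thesis by blast
qed

theorem lemmaC1:
  fixes \<beta> :: real
    and M :: "'a measure" and \<xi> :: "real \<Rightarrow> 'a \<Rightarrow> real" and E :: "nat \<Rightarrow> 'a \<Rightarrow> real"
    and N :: "'b measure" and P :: "real \<Rightarrow> 'b \<Rightarrow> nat set set"
  assumes beta: "\<beta> > -2"
    and xi: "sampled_subordinator M (phi \<beta>) \<xi> E"
    and frag: "homogeneous_fragmentation N (nu \<beta>) P"
  shows "(\<forall>n\<ge>2. same_law
            (N \<Otimes>\<^sub>M measure_pmf (pmf_of_set {1..n})) (\<lambda>(\<omega>, j). discrete_height P n j \<omega>)
            M (occupied_gaps \<xi> E (n - 1))) \<and>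
         (\<exists>(Q :: ((real \<Rightarrow> real) \<times> (nat \<Rightarrow> real) \<times> (real \<Rightarrow> nat set set)) measure) \<xi>' E' P'.
            sampled_subordinator Q (phi \<beta>) \<xi>' E' \<and>
            homogeneous_fragmentation Q (nu \<beta>) P' \<and>
            (AE \<omega> in Q. \<forall>n\<ge>2. occupied_gaps \<xi>' E' (n - 1) \<omega> = discrete_height P' n 1 \<omega>))"
proof -
  have M: "beta_sample M \<beta> \<xi> E"
    by (intro beta_sample.intro beta_sample_axioms.intro xi beta)
  have N: "beta_fragmentation N \<beta> P"
    by (intro beta_fragmentation.intro beta_fragmentation_axioms.intro frag beta)
  show ?thesis
    by (intro conjI allI impI height_uniform_leaf[OF M N] gap_height_coupling[OF M N]) simp
qed

end
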